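(* Let $t_0\ge0$, $\ell\ge1$, and let $a_k,g_k$ ($k=1,\dots,\ell$), $b,h:[0,\infty)\to\mathbb R$ be Lebesgue measurable functions such that $a_k,b$ are essentially bounded on $[0,\infty)$; $\sum_{k=1}^{\ell}\operatorname{ess\,sup}_{t\ge t_0}|a_k(t)|\le A_0$ for some constant $A_0<1$; $b(t)\ge0$ for $t\ge t_0$; $0\le t-g_k(t)\le\delta_k$ and $0\le t-h(t)\le\tau$ with constants $\delta_k$ and $\tau>0$; and for each $k$ the set $g_k^{-1}(E)$ has Lebesgue measure zero whenever $E\subset\mathbb R$ has Lebesgue measure zero. Put $S=\sum_{k=1}^{\ell}\|a_k\|_{[t_0,\infty)}$. Assume that $b(t)\ge\beta>0$ for $t\ge t_0$ with a constant $\beta$, and that at least one of the following conditions holds: (i) $\displaystyle\int_{h(t)}^t b(s)\,ds\le\frac1e$ for $t\ge t_0$, and $\displaystyle S+\|b\|_{[t_0,\infty)}\sum_{k=1}^{\ell}\left\|\frac{a_k}{b}\right\|_{[t_0,\infty)}<1$; (ii) $\displaystyle\left(\sum_{k=1}^{\ell}\left\|\frac{a_k}{b_0}\right\|_{[t_0,\infty)}\right)\frac{\|b\|_{[t_0,\infty)}}{1-S}+\left\|\frac{b-b_0}{b_0}\right\|_{[t_0,\infty)}<1$, where $b_0(t)=\min\left\{b(t),\frac1{\tau e}\right\}$; (iii) $\displaystyle\|b\|_{[t_0,\infty)}\left(\sum_{k=1}^{\ell}\left\|\frac{a_k}{b}\right\|_{[t_0,\infty)}+\left\|\left(t-h(t)-\frac1{\|b\|_{[t_0,\infty)}e}\right)^+\right\|_{[t_0,\infty)}\right)<1-S$.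 Then the equation $\dot x(t)-\sum_{k=1}^{\ell}a_k(t)\dot x(g_k(t))=-b(t)x(h(t))$ is exponentially stable.
   Context: Notation: $\|f\|_{[t_0,\infty)}=\operatorname{ess\,sup}_{t\ge t_0}|f(t)|$ (an expression in $t$ inside the norm denotes the corresponding function of $t$); $u^+=\max\{u,0\}$. In integrals over $[h(t),t]$ the coefficient $b$ is taken to be $0$ at negative arguments. Solutions: for an initial point $\sigma\ge t_0$ and bounded Borel measurable functions $\varphi:(-\infty,\sigma]\to\mathbb R$, $\psi:(-\infty,\sigma)\to\mathbb R$ (prescribed independently of each other), a solution of the equation with initial conditions $x(t)=\varphi(t)$ for $t\le\sigma$, $\dot x(t)=\psi(t)$ for $t<\sigma$ is a function $x$ that is absolutely continuous on each $[\sigma,c]$, has locally essentially bounded derivative on $[\sigma,\infty)$, and satisfies the equation for almost all $t\ge\sigma$, where $x$ at arguments $\le\sigma$ is replaced by $\varphi$ and $\dot x$ at arguments $<\sigma$ is replaced by $\psi$. The equation is (uniformly) exponentially stable if there exist $M>0$, $\gamma>0$, not depending on $\sigma\ge t_0$, $\varphi$, $\psi$, such that every such solution satisfies $|x(t)|\le M e^{-\gamma(t-\sigma)}\sup_{s\le\sigma}(|\varphi(s)|+|\psi(s)|)$ for $t\ge\sigma$ (with $\psi(\sigma):=0$). *)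

theory Defs
  imports "HOL-Analysis.Analysis" "HOL-Probability.Essential_Supremum"
begin

definition ess_bounded_on :: "real set \<Rightarrow> (real \<Rightarrow> real) \<Rightarrow> bool" where
  "ess_bounded_on A f \<longleftrightarrow> (\<exists>C. AE t in lebesgue_on A. \<bar>f t\<bar> \<le> C)"

text \<open>The norm \<open>ess sup\<close> of \<open>|f|\<close> over \<open>[t\<^sub>0,\<infinity>)\<close>. It is real-valued, so it is only meaningful
  for measurable, essentially bounded \<open>f\<close>; it takes the value \<open>0\<close> if the essential supremum is
  infinite.\<close>

definition ess_norm :: "real \<Rightarrow> (real \<Rightarrow> real) \<Rightarrow> real" where
  "ess_norm t0 f = real_of_ereal (esssup (lebesgue_on {t0..}) (\<lambda>t. ereal \<bar>f t\<bar>))"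

text \<open>The usual \<open>\<epsilon>\<close>-\<open>\<delta>\<close> condition on finite families of non-overlapping compact
  subintervals \<open>K = [Inf K, Sup K]\<close> of \<open>[p,q]\<close>.\<close>

definition absolutely_continuous_on_Icc :: "real \<Rightarrow> real \<Rightarrow> (real \<Rightarrow> real) \<Rightarrow> bool" where
  "absolutely_continuous_on_Icc p q f \<longleftrightarrow>
     (\<forall>\<epsilon>>0. \<exists>\<delta>>0. \<forall>\<D>. \<D> division_of \<Union>\<D> \<and> \<Union>\<D> \<subseteq> {p..q} \<and> (\<Sum>K\<in>\<D>. Sup K - Inf K) < \<delta>
        \<longrightarrow> (\<Sum>K\<in>\<D>. \<bar>f (Sup K) - f (Inf K)\<bar>) < \<epsilon>)"

text \<open>The values of \<open>\<phi>\<close> outside \<open>(-\<infinity>,\<sigma>]\<close> and of \<open>\<psi>\<close> outside \<open>(-\<infinity>,\<sigma>)\<close> are irrelevant, here and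
  below.\<close>

definition initial_data :: "real \<Rightarrow> (real \<Rightarrow> real) \<Rightarrow> (real \<Rightarrow> real) \<Rightarrow> bool" where
  "initial_data \<sigma> \<phi> \<psi> \<longleftrightarrow>
     \<phi> \<in> borel_measurable (restrict_space borel {..\<sigma>}) \<and> bounded (\<phi> ` {..\<sigma>}) \<and>
     \<psi> \<in> borel_measurable (restrict_space borel {..<\<sigma>}) \<and> bounded (\<psi> ` {..<\<sigma>})"

text \<open>Solutions of
  \<open>x'(t) - (\<Sum>k=1..\<ell>. a\<^sub>k(t) x'(g\<^sub>k(t))) = - b(t) x(h(t))\<close>, \<open>t \<ge> \<sigma>\<close>,
  with initial data \<open>\<phi>\<close>, \<open>\<psi>\<close>. Only the restriction of \<open>x\<close> to \<open>[\<sigma>,\<infinity>)\<close> matters.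
  An absolutely continuous \<open>x\<close> is differentiable almost everywhere, so the arbitrary value of
  \<^const>\<open>deriv\<close> at other points is harmless as long as preimages of null sets under
  \<open>g\<^sub>k\<close> are null sets.\<close>

definition neutral_solution ::
  "nat \<Rightarrow> (nat \<Rightarrow> real \<Rightarrow> real) \<Rightarrow> (nat \<Rightarrow> real \<Rightarrow> real) \<Rightarrow> (real \<Rightarrow> real) \<Rightarrow> (real \<Rightarrow> real)
    \<Rightarrow> real \<Rightarrow> (real \<Rightarrow> real) \<Rightarrow> (real \<Rightarrow> real) \<Rightarrow> (real \<Rightarrow> real) \<Rightarrow> bool" where
  "neutral_solution l a g b h \<sigma> \<phi> \<psi> x \<longleftrightarrow>
     x \<sigma> = \<phi> \<sigma> \<and>
     (\<forall>c>\<sigma>. absolutely_continuous_on_Icc \<sigma> c x) \<and>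
     (\<forall>c>\<sigma>. ess_bounded_on {\<sigma>..c} (deriv x)) \<and>
     (AE t in lebesgue_on {\<sigma>..}.
        deriv x t - (\<Sum>k=1..l. a k t * (if g k t < \<sigma> then \<psi> (g k t) else deriv x (g k t)))
          = - b t * (if h t \<le> \<sigma> then \<phi> (h t) else x (h t)))"

definition exponentially_stable ::
  "real \<Rightarrow> nat \<Rightarrow> (nat \<Rightarrow> real \<Rightarrow> real) \<Rightarrow> (nat \<Rightarrow> real \<Rightarrow> real) \<Rightarrow> (real \<Rightarrow> real) \<Rightarrow> (real \<Rightarrow> real)
    \<Rightarrow> bool" where
  "exponentially_stable t0 l a g b h \<longleftrightarrow>
     (\<exists>M>0. \<exists>\<gamma>>0. \<forall>\<sigma>\<ge>t0. \<forall>\<phi> \<psi> x.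
        initial_data \<sigma> \<phi> \<psi> \<longrightarrow> neutral_solution l a g b h \<sigma> \<phi> \<psi> x \<longrightarrow>
        (\<forall>t\<ge>\<sigma>. \<bar>x t\<bar> \<le> M * exp (- \<gamma> * (t - \<sigma>)) *
           (SUP s\<in>{..\<sigma>}. \<bar>\<phi> s\<bar> + (if s < \<sigma> then \<bar>\<psi> s\<bar> else 0))))"

end

(*
Let E(t) = exp(-gamma (t - sigma)), D the size of the initial data, X = sup |x|/E on [sigma,c] and
nu the essential supremum of |x'|/E there. The equation gives nu <= rho (||b|| (X + D) + S D)/(1 - rho S)
with rho -> 1 as gamma -> 0. Under each of the three conditions the equation is a perturbation of
x'(t) + b1(t) x(eta(t)) = 0 with integral of b1 over [eta(t),t] at most 1/e: take b1 = b, eta = h in (i),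
b1 = b0, eta = h in (ii), and b1 = b, eta(t) = max(h(t), t - 1/(e||b||)) in (iii). For such an equation
nonnegative forcing and nonnegative initial value (with zero history) produce nonnegative solutions,
so that x can be compared with a multiple of E; this bounds X by theta X + const D, where theta tends,
as gamma -> 0, to the quantity that the respective condition requires to be < 1.

As x is only assumed absolutely continuous and its derivative enters through "deriv", one needs that
absolutely continuous functions are differentiable almost everywhere and are controlled by their
derivative; both follow from the Vitali covering theorem.
*)

theory Submission
  imports Defs
begin

section \<open>Absolutely continuous functions\<close>

text \<open>One inequality serves all three conditions: if \<open>\<kappa>0\<close> measures,
  relative to b1, the perturbing terms that involve x', and \<open>\<kappa>2\<close> those that
  involve x, then theta tends to \<open>\<kappa>0 * (bb / (1 - S)) + \<kappa>2\<close>. The factor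
  \<open>bb / (1 - S)\<close> is the price of estimating x' by x. Conditions (i) and (iii) have
  \<open>\<kappa>2 = 0\<close>; in (ii) it is the norm of (b - b0)/b0.

  The obstacle is the history: on [sigma, sigma + Delta] delayed arguments may fall before sigma,
  where phi and psi are prescribed independently, so x'(t) + b1(t) x(eta(t)) is no small
  perturbation there. A crude bound with a growing exponential handles this interval, and the
  barrier has to rise on it before it may decay. Suprema of |x|/E are taken over compact intervals
  and hence are finite, so theta X can be absorbed; the resulting constant does not depend on the
  interval.

  For the primitive B of b1 only B' >= b1 almost everywhere is proved, half of Lebesgue
  differentiation. This is the right half because B enters the comparison through the decreasing
  function exp(-e B).\<close>

abbreviation increment :: "(real \<Rightarrow> real) \<Rightarrow> real set \<Rightarrow> real" where
  "increment f K \<equiv> f (Sup K) - f (Inf K)"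

lemma sum_increment_division:
  fixes f :: "real \<Rightarrow> real"
  assumes "p \<le> q" and D: "\<D> division_of {p..q}"
  shows "(\<Sum>K\<in>\<D>. increment f K) = f q - f p"
proof -
  have K: "Inf K \<in> K" if K: "K \<in> \<D>" for K
  proof -
    obtain u v where uv: "K = cbox u v" using D K by blast
    moreover have "K \<noteq> {}" using D K by blast
    ultimately show ?thesis by auto
  qed
  \<comment> \<open>Tagging each interval with its left endpoint makes the telescoping identity for
    tagged divisions applicable.\<close>
  have "(\<lambda>K. (Inf K, K)) ` \<D> tagged_division_of {p..q}"
  proof (rule tagged_division_ofI)
    show "finite ((\<lambda>K. (Inf K, K)) ` \<D>)" using D by blast
    show "x \<in> K" if "(x, K) \<in> (\<lambda>K. (Inf K, K)) ` \<D>" for x K using that K by auto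
    show "K \<subseteq> {p..q}" if "(x, K) \<in> (\<lambda>K. (Inf K, K)) ` \<D>" for x K using that D by blast
    show "\<exists>a b. K = cbox a b" if "(x, K) \<in> (\<lambda>K. (Inf K, K)) ` \<D>" for x K using that D by blast
    show "interior K1 \<inter> interior K2 = {}"
      if "(x1, K1) \<in> (\<lambda>K. (Inf K, K)) ` \<D>" "(x2, K2) \<in> (\<lambda>K. (Inf K, K)) ` \<D>" "(x1, K1) \<noteq> (x2, K2)"
      for x1 K1 x2 K2 using that division_ofD(5)[OF D, of K1 K2] by auto
    have "{K. \<exists>x. (x, K) \<in> (\<lambda>K. (Inf K, K)) ` \<D>} = \<D>" by auto
    then show "\<Union>{K. \<exists>x. (x, K) \<in> (\<lambda>K. (Inf K, K)) ` \<D>} = {p..q}" using division_ofD(6)[OF D] by simp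
  qed
  from additive_tagged_division_1[OF \<open>p \<le> q\<close> this, of f] show ?thesis
    by (subst (asm) sum.reindex) (auto simp: inj_on_def o_def)
qed

lemma measure_division_Union:
  assumes "\<D> division_of (\<Union>\<D>)"
  shows "measure lebesgue (\<Union>\<D>) = (\<Sum>K\<in>\<D>. increment (\<lambda>t. t) K)"
proof -
  have "(\<Sum>K\<in>\<D>. measure lebesgue K) = (\<Sum>K\<in>\<D>. increment (\<lambda>t. t) K)"
  proof (rule sum.cong[OF refl])
    fix K assume K: "K \<in> \<D>"
    obtain u v where uv: "K = cbox u v" using assms K by blast
    moreover have "K \<noteq> {}" using assms K by blast
    ultimately show "measure lebesgue K = Sup K - Inf K" by auto
  qed
  then show ?thesis using content_division[OF assms] by simp
qed

section \<open>Finite Vitali covers by intervals\<close>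

lemma disjoint_intervals_division:
  assumes "finite \<D>" and "\<And>K. K \<in> \<D> \<Longrightarrow> \<exists>u v::real. u < v \<and> K = {u..v}"
    and "pairwise disjnt \<D>"
  shows "\<D> division_of (\<Union>\<D>)"
proof (rule division_ofI)
  show "\<exists>a b. K = cbox a b" if "K \<in> \<D>" for K using assms(2)[OF that] by auto
  show "K \<noteq> {}" if "K \<in> \<D>" for K using assms(2)[OF that] by auto
  show "interior K1 \<inter> interior K2 = {}" if "K1 \<in> \<D>" "K2 \<in> \<D>" "K1 \<noteq> K2" for K1 K2
  proof -
    have "disjnt K1 K2" using assms(3) that by (auto simp: pairwise_def)
    then show ?thesis using interior_subset unfolding disjnt_def by blast
  qed
qed (use assms in auto)

text \<open>Short intervals around the points of \<open>E\<close> inside \<open>G\<close> form a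
  Vitali cover, so countably many disjoint ones exhaust \<open>E\<close> up to a null set. By
  continuity of measure from above, finitely many of them already leave less than
  \<open>\<epsilon>\<close> uncovered, and only finite families can enter a division.\<close>

lemma Vitali_finite_intervals:
  fixes E G :: "real set" and P :: "real \<Rightarrow> real \<Rightarrow> bool"
  assumes E: "E \<in> lmeasurable" and G: "open G" "E \<subseteq> G" and "\<epsilon> > 0"
    and P: "\<And>t \<eta>. t \<in> E \<Longrightarrow> \<eta> > 0 \<Longrightarrow> \<exists>u v. u < t \<and> t < v \<and> v - u < \<eta> \<and> P u v"
  obtains \<D> where "finite \<D>" "\<And>K. K \<in> \<D> \<Longrightarrow> \<exists>u v. u < v \<and> K = {u..v} \<and> P u v \<and> K \<subseteq> G"
    "pairwise disjnt \<D>" "measure lebesgue (E - \<Union>\<D>) < \<epsilon>"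
proof -
  define I where "I = {(u, v). u < v \<and> P u v \<and> {u..v} \<subseteq> G}"
  \<comment> \<open>Midpoint and half-length present the intervals as closed balls, the form in
    which the covering theorem is stated.\<close>
  define m where "m = (\<lambda>(u, v). (u + v) / 2 :: real)"
  define r where "r = (\<lambda>(u, v). (v - u) / 2 :: real)"
  have ball: "cball (m i) (r i) = {fst i..snd i}" if "fst i < snd i" for i
    using that by (auto simp: m_def r_def case_prod_beta cball_eq_atLeastAtMost field_simps)
  have cov: "\<exists>i. i \<in> I \<and> t \<in> cball (m i) (r i) \<and> r i < d" if t: "t \<in> E" and "d > 0" for t d
  proof -
    obtain e where e: "e > 0" "ball t e \<subseteq> G" using G t open_contains_ball by (metis subsetD)
    obtain u v where uv: "u < t" "t < v" "v - u < min d e" "P u v"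
      using P[OF t, of "min d e"] \<open>d > 0\<close> e by auto
    have "{u..v} \<subseteq> ball t e" using uv by (auto simp: dist_real_def)
    then have "(u, v) \<in> I" using uv e by (auto simp: I_def)
    moreover have "t \<in> cball (m (u, v)) (r (u, v))" using uv by (subst ball) auto
    moreover have "r (u, v) < d" using uv by (auto simp: r_def)
    ultimately show ?thesis by blast
  qed
  have "0 < r i" if "i \<in> I" for i using that by (auto simp: I_def r_def)
  from Vitali_covering_theorem_cballs[of I r E m, OF this cov]
  obtain C where C: "countable C" "C \<subseteq> I"
     "pairwise (\<lambda>i j. disjnt (cball (m i) (r i)) (cball (m j) (r j))) C"
     "negligible (E - (\<Union>i\<in>C. cball (m i) (r i)))" by auto
  define J where "J = (\<lambda>i::real \<times> real. {fst i..snd i})"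
  have JC: "cball (m i) (r i) = J i" if "i \<in> C" for i
    using ball that C(2) by (force simp: I_def J_def)
  have neg: "negligible (E - (\<Union>i\<in>C. J i))" using C(4) JC by simp
  have pw: "pairwise (\<lambda>i j. disjnt (J i) (J j)) C"
    using C(3) JC by (auto simp: pairwise_def)
  have "\<exists>F. finite F \<and> F \<subseteq> C \<and> measure lebesgue (E - (\<Union>i\<in>F. J i)) < \<epsilon>"
  proof (cases "C = {}")
    case True
    then show ?thesis using neg \<open>\<epsilon> > 0\<close> by (auto simp: negligible_imp_measure0)
  next
    case False
    define c where "c = from_nat_into C"
    have c: "range c = C" using False C(1) by (simp add: c_def)
    define A where "A n = E - (\<Union>i\<in>c ` {..<n}. J i)" for n
    have Jm: "J i \<in> sets lebesgue" for i by (simp add: J_def)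
    have Am: "A n \<in> lmeasurable" for n
      unfolding A_def using Jm E by (intro fmeasurable_Diff) auto
    have "(\<lambda>n. measure lebesgue (A n)) \<longlonglongrightarrow> measure lebesgue (\<Inter>n. A n)"
    proof (rule Lim_measure_decseq)
      show "range A \<subseteq> sets lebesgue" using Am by (auto simp: fmeasurableD)
      show "decseq A" by (auto simp: decseq_def A_def)
      show "emeasure lebesgue (A n) \<noteq> \<infinity>" for n using fmeasurableD2[OF Am[of n]] by simp
    qed
    moreover have "(\<Inter>n. A n) = E - (\<Union>i\<in>C. J i)" 
      unfolding A_def c[symmetric]
    proof (intro equalityI subsetI)
      fix x assume x: "x \<in> (\<Inter>n. E - (\<Union>i\<in>c ` {..<n}. J i))"
      then have "x \<notin> J (c n)" for n using INT_D[OF x, of "Suc n"] by blast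
      then show "x \<in> E - (\<Union>i\<in>range c. J i)" using x by blast
    qed blast
    ultimately have "(\<lambda>n. measure lebesgue (A n)) \<longlonglongrightarrow> 0"
      using neg by (simp add: negligible_imp_measure0)
    then have "\<forall>\<^sub>F n in sequentially. measure lebesgue (A n) < \<epsilon>"
      using \<open>\<epsilon> > 0\<close> by (rule order_tendstoD)
    then obtain n where "measure lebesgue (A n) < \<epsilon>" by (auto simp: eventually_sequentially)
    then show ?thesis using c unfolding A_def by (intro exI[of _ "c ` {..<n}"]) auto
  qed
  then obtain F where F: "finite F" "F \<subseteq> C" "measure lebesgue (E - (\<Union>i\<in>F. J i)) < \<epsilon>" by blast
  show ?thesis
  proof (rule that[of "J ` F"])
    show "\<exists>u v. u < v \<and> K = {u..v} \<and> P u v \<and> K \<subseteq> G" if "K \<in> J ` F" for K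
      using that F(2) C(2) by (auto simp: J_def I_def)
    show "pairwise disjnt (J ` F)"
      using pairwise_subset[OF pw F(2)] unfolding pairwise_image by (rule pairwise_mono) auto
  qed (use F in auto)
qed

section \<open>Slopes over intervals around a point, and absolute continuity\<close>

lemma absolutely_continuous_increment:
  assumes "absolutely_continuous_on_Icc p q f" and "\<epsilon> > 0"
  obtains \<delta> where "\<delta> > 0"
    "\<And>\<D>. \<D> division_of \<Union>\<D> \<Longrightarrow> \<Union>\<D> \<subseteq> {p..q} \<Longrightarrow> (\<Sum>K\<in>\<D>. increment (\<lambda>t. t) K) < \<delta> \<Longrightarrow>
       (\<Sum>K\<in>\<D>. \<bar>increment f K\<bar>) < \<epsilon>"
  using assms unfolding absolutely_continuous_on_Icc_def by meson

text \<open>Only intervals \<open>[u,v]\<close> with \<open>u < t < v\<close> are considered, so that the points at which small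
  slopes of a given kind occur form a \<open>G\<^sub>\<delta>\<close> set, whatever \<open>f\<close> is.\<close>

definition frequently_slope :: "(real \<Rightarrow> real) \<Rightarrow> (real \<Rightarrow> bool) \<Rightarrow> real \<Rightarrow> bool" where
  "frequently_slope f Q t \<longleftrightarrow>
     (\<forall>\<eta>>0. \<exists>u v. u < t \<and> t < v \<and> v - u < \<eta> \<and> Q ((f v - f u) / (v - u)))"

lemma frequently_slope_borel: "{t. frequently_slope f Q t} \<in> sets borel"
proof -
  define S where "S n = (\<Union>(u, v)\<in>{(u, v). v - u < inverse (real (Suc n)) \<and> Q ((f v - f u) / (v - u))}. {u<..<v})" for n
  have S: "t \<in> S n \<longleftrightarrow> (\<exists>u v. u < t \<and> t < v \<and> v - u < inverse (real (Suc n)) \<and> Q ((f v - f u) / (v - u)))" for t n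
    unfolding S_def by (auto simp del: of_nat_Suc)
  have "frequently_slope f Q t \<longleftrightarrow> (\<forall>n. t \<in> S n)" for t
  proof
    assume "frequently_slope f Q t"
    then show "\<forall>n. t \<in> S n"
      unfolding frequently_slope_def S by (metis inverse_positive_iff_positive of_nat_0_less_iff zero_less_Suc)
  next
    assume *: "\<forall>n. t \<in> S n"
    show "frequently_slope f Q t" unfolding frequently_slope_def
    proof (intro allI impI)
      fix \<eta> :: real assume "\<eta> > 0"
      then obtain n where n: "inverse (real (Suc n)) < \<eta>" using reals_Archimedean by blast
      from * have "t \<in> S n" ..
      with n show "\<exists>u v. u < t \<and> t < v \<and> v - u < \<eta> \<and> Q ((f v - f u) / (v - u))"
        unfolding S by (meson less_trans)
    qed
  qed
  then have "{t. frequently_slope f Q t} = (\<Inter>n. S n)"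
    by blast
  also have "\<dots> \<in> sets borel"
    unfolding S_def by (intro sets.countable_INT'' borel_open open_UN) auto
  finally show ?thesis .
qed

text \<open>The disjoint intervals \<open>\<D>\<close> are completed to a division of
  \<open>{c..d}\<close> so that increments over \<open>\<D>\<close> and over
  \<open>\<D>' - \<D>\<close> add up to the increment over \<open>{c..d}\<close>. When
  \<open>E\<close> fills \<open>{c..d}\<close> up to a null set, the complementary part has total
  length below \<open>\<epsilon>\<close>, and there absolute continuity takes over.\<close>

lemma Vitali_division:
  fixes E :: "real set" and P :: "real \<Rightarrow> real \<Rightarrow> bool"
  assumes "c < d" and E: "E \<in> lmeasurable" and "\<epsilon> > 0"
    and P: "\<And>t \<eta>. t \<in> E \<Longrightarrow> c < t \<Longrightarrow> t < d \<Longrightarrow> \<eta> > 0 \<Longrightarrow> \<exists>u v. u < t \<and> t < v \<and> v - u < \<eta> \<and> P u v"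
  obtains \<D> \<D>' where "\<D> \<subseteq> \<D>'" "\<D>' division_of {c..d}"
    "\<And>K. K \<in> \<D> \<Longrightarrow> \<exists>u v. u < v \<and> K = {u..v} \<and> P u v"
    "measure lebesgue (E \<inter> {c..d}) - \<epsilon> < (\<Sum>K\<in>\<D>. increment (\<lambda>t. t) K)"
proof -
  \<comment> \<open>Removing the two endpoints costs no measure and places the set inside an open
    interval, as the covering lemma demands.\<close>
  define E' where "E' = E \<inter> {c<..<d}"
  have E': "E' \<in> lmeasurable" unfolding E'_def using E by (intro fmeasurable_Int_fmeasurable) auto
  have EE': "measure lebesgue (E \<inter> {c..d}) = measure lebesgue E'"
  proof (rule measure_negligible_symdiff)
    show "E' \<in> lmeasurable" by (fact E')
    have "(E' - E \<inter> {c..d}) \<union> (E \<inter> {c..d} - E') \<subseteq> {c, d}" by (auto simp: E'_def)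
    then show "negligible ((E' - E \<inter> {c..d}) \<union> (E \<inter> {c..d} - E'))"
      using negligible_subset by (metis finite.emptyI finite.insertI negligible_finite)
  qed
  obtain \<D> where D: "finite \<D>"
    "\<And>K. K \<in> \<D> \<Longrightarrow> \<exists>u v. u < v \<and> K = {u..v} \<and> P u v \<and> K \<subseteq> {c<..<d}"
    "pairwise disjnt \<D>" "measure lebesgue (E' - \<Union>\<D>) < \<epsilon>"
    using Vitali_finite_intervals[OF E' open_greaterThanLessThan _ \<open>\<epsilon> > 0\<close>, of c d P] P
    unfolding E'_def by auto
  have div: "\<D> division_of \<Union>\<D>"
    using disjoint_intervals_division[OF D(1) _ D(3)] D(2) by blast
  have "\<Union>\<D> \<subseteq> cbox c d" using D(2) by fastforce
  from partial_division_extend_interval[OF div this]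
  obtain \<D>' where D': "\<D> \<subseteq> \<D>'" "\<D>' division_of {c..d}"
    unfolding box_real by blast
  have U: "\<Union>\<D> \<in> lmeasurable" using div by (rule lmeasurable_division)
  have "measure lebesgue E' \<le> measure lebesgue ((E' - \<Union>\<D>) \<union> \<Union>\<D>)"
    using E' U by (intro measure_mono_fmeasurable) (auto intro: fmeasurable_Diff)
  also have "\<dots> \<le> measure lebesgue (E' - \<Union>\<D>) + measure lebesgue (\<Union>\<D>)"
    using E' U by (intro measure_Un_le) (auto intro: fmeasurableD)
  finally show ?thesis
    using that[OF D'] D(2,4) EE' measure_division_Union[OF div] by fastforce
qed

text \<open>Because \<open>t\<close> lies between \<open>u\<close> and \<open>v\<close>, the
  one-sided errors \<open>\<epsilon> * (t - u)\<close> and \<open>\<epsilon> * (v - t)\<close> add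
  up to exactly \<open>\<epsilon> * (v - u)\<close>.\<close>

lemma DERIV_imp_slope_close:
  fixes f :: "real \<Rightarrow> real"
  assumes "(f has_real_derivative D) (at t)" and "\<epsilon> > 0"
  obtains \<eta> where "\<eta> > 0" 
    "\<And>u v. u < t \<Longrightarrow> t < v \<Longrightarrow> v - u < \<eta> \<Longrightarrow> \<bar>(f v - f u) / (v - u) - D\<bar> \<le> \<epsilon>"
proof -
  from assms obtain \<eta> where \<eta>: "\<eta> > 0" 
    "\<And>y. norm (y - t) < \<eta> \<Longrightarrow> norm (f y - f t - D * (y - t)) \<le> \<epsilon> * norm (y - t)"
    unfolding has_field_derivative_def has_derivative_at_alt by blast
  show ?thesis
  proof (rule that[OF \<eta>(1)])
    fix u v assume uv: "u < t" "t < v" "v - u < \<eta>"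
    have "\<bar>f u - f t - D * (u - t)\<bar> \<le> \<epsilon> * (t - u)" "\<bar>f v - f t - D * (v - t)\<bar> \<le> \<epsilon> * (v - t)"
      using \<eta>(2)[of u] \<eta>(2)[of v] uv by auto
    then have "\<bar>f v - f u - D * (v - u)\<bar> \<le> \<epsilon> * (v - u)" by (simp add: algebra_simps)
    moreover have "(f v - f u) / (v - u) - D = (f v - f u - D * (v - u)) / (v - u)"
      using uv by (simp add: field_simps)
    ultimately show "\<bar>(f v - f u) / (v - u) - D\<bar> \<le> \<epsilon>"
      using uv by (simp add: abs_divide pos_divide_le_eq)
  qed
qed

lemma frequently_slope_less:
  assumes "(f has_real_derivative D) (at t)" and "D < p"
  shows "frequently_slope f (\<lambda>s. s < p) t"
  unfolding frequently_slope_def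
proof (intro allI impI)
  fix \<eta> :: real assume "\<eta> > 0"
  obtain \<eta>' where \<eta>': "\<eta>' > 0" 
    "\<And>u v. u < t \<Longrightarrow> t < v \<Longrightarrow> v - u < \<eta>' \<Longrightarrow> \<bar>(f v - f u) / (v - u) - D\<bar> \<le> (p - D) / 2"
    using DERIV_imp_slope_close[OF assms(1), of "(p - D) / 2"] assms(2) by auto
  define e where "e = min \<eta> \<eta>' / 3"
  have e: "e > 0" "2 * e < \<eta>" "2 * e < \<eta>'" using \<open>\<eta> > 0\<close> \<eta>'(1) by (auto simp: e_def)
  have "(f (t + e) - f (t - e)) / ((t + e) - (t - e)) < p"
  proof -
    have "\<bar>(f (t + e) - f (t - e)) / ((t + e) - (t - e)) - D\<bar> \<le> (p - D) / 2"
      using e by (intro \<eta>'(2)) auto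
    then show ?thesis using assms(2) by argo
  qed
  then show "\<exists>u v. u < t \<and> t < v \<and> v - u < \<eta> \<and> (f v - f u) / (v - u) < p"
    using e by (intro exI[of _ "t - e"] exI[of _ "t + e"]) auto
qed

text \<open>Intervals of slope below \<open>p + \<epsilon>\<close> cover almost all of
  \<open>{c..d}\<close>; the remaining ones have total length below \<open>\<delta>\<close>, so
  absolute continuity makes their contribution smaller than \<open>\<epsilon>\<close>. This replaces
  the mean value theorem when the derivative is known only off a null set.\<close>

lemma absolutely_continuous_increment_le:
  assumes ac: "absolutely_continuous_on_Icc c d f" and "c \<le> d" and N: "negligible N"
    and D: "\<And>t. c < t \<Longrightarrow> t < d \<Longrightarrow> t \<notin> N \<Longrightarrow> \<exists>D\<le>p. (f has_real_derivative D) (at t)"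
  shows "f d - f c \<le> p * (d - c)"
proof (cases "c = d")
  case False
  then have "c < d" using \<open>c \<le> d\<close> by simp
  \<comment> \<open>The error collects \<open>\<epsilon> * (d - c)\<close> from the slope bound
    \<open>p + \<epsilon>\<close>, \<open>\<bar>p\<bar> * \<epsilon>\<close> from the uncovered
    length \<open>\<rho>\<close>, and \<open>\<epsilon>\<close> from the increment over the
    uncovered part.\<close>
  have *: "f d - f c \<le> p * (d - c) + \<epsilon> * (\<bar>p\<bar> + (d - c) + 1)" if "\<epsilon> > 0" for \<epsilon>
  proof -
    obtain \<delta> where \<delta>: "\<delta> > 0"
      "\<And>\<D>. \<D> division_of \<Union>\<D> \<Longrightarrow> \<Union>\<D> \<subseteq> {c..d} \<Longrightarrow> (\<Sum>K\<in>\<D>. increment (\<lambda>t. t) K) < \<delta> \<Longrightarrow>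
         (\<Sum>K\<in>\<D>. \<bar>increment f K\<bar>) < \<epsilon>"
      using absolutely_continuous_increment[OF ac \<open>\<epsilon> > 0\<close>] by blast
    define e where "e = min \<epsilon> \<delta>"
    have e: "e > 0" "e \<le> \<epsilon>" "e \<le> \<delta>" using \<open>\<epsilon> > 0\<close> \<delta> by (auto simp: e_def)
    define E where "E = {c<..<d} - N"
    have E: "E \<in> lmeasurable" unfolding E_def
      using N by (intro fmeasurable_Diff) (auto simp: negligible_iff_null_sets null_setsD2)
    have "measure lebesgue (E \<inter> {c..d}) = measure lebesgue {c..d}"
    proof (rule measure_negligible_symdiff)
      have "sym_diff {c..d} (E \<inter> {c..d}) \<subseteq> insert c (insert d N)" by (auto simp: E_def)
      then show "negligible (sym_diff {c..d} (E \<inter> {c..d}))"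
        using N negligible_subset by (metis negligible_insert)
    qed auto
    then have mE: "measure lebesgue (E \<inter> {c..d}) = d - c" using \<open>c < d\<close> by simp
    have "\<exists>u v. u < t \<and> t < v \<and> v - u < \<eta> \<and> (f v - f u) / (v - u) < p + \<epsilon>"
      if t: "t \<in> E" "c < t" "t < d" "\<eta> > 0" for t \<eta>
    proof -
      obtain D where "D \<le> p" "(f has_real_derivative D) (at t)"
        using D[of t] t unfolding E_def by auto
      then have "frequently_slope f (\<lambda>s. s < p + \<epsilon>) t"
        using \<open>\<epsilon> > 0\<close> by (intro frequently_slope_less) auto
      then show ?thesis using t by (simp add: frequently_slope_def)
    qed
    from Vitali_division[OF \<open>c < d\<close> E e(1), of "\<lambda>u v. (f v - f u) / (v - u) < p + \<epsilon>", OF this]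
    obtain \<D> \<D>' where DD: "\<D> \<subseteq> \<D>'" "\<D>' division_of {c..d}"
      "\<And>K. K \<in> \<D> \<Longrightarrow> \<exists>u v. u < v \<and> K = {u..v} \<and> (f v - f u) / (v - u) < p + \<epsilon>"
      "d - c - e < (\<Sum>K\<in>\<D>. increment (\<lambda>t. t) K)"
      unfolding mE by blast
    define R where "R = \<D>' - \<D>"
    have fin: "finite \<D>'" using DD(2) by blast
    have Rdiv: "R division_of \<Union>R"
      using division_of_subset[OF division_of_union_self[OF DD(2)]] by (auto simp: R_def)
    have Rsub: "\<Union>R \<subseteq> {c..d}" using DD(2) by (auto simp: R_def)
    have split: "(\<Sum>K\<in>\<D>. increment h K) + (\<Sum>K\<in>R. increment h K) = h d - h c" for h
      using sum.subset_diff[OF DD(1) fin] sum_increment_division[OF \<open>c \<le> d\<close> DD(2), of h]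
      by (metis R_def add.commute)
    have Rlt: "(\<Sum>K\<in>R. increment (\<lambda>t. t) K) < e"
      using split[of "\<lambda>t. t"] DD(4) by linarith
    have "(\<Sum>K\<in>R. \<bar>increment f K\<bar>) < \<epsilon>" using Rlt e by (intro \<delta>(2)[OF Rdiv Rsub]) linarith
    then have R1: "(\<Sum>K\<in>R. increment f K) < \<epsilon>"
      using sum_abs[of "increment f" R] by linarith
    define \<rho> where "\<rho> = (\<Sum>K\<in>R. increment (\<lambda>t. t) K)"
    have "0 \<le> \<rho>"
      using measure_division_Union[OF Rdiv] measure_nonneg unfolding \<rho>_def by metis
    then have R2: "\<bar>\<rho>\<bar> \<le> \<epsilon>" using Rlt e by (simp add: \<rho>_def)
    have "(\<Sum>K\<in>\<D>. increment f K) \<le> (\<Sum>K\<in>\<D>. (p + \<epsilon>) * increment (\<lambda>t. t) K)"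
      using DD(3) by (intro sum_mono) (fastforce simp: field_simps)
    also have "\<dots> = (p + \<epsilon>) * (\<Sum>K\<in>\<D>. increment (\<lambda>t. t) K)" by (simp only: sum_distrib_left)
    also have "(\<Sum>K\<in>\<D>. increment (\<lambda>t. t) K) = d - c - \<rho>" using split[of "\<lambda>t. t"] by (simp add: \<rho>_def)
    \<comment> \<open>The sign of \<open>p\<close> is unknown, so shortening the length by
      \<open>\<rho>\<close> may increase the product; \<open>\<bar>p\<bar> * \<epsilon>\<close> pays
      for that.\<close>
    also have "(p + \<epsilon>) * (d - c - \<rho>) \<le> (p + \<epsilon>) * (d - c) + \<bar>p\<bar> * \<epsilon>"
    proof -
      have "- (p * \<rho>) \<le> \<bar>p\<bar> * \<bar>\<rho>\<bar>" unfolding abs_mult[symmetric] by simp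
      also have "\<dots> \<le> \<bar>p\<bar> * \<epsilon>" using R2 by (intro mult_left_mono) auto
      finally have "- (p * \<rho>) \<le> \<bar>p\<bar> * \<epsilon>" .
      moreover have "0 \<le> \<epsilon> * \<rho>" using \<open>0 \<le> \<rho>\<close> \<open>\<epsilon> > 0\<close> by simp
      ultimately show ?thesis by (simp add: algebra_simps)
    qed
    finally have "(\<Sum>K\<in>\<D>. increment f K) \<le> (p + \<epsilon>) * (d - c) + \<bar>p\<bar> * \<epsilon>" .
    then have "f d - f c \<le> (p + \<epsilon>) * (d - c) + \<bar>p\<bar> * \<epsilon> + \<epsilon>" using split[of f] R1 by linarith
    then show ?thesis by (simp add: algebra_simps)
  qed
  show ?thesis
  proof (rule field_le_epsilon)
    fix e :: real assume "e > 0"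
    define k where "k = \<bar>p\<bar> + (d - c) + 1"
    have "k > 0" using \<open>c < d\<close> by (simp add: k_def)
    then show "f d - f c \<le> p * (d - c) + e" 
      using *[of "e / k"] \<open>e > 0\<close> by (simp flip: k_def)
  qed
qed simp

section \<open>Differentiability almost everywhere\<close>

text \<open>Covers the points with slopes below \<open>p\<close> by intervals, and the points with slopes above
  \<open>q\<close> by smaller intervals inside them. Up to a set of small measure both families have the same
  union, so by absolute continuity \<open>f\<close> has nearly the same total increment over both.\<close>

lemma slope_gap_negligible:
  assumes ac: "absolutely_continuous_on_Icc c d f" and "p < q"
  shows "negligible {t \<in> {c<..<d}. frequently_slope f (\<lambda>s. s < p) t \<and> frequently_slope f (\<lambda>s. s > q) t}"
    (is "negligible ?E")
proof -
  define E where "E = ?E"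
  have "E = {c<..<d} \<inter> {t. frequently_slope f (\<lambda>s. s < p) t} \<inter> {t. frequently_slope f (\<lambda>s. s > q) t}"
    by (auto simp: E_def)
  then have E: "E \<in> lmeasurable"
    using frequently_slope_borel
    by (intro bounded_set_imp_lmeasurable) (auto intro!: sets.Int intro: bounded_subset[of "{c<..<d}"])
  define m where "m = measure lebesgue E"
  \<comment> \<open>The three summands come from the increment of \<open>f\<close> over the leftover
    \<open>\<R>\<close>, from its length \<open>\<rho> \<le> 3 * e\<close>, and from
    \<open>T \<ge> m - 2 * e\<close> for the total length of the first family.\<close>
  have main: "(q - p) * m \<le> \<epsilon> * (1 + 3 * \<bar>q\<bar> + 2 * (q - p))" if "\<epsilon> > 0" for \<epsilon>
  proof -
    obtain \<delta> where \<delta>: "\<delta> > 0"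
      "\<And>\<D>. \<D> division_of \<Union>\<D> \<Longrightarrow> \<Union>\<D> \<subseteq> {c..d} \<Longrightarrow> (\<Sum>K\<in>\<D>. increment (\<lambda>t. t) K) < \<delta> \<Longrightarrow>
         (\<Sum>K\<in>\<D>. \<bar>increment f K\<bar>) < \<epsilon>"
      using absolutely_continuous_increment[OF ac \<open>\<epsilon> > 0\<close>] by blast
    define e where "e = min \<epsilon> (\<delta> / 4)"
    have e: "e > 0" "e \<le> \<epsilon>" "3 * e < \<delta>" using \<open>\<epsilon> > 0\<close> \<delta> by (auto simp: e_def)
    \<comment> \<open>Keeping the first family inside an open set that exceeds \<open>E\<close> by
      less than \<open>e\<close> bounds its total length by \<open>m + e\<close>, so it contains
      little besides points of \<open>E\<close>.\<close>
    obtain G0 where G0: "open G0" "E \<subseteq> G0" "G0 - E \<in> lmeasurable" "emeasure lebesgue (G0 - E) < ennreal e"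
      using sets_lebesgue_outer_open[of E e] E e by auto
    define G where "G = G0 \<inter> {c<..<d}"
    have G: "open G" "E \<subseteq> G" "G \<subseteq> {c<..<d}" using G0 by (auto simp: G_def E_def)
    have Gm: "G \<in> lmeasurable" using G by (intro bounded_set_imp_lmeasurable) (auto intro: bounded_subset[of "{c<..<d}"])
    have "measure lebesgue (G0 - E) < e"
      using G0(3,4) e by (simp add: emeasure_eq_measure2 ennreal_less_iff)
    moreover have "measure lebesgue (G - E) \<le> measure lebesgue (G0 - E)"
      using G0(3) E Gm by (intro measure_mono_fmeasurable) (auto simp: G_def)
    moreover have "measure lebesgue G = measure lebesgue (G - E) + m"
      unfolding m_def using Gm E G by (subst measurable_measure_Diff) auto
    ultimately have mG: "measure lebesgue G \<le> m + e" by linarith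
    have lo: "\<exists>u v. u < t \<and> t < v \<and> v - u < \<eta> \<and> (f v - f u) / (v - u) < p" 
      and hi: "\<exists>u v. u < t \<and> t < v \<and> v - u < \<eta> \<and> q < (f v - f u) / (v - u)" 
      if "t \<in> E" "\<eta> > 0" for t \<eta>
      using that by (auto simp: E_def frequently_slope_def)
    from Vitali_finite_intervals[OF E G(1,2) e(1), of "\<lambda>u v. (f v - f u) / (v - u) < p", OF lo]
    obtain \<D> where D: "finite \<D>"
      "\<And>K. K \<in> \<D> \<Longrightarrow> \<exists>u v. u < v \<and> K = {u..v} \<and> (f v - f u) / (v - u) < p \<and> K \<subseteq> G"
      "pairwise disjnt \<D>" "measure lebesgue (E - \<Union>\<D>) < e"
      by blast
    have div: "\<D> division_of \<Union>\<D>"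
      using disjoint_intervals_division[OF D(1) _ D(3)] D(2) by blast
    define T where "T = (\<Sum>K\<in>\<D>. increment (\<lambda>t. t) K)"
    have T: "T \<le> m + e"
    proof -
      have "T = measure lebesgue (\<Union>\<D>)" using measure_division_Union[OF div] by (simp add: T_def)
      also have "\<dots> \<le> measure lebesgue G"
        using D(2) Gm lmeasurable_division[OF div] by (intro measure_mono_fmeasurable) auto
      finally show ?thesis using mG by linarith
    qed
    \<comment> \<open>One \<open>e1\<close> is lost in every interval of \<open>\<D>\<close>, at
      most \<open>e\<close> in total; the summand 1 keeps the divisor positive for empty
      \<open>\<D>\<close>.\<close>
    define e1 where "e1 = e / real (card \<D> + 1)"
    have e1: "e1 > 0" "real (card \<D>) * e1 \<le> e" using e by (auto simp: e1_def field_simps)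
    \<comment> \<open>\<open>R\<close> is what remains of \<open>K\<close> after removing the
      second-family intervals, whose slopes exceed \<open>q\<close>. The last clause is the slope
      bound for the removed part, written through its complement.\<close>
    define good where "good K R \<longleftrightarrow> R division_of \<Union>R \<and> \<Union>R \<subseteq> K \<and>
        (\<Sum>J\<in>R. increment (\<lambda>t. t) J) \<le> increment (\<lambda>t. t) K - measure lebesgue (E \<inter> K) + e1 \<and>
        q * (increment (\<lambda>t. t) K - (\<Sum>J\<in>R. increment (\<lambda>t. t) J))
          \<le> increment f K - (\<Sum>J\<in>R. increment f J)" for K R
    have "\<exists>R. good K R" if K: "K \<in> \<D>" for K
    proof -
      obtain u v where uv: "u < v" "K = {u..v}" using D(2)[OF K] by blast
      from Vitali_division[OF uv(1) E e1(1), of "\<lambda>u v. (f v - f u) / (v - u) > q", OF hi]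
      obtain \<J> \<J>' where J: "\<J> \<subseteq> \<J>'" "\<J>' division_of {u..v}"
        "\<And>K. K \<in> \<J> \<Longrightarrow> \<exists>u v. u < v \<and> K = {u..v} \<and> q < (f v - f u) / (v - u)"
        "measure lebesgue (E \<inter> {u..v}) - e1 < (\<Sum>K\<in>\<J>. increment (\<lambda>t. t) K)"
        by blast
      have fin: "finite \<J>'" using J(2) by blast
      have split: "(\<Sum>K\<in>\<J>. increment h K) + (\<Sum>K\<in>\<J>' - \<J>. increment h K) = increment h K" for h
        using sum.subset_diff[OF J(1) fin, of "increment h"] uv
          sum_increment_division[OF less_imp_le[OF uv(1)] J(2), of h] by simp
      have "q * (\<Sum>K\<in>\<J>. increment (\<lambda>t. t) K) \<le> (\<Sum>K\<in>\<J>. increment f K)"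
        unfolding sum_distrib_left using J(3) by (intro sum_mono) (fastforce simp: field_simps)
      then have "q * (increment (\<lambda>t. t) K - (\<Sum>J\<in>\<J>' - \<J>. increment (\<lambda>t. t) J))
          \<le> increment f K - (\<Sum>J\<in>\<J>' - \<J>. increment f J)"
        using split[of f] split[of "\<lambda>t. t"] by (smt (verit))
      moreover have "(\<J>' - \<J>) division_of \<Union>(\<J>' - \<J>)"
        using division_of_subset[OF division_of_union_self[OF J(2)]] by auto
      moreover have "\<Union>(\<J>' - \<J>) \<subseteq> K" using J(2) uv by auto
      moreover have "(\<Sum>J\<in>\<J>' - \<J>. increment (\<lambda>t. t) J) \<le> increment (\<lambda>t. t) K - measure lebesgue (E \<inter> K) + e1"
        using split[of "\<lambda>t. t"] J(4) uv by simp
      ultimately show ?thesis unfolding good_def by blast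
    qed
    then obtain R where good: "\<And>K. K \<in> \<D> \<Longrightarrow> good K (R K)" by metis
    then have R: "\<And>K. K \<in> \<D> \<Longrightarrow> R K division_of \<Union>(R K)" "\<And>K. K \<in> \<D> \<Longrightarrow> \<Union>(R K) \<subseteq> K"
       "\<And>K. K \<in> \<D> \<Longrightarrow> (\<Sum>J\<in>R K. increment (\<lambda>t. t) J) \<le> increment (\<lambda>t. t) K - measure lebesgue (E \<inter> K) + e1"
       "\<And>K. K \<in> \<D> \<Longrightarrow> q * (increment (\<lambda>t. t) K - (\<Sum>J\<in>R K. increment (\<lambda>t. t) J))
          \<le> increment f K - (\<Sum>J\<in>R K. increment f J)"
      unfolding good_def by blast+
    define \<R> where "\<R> = (\<Union>K\<in>\<D>. R K)"
    have disj: "J \<inter> J' = {}" if "K \<in> \<D>" "K' \<in> \<D>" "K \<noteq> K'" "J \<in> R K" "J' \<in> R K'" for J J' K K'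
    proof -
      have "disjnt K K'" using D(3) that by (auto simp: pairwise_def)
      moreover have "J \<subseteq> K" "J' \<subseteq> K'" using R(2) that by blast+
      ultimately show ?thesis unfolding disjnt_def by blast
    qed
    have ne: "J \<noteq> {}" if "K \<in> \<D>" "J \<in> R K" for J K using R(1) that by blast
    have Rsum: "(\<Sum>J\<in>\<R>. h J) = (\<Sum>K\<in>\<D>. \<Sum>J\<in>R K. h J)" for h :: "real set \<Rightarrow> real"
      unfolding \<R>_def
    proof (rule sum.UNION_disjoint[OF D(1)])
      show "\<forall>K\<in>\<D>. finite (R K)" using R(1) by blast
      show "\<forall>K\<in>\<D>. \<forall>K'\<in>\<D>. K \<noteq> K' \<longrightarrow> R K \<inter> R K' = {}"
      proof (intro ballI impI equals0I)
        fix K K' J assume "K \<in> \<D>" "K' \<in> \<D>" "K \<noteq> K'" "J \<in> R K \<inter> R K'"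
        then show False using disj[of K K' J J] ne[of K J] by auto
      qed
    qed
    have Rdiv: "\<R> division_of \<Union>\<R>"
    proof (rule division_ofI)
      show "finite \<R>" unfolding \<R>_def using D(1) R(1) by (intro finite_UN_I) auto
      show "K \<noteq> {}" "\<exists>a b. K = cbox a b" if "K \<in> \<R>" for K
        using that R(1) unfolding \<R>_def by blast+
      show "interior J \<inter> interior J' = {}" if JJ: "J \<in> \<R>" "J' \<in> \<R>" "J \<noteq> J'" for J J'
      proof -
        obtain K K' where K: "K \<in> \<D>" "K' \<in> \<D>" "J \<in> R K" "J' \<in> R K'" using JJ by (auto simp: \<R>_def)
        show ?thesis
        proof (cases "K = K'")
          case True
          then show ?thesis using division_ofD(5)[OF R(1)] K JJ by blast
        next
          case False
          then have "J \<inter> J' = {}" using disj K by blast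
          then show ?thesis using interior_subset by blast
        qed
      qed
    qed auto
    define \<rho> where "\<rho> = (\<Sum>J\<in>\<R>. increment (\<lambda>t. t) J)"
    have "0 \<le> \<rho>" using measure_division_Union[OF Rdiv] measure_nonneg unfolding \<rho>_def by metis
    have mle: "m - e \<le> (\<Sum>K\<in>\<D>. measure lebesgue (E \<inter> K))"
    proof -
      have EK: "E \<inter> K \<in> lmeasurable" if "K \<in> \<D>" for K 
        using D(2)[OF that] E by (auto intro: fmeasurable_Int_fmeasurable)
      have "m = measure lebesgue ((E - \<Union>\<D>) \<union> (\<Union>K\<in>\<D>. E \<inter> K))"
        unfolding m_def by (rule arg_cong[where f="measure lebesgue"]) blast
      also have "\<dots> \<le> measure lebesgue (E - \<Union>\<D>) + measure lebesgue (\<Union>K\<in>\<D>. E \<inter> K)"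
        using E EK D(1) lmeasurable_division[OF div]
        by (intro measure_Un_le) (auto intro!: sets.finite_UN fmeasurableD)
      also have "measure lebesgue (\<Union>K\<in>\<D>. E \<inter> K) \<le> (\<Sum>K\<in>\<D>. measure lebesgue (E \<inter> K))"
        using EK D(1) by (intro measure_UNION_le) auto
      finally show ?thesis using D(4) by linarith
    qed
    have "\<rho> \<le> (\<Sum>K\<in>\<D>. increment (\<lambda>t. t) K - measure lebesgue (E \<inter> K) + e1)"
      unfolding \<rho>_def Rsum using R(3) by (rule sum_mono)
    also have "\<dots> = T - (\<Sum>K\<in>\<D>. measure lebesgue (E \<inter> K)) + real (card \<D>) * e1"
      by (simp add: T_def sum.distrib sum_subtractf)
    finally have \<rho>1: "\<rho> \<le> T - (m - e) + e" using mle e1 by linarith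
    then have \<rho>2: "\<rho> \<le> 3 * e" using T by linarith
    have "\<Union>\<R> \<subseteq> {c..d}"
    proof -
      have "\<Union>\<R> \<subseteq> \<Union>\<D>" using R(2) unfolding \<R>_def by blast
      also have "\<dots> \<subseteq> {c<..<d}" using D(2) G(3) by blast
      finally show ?thesis by force
    qed
    with \<rho>2 e have "(\<Sum>J\<in>\<R>. \<bar>increment f J\<bar>) < \<epsilon>"
      by (intro \<delta>(2) Rdiv) (auto simp: \<rho>_def)
    moreover have "- (\<Sum>J\<in>\<R>. increment f J) \<le> (\<Sum>J\<in>\<R>. \<bar>increment f J\<bar>)"
      unfolding sum_negf[symmetric] by (intro sum_mono) auto
    ultimately have Rf: "- (\<Sum>J\<in>\<R>. increment f J) < \<epsilon>" by linarith
    \<comment> \<open>Here the two slope conditions collide: the increment of \<open>f\<close> over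
      the first family is at most \<open>p * T\<close>, while computed through the second family it
      exceeds \<open>q * (T - \<rho>) - \<epsilon>\<close>.\<close>
    have "q * (T - \<rho>) \<le> (\<Sum>K\<in>\<D>. increment f K) - (\<Sum>J\<in>\<R>. increment f J)"
    proof -
      have "q * (T - \<rho>) = (\<Sum>K\<in>\<D>. q * (increment (\<lambda>t. t) K - (\<Sum>J\<in>R K. increment (\<lambda>t. t) J)))"
        by (simp only: T_def \<rho>_def Rsum sum_distrib_left[symmetric] sum_subtractf)
      also have "\<dots> \<le> (\<Sum>K\<in>\<D>. increment f K - (\<Sum>J\<in>R K. increment f J))"
        using R(4) by (rule sum_mono)
      also have "\<dots> = (\<Sum>K\<in>\<D>. increment f K) - (\<Sum>J\<in>\<R>. increment f J)"
        by (simp only: Rsum sum_subtractf)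
      finally show ?thesis .
    qed
    also have "(\<Sum>K\<in>\<D>. increment f K) \<le> p * T"
      unfolding T_def sum_distrib_left using D(2) by (intro sum_mono) (fastforce simp: field_simps)
    finally have "(q - p) * T \<le> q * \<rho> + \<epsilon>" using Rf by (simp add: algebra_simps)
    also have "q * \<rho> \<le> \<bar>q\<bar> * (3 * \<epsilon>)"
      using \<rho>2 e \<open>0 \<le> \<rho>\<close> by (intro mult_mono) auto
    finally have "(q - p) * T \<le> \<epsilon> * (1 + 3 * \<bar>q\<bar>)" by (simp add: algebra_simps)
    moreover have "(q - p) * (m - 2 * \<epsilon>) \<le> (q - p) * T"
      using \<rho>1 \<open>0 \<le> \<rho>\<close> e \<open>p < q\<close> by (intro mult_left_mono) auto
    ultimately show ?thesis by (simp add: algebra_simps)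
  qed
  have "(q - p) * m \<le> 0 + x" if "x > 0" for x
  proof -
    define k where "k = 1 + 3 * \<bar>q\<bar> + 2 * (q - p)"
    have "k > 0" using \<open>p < q\<close> by (simp add: k_def)
    then show ?thesis using main[of "x / k", folded k_def] that by simp
  qed
  then have "(q - p) * m \<le> 0" by (rule field_le_epsilon)
  moreover have "m \<ge> 0" by (simp add: m_def)
  ultimately have "m = 0" using \<open>p < q\<close> by (smt (verit) mult_pos_pos)
  then show ?thesis using E unfolding m_def E_def by (simp add: negligible_iff_measure0)
qed

lemma absolutely_continuous_on_subinterval:
  assumes "absolutely_continuous_on_Icc c d f" and "{c'..d'} \<subseteq> {c..d}"
  shows "absolutely_continuous_on_Icc c' d' f"
  using assms unfolding absolutely_continuous_on_Icc_def by (meson subset_trans)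

lemma absolutely_continuous_uminus:
  assumes "absolutely_continuous_on_Icc c d f"
  shows "absolutely_continuous_on_Icc c d (\<lambda>t. - f t)"
proof -
  have "(\<Sum>K\<in>\<D>. \<bar>- f (Sup K) - - f (Inf K)\<bar>) = (\<Sum>K\<in>\<D>. \<bar>increment f K\<bar>)" for \<D>
    by (intro sum.cong) auto
  then show ?thesis using assms unfolding absolutely_continuous_on_Icc_def by simp
qed

lemma absolutely_continuous_imp_continuous_on:
  assumes ac: "absolutely_continuous_on_Icc c d f"
  shows "continuous_on {c..d} f"
  unfolding continuous_on_iff
proof (intro ballI allI impI)
  fix s and \<epsilon> :: real assume s: "s \<in> {c..d}" and "\<epsilon> > 0"
  obtain \<delta> where \<delta>: "\<delta> > 0"
    "\<And>\<D>. \<D> division_of \<Union>\<D> \<Longrightarrow> \<Union>\<D> \<subseteq> {c..d} \<Longrightarrow> (\<Sum>K\<in>\<D>. increment (\<lambda>t. t) K) < \<delta> \<Longrightarrow>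
       (\<Sum>K\<in>\<D>. \<bar>increment f K\<bar>) < \<epsilon>"
    using absolutely_continuous_increment[OF ac \<open>\<epsilon> > 0\<close>] by blast
  have *: "\<bar>f v - f u\<bar> < \<epsilon>" if "u \<le> v" "u \<in> {c..d}" "v \<in> {c..d}" "v - u < \<delta>" for u v
    using \<delta>(2)[of "{{u..v}}"] that division_of_self[of u v] by auto
  have "dist (f t) (f s) < \<epsilon>" if "t \<in> {c..d}" "dist t s < \<delta>" for t
    using *[of s t] *[of t s] that s by (cases "s \<le> t") (auto simp: dist_real_def abs_minus_commute)
  then show "\<exists>\<delta>>0. \<forall>t\<in>{c..d}. dist t s < \<delta> \<longrightarrow> dist (f t) (f s) < \<epsilon>" using \<delta>(1) by blast
qed

text \<open>If such points had measure \<open>m > 0\<close> inside an interval shorter than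
  \<open>\<delta>\<close>, disjoint intervals of slope above \<open>n > 2 / m\<close> with total
  length above \<open>m / 2\<close> would give a total increment above 1, against the choice of
  \<open>\<delta>\<close>.\<close>

lemma slope_unbounded_negligible:
  assumes ac: "absolutely_continuous_on_Icc c d f"
  shows "negligible {t \<in> {c<..<d}. \<forall>n::nat. frequently_slope f (\<lambda>s. s > n) t}"
proof -
  obtain \<delta> where \<delta>: "\<delta> > 0"
    "\<And>\<D>. \<D> division_of \<Union>\<D> \<Longrightarrow> \<Union>\<D> \<subseteq> {c..d} \<Longrightarrow> (\<Sum>K\<in>\<D>. increment (\<lambda>t. t) K) < \<delta> \<Longrightarrow>
       (\<Sum>K\<in>\<D>. \<bar>increment f K\<bar>) < 1"
    using absolutely_continuous_increment[OF ac zero_less_one] by blast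
  have short: "negligible {t \<in> {u<..<v}. \<forall>n::nat. frequently_slope f (\<lambda>s. s > n) t}" (is "negligible ?E")
    if uv: "c \<le> u" "u < v" "v \<le> d" "v - u < \<delta>" for u v
  proof (rule ccontr)
    define E where "E = ?E"
    assume "\<not> negligible ?E"
    have "E = {u<..<v} \<inter> (\<Inter>n::nat. {t. frequently_slope f (\<lambda>s. s > n) t})" by (auto simp: E_def)
    then have E: "E \<in> lmeasurable"
      using frequently_slope_borel
      by (intro bounded_set_imp_lmeasurable)
        (auto intro!: sets.Int sets.countable_INT'' intro: bounded_subset[of "{u<..<v}"])
    define m where "m = measure lebesgue E"
    have "m > 0" using E \<open>\<not> negligible ?E\<close>
      unfolding m_def E_def[symmetric] by (simp add: negligible_iff_measure0 zero_less_measure_iff)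
    obtain n :: nat where n: "2 / m < n" using reals_Archimedean2 by blast
    have hi: "\<exists>u v. u < t \<and> t < v \<and> v - u < \<eta> \<and> n < (f v - f u) / (v - u)" 
      if "t \<in> E" "\<eta> > 0" for t \<eta>
      using that by (auto simp: E_def frequently_slope_def)
    have "m / 2 > 0" using \<open>m > 0\<close> by simp
    from Vitali_division[OF uv(2) E this, of "\<lambda>u v. n < (f v - f u) / (v - u)", OF hi]
    obtain \<D> \<D>' where D: "\<D> \<subseteq> \<D>'" "\<D>' division_of {u..v}"
      "\<And>K. K \<in> \<D> \<Longrightarrow> \<exists>u v. u < v \<and> K = {u..v} \<and> n < (f v - f u) / (v - u)"
      "measure lebesgue (E \<inter> {u..v}) - m / 2 < (\<Sum>K\<in>\<D>. increment (\<lambda>t. t) K)"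
      by blast
    have "E \<inter> {u..v} = E" by (auto simp: E_def)
    then have big: "m / 2 < (\<Sum>K\<in>\<D>. increment (\<lambda>t. t) K)" using D(4) by (simp add: m_def)
    have div: "\<D> division_of \<Union>\<D>"
      using division_of_subset[OF division_of_union_self[OF D(2)]] D(1) by auto
    have sub: "\<Union>\<D> \<subseteq> {u..v}" using D(1,2) by blast
    have "(\<Sum>K\<in>\<D>. increment (\<lambda>t. t) K) \<le> measure lebesgue {u..v}"
      unfolding measure_division_Union[OF div, symmetric]
      using sub lmeasurable_division[OF div] by (intro measure_mono_fmeasurable) auto
    then have "(\<Sum>K\<in>\<D>. increment (\<lambda>t. t) K) < \<delta>" using uv by simp
    then have "(\<Sum>K\<in>\<D>. \<bar>increment f K\<bar>) < 1"
      using sub uv by (intro \<delta>(2)[OF div]) auto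
    then have "(\<Sum>K\<in>\<D>. increment f K) < 1"
      using sum_abs[of "increment f" \<D>] by linarith
    moreover have "n * (\<Sum>K\<in>\<D>. increment (\<lambda>t. t) K) \<le> (\<Sum>K\<in>\<D>. increment f K)"
      unfolding sum_distrib_left using D(3) by (intro sum_mono) (fastforce simp: field_simps)
    moreover have "0 < real n" using n \<open>m > 0\<close> by (smt (verit) divide_pos_pos)
    then have "2 / m * (m / 2) < n * (\<Sum>K\<in>\<D>. increment (\<lambda>t. t) K)"
      using n big \<open>m > 0\<close> by (intro mult_strict_mono) simp_all
    ultimately show False using \<open>m > 0\<close> by simp
  qed
  \<comment> \<open>Countably many windows of length at most \<open>\<delta> / 2\<close>, indexed by
    rationals, cover \<open>{c<..<d}\<close> and reduce the claim to short intervals.\<close>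
  define I where "I r = {t \<in> {max c r<..<min d (r + \<delta> / 2)}. \<forall>n::nat. frequently_slope f (\<lambda>s. s > n) t}" for r
  have "negligible (I r)" for r
  proof (cases "max c r < min d (r + \<delta> / 2)")
    case True
    then show ?thesis unfolding I_def using \<delta>(1) by (intro short) auto
  next
    case False
    then have "I r = {}" by (auto simp: I_def)
    then show ?thesis by simp
  qed
  then have "negligible (\<Union>(I ` \<rat>))"
    using countable_rat by (intro negligible_countable_Union) auto
  moreover have "{t \<in> {c<..<d}. \<forall>n::nat. frequently_slope f (\<lambda>s. s > n) t} \<subseteq> \<Union>(I ` \<rat>)"
  proof
    fix t assume t: "t \<in> {t \<in> {c<..<d}. \<forall>n::nat. frequently_slope f (\<lambda>s. s > n) t}"
    obtain r where "r \<in> \<rat>" "t - \<delta> / 2 < r" "r < t" using Rats_dense_in_real[of "t - \<delta> / 2" t] \<delta>(1) by auto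
    then have "t \<in> I r" using t unfolding I_def by auto
    then show "t \<in> \<Union>(I ` \<rat>)" using \<open>r \<in> \<rat>\<close> by blast
  qed
  ultimately show ?thesis using negligible_subset by blast
qed

text \<open>Letting one endpoint of a straddling interval tend to \<open>t\<close> recovers the one-sided difference
  quotients; this needs continuity.\<close>

lemma slope_close_imp_DERIV:
  assumes cont: "isCont f t"
    and *: "\<And>\<epsilon>. \<epsilon> > 0 \<Longrightarrow> \<exists>\<eta>>0. \<forall>u v. u < t \<longrightarrow> t < v \<longrightarrow> v - u < \<eta> \<longrightarrow> \<bar>(f v - f u) / (v - u) - D\<bar> \<le> \<epsilon>"
  shows "(f has_real_derivative D) (at t)"
  unfolding has_field_derivative_def has_derivative_at_alt
proof (intro conjI allI impI)
  show "bounded_linear ((*) D)" by (rule bounded_linear_mult_right)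
  fix \<epsilon> :: real assume "\<epsilon> > 0"
  then obtain \<eta> where \<eta>: "\<eta> > 0" 
    "\<And>u v. u < t \<Longrightarrow> t < v \<Longrightarrow> v - u < \<eta> \<Longrightarrow> \<bar>(f v - f u) / (v - u) - D\<bar> \<le> \<epsilon>" using * by meson
  have est: "\<bar>f v - f u - D * (v - u)\<bar> \<le> \<epsilon> * (v - u)" if "u < t" "t < v" "v - u < \<eta>" for u v
  proof -
    have "(f v - f u) / (v - u) - D = (f v - f u - D * (v - u)) / (v - u)"
      using that by (simp add: field_simps)
    then show ?thesis using \<eta>(2)[OF that] that by (simp add: abs_divide pos_divide_le_eq)
  qed
  have R: "\<bar>f v - f t - D * (v - t)\<bar> \<le> \<epsilon> * (v - t)" if "t < v" "v - t < \<eta>" for v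
  proof (rule tendsto_le[of "at_left t"])
    show "((\<lambda>u. \<bar>f v - f u - D * (v - u)\<bar>) \<longlongrightarrow> \<bar>f v - f t - D * (v - t)\<bar>) (at_left t)"
      using cont by (intro tendsto_intros) (auto simp: isCont_def intro: tendsto_within_subset)
    show "((\<lambda>u. \<epsilon> * (v - u)) \<longlongrightarrow> \<epsilon> * (v - t)) (at_left t)" by (intro tendsto_intros)
    have "v - \<eta> < t" using that by simp
    then show "\<forall>\<^sub>F u in at_left t. \<bar>f v - f u - D * (v - u)\<bar> \<le> \<epsilon> * (v - u)"
      unfolding eventually_at_left[OF \<open>v - \<eta> < t\<close>] using est that by (intro exI[of _ "v - \<eta>"]) auto
  qed auto
  have L: "\<bar>f t - f u - D * (t - u)\<bar> \<le> \<epsilon> * (t - u)" if "u < t" "t - u < \<eta>" for u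
  proof (rule tendsto_le[of "at_right t"])
    show "((\<lambda>v. \<bar>f v - f u - D * (v - u)\<bar>) \<longlongrightarrow> \<bar>f t - f u - D * (t - u)\<bar>) (at_right t)"
      using cont by (intro tendsto_intros) (auto simp: isCont_def intro: tendsto_within_subset)
    show "((\<lambda>v. \<epsilon> * (v - u)) \<longlongrightarrow> \<epsilon> * (t - u)) (at_right t)" by (intro tendsto_intros)
    have "t < u + \<eta>" using that by simp
    then show "\<forall>\<^sub>F v in at_right t. \<bar>f v - f u - D * (v - u)\<bar> \<le> \<epsilon> * (v - u)"
      unfolding eventually_at_right[OF \<open>t < u + \<eta>\<close>] using est that by (intro exI[of _ "u + \<eta>"]) auto
  qed auto
  show "\<exists>d>0. \<forall>y. norm (y - t) < d \<longrightarrow> norm (f y - f t - D * (y - t)) \<le> \<epsilon> * norm (y - t)"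
  proof (intro exI[of _ \<eta>] conjI allI impI \<eta>(1))
    fix y assume y: "norm (y - t) < \<eta>"
    consider "y < t" | "y = t" | "t < y" by linarith
    then show "norm (f y - f t - D * (y - t)) \<le> \<epsilon> * norm (y - t)"
    proof cases
      case 1
      have "\<bar>f y - f t - D * (y - t)\<bar> = \<bar>f t - f y - D * (t - y)\<bar>" by (simp add: algebra_simps)
      then show ?thesis using L[of y] y 1 by auto
    qed (use R[of y] y in auto)
  qed
qed

lemma frequently_slope_uminus:
  "frequently_slope (\<lambda>t. - f t) Q t \<longleftrightarrow> frequently_slope f (\<lambda>s. Q (- s)) t"
proof -
  have "(- f v - - f u) / (v - u) = - ((f v - f u) / (v - u))" for u v :: real
    by (simp add: minus_divide_left)
  then show ?thesis unfolding frequently_slope_def by simp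
qed

text \<open>The exceptional points form a countable union over rational gaps \<open>p < q\<close>,
  together with the points of unbounded slopes in either direction. Elsewhere the lower and upper
  limits of the slopes are finite and agree.\<close>

lemma absolutely_continuous_differentiable_AE:
  assumes ac: "absolutely_continuous_on_Icc c d f"
  shows "negligible {t \<in> {c<..<d}. \<not> (\<exists>D. (f has_real_derivative D) (at t))}"
proof -
  define Z where "Z = (\<lambda>(p, q). {t \<in> {c<..<d}. frequently_slope f (\<lambda>s. s < p) t \<and> frequently_slope f (\<lambda>s. s > q) t})"
  define Q where "Q = {(p, q). p \<in> \<rat> \<and> q \<in> \<rat> \<and> p < (q::real)}"
  define U where "U = {t \<in> {c<..<d}. \<forall>n::nat. frequently_slope f (\<lambda>s. s > n) t}"
  define L where "L = {t \<in> {c<..<d}. \<forall>n::nat. frequently_slope f (\<lambda>s. s < - n) t}"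
  have "countable Q" 
    by (rule countable_subset[of _ "\<rat> \<times> \<rat>"]) (auto simp: Q_def countable_rat)
  then have "negligible (\<Union>(Z ` Q))"
    using slope_gap_negligible[OF ac] by (intro negligible_countable_Union) (auto simp: Q_def Z_def)
  moreover have "negligible U" unfolding U_def by (rule slope_unbounded_negligible[OF ac])
  moreover have "negligible L"
    using slope_unbounded_negligible[OF absolutely_continuous_uminus[OF ac]]
    unfolding L_def frequently_slope_uminus by (simp add: less_minus_iff)
  ultimately have "negligible (\<Union>(Z ` Q) \<union> U \<union> L)" by (intro negligible_Un)
  moreover have "\<exists>D. (f has_real_derivative D) (at t)"
    if t: "t \<in> {c<..<d}" and N: "t \<notin> \<Union>(Z ` Q) \<union> U \<union> L" for t
  proof -
    define above where "above q \<longleftrightarrow> frequently_slope f (\<lambda>s. s > q) t" for q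
    define below where "below q \<longleftrightarrow> frequently_slope f (\<lambda>s. s < q) t" for q
    \<comment> \<open>Two rationals strictly between \<open>p\<close> and \<open>q\<close> put the
      point into one of the countably many null sets \<open>Z (p', q')\<close>.\<close>
    have gap: "\<not> (below p \<and> above q)" if "p < q" for p q
    proof
      assume *: "below p \<and> above q"
      obtain p' where p': "p' \<in> \<rat>" "p < p'" "p' < q" using Rats_dense_in_real \<open>p < q\<close> by blast
      obtain q' where q': "q' \<in> \<rat>" "p' < q'" "q' < q" using Rats_dense_in_real p' by blast
      have "frequently_slope f (\<lambda>s. s < p') t" 
        using * p' unfolding below_def frequently_slope_def by (meson less_trans)
      moreover have "frequently_slope f (\<lambda>s. s > q') t" 
        using * q' unfolding above_def frequently_slope_def by (meson less_trans)
      ultimately have "t \<in> Z (p', q')" using t by (simp add: Z_def)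
      moreover have "(p', q') \<in> Q" using p' q' by (simp add: Q_def)
      ultimately show False using N by blast
    qed
    obtain n :: nat where n: "\<not> above n" using N t by (auto simp: U_def above_def)
    obtain n' :: nat where n': "\<not> below (- n')" using N t by (auto simp: L_def below_def)
    have le: "\<exists>\<eta>>0. \<forall>u v. u < t \<longrightarrow> t < v \<longrightarrow> v - u < \<eta> \<longrightarrow> (f v - f u) / (v - u) \<le> q" if "\<not> above q" for q
      using that unfolding above_def frequently_slope_def by (meson not_less)
    have ge: "\<exists>\<eta>>0. \<forall>u v. u < t \<longrightarrow> t < v \<longrightarrow> v - u < \<eta> \<longrightarrow> q \<le> (f v - f u) / (v - u)" if "\<not> below q" for q
      using that unfolding below_def frequently_slope_def by (meson not_less)
    have both: "p \<le> q" if pq: "\<not> below p" "\<not> above q" for p q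
    proof -
      obtain \<eta>1 where 1: "\<eta>1 > 0" "\<forall>u v. u < t \<longrightarrow> t < v \<longrightarrow> v - u < \<eta>1 \<longrightarrow> (f v - f u) / (v - u) \<le> q"
        using le[OF pq(2)] by blast
      obtain \<eta>2 where 2: "\<eta>2 > 0" "\<forall>u v. u < t \<longrightarrow> t < v \<longrightarrow> v - u < \<eta>2 \<longrightarrow> p \<le> (f v - f u) / (v - u)"
        using ge[OF pq(1)] by blast
      define e where "e = min \<eta>1 \<eta>2 / 3"
      have e: "t - e < t" "t < t + e" "(t + e) - (t - e) < \<eta>1" "(t + e) - (t - e) < \<eta>2"
        using 1(1) 2(1) by (auto simp: e_def)
      from 1(2)[rule_format, OF e(1,2,3)] 2(2)[rule_format, OF e(1,2,4)] show ?thesis by linarith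
    qed
    \<comment> \<open>The lower limit of the slopes around \<open>t\<close>:
      \<open>\<not> below p\<close> says that they are eventually at least \<open>p\<close>. The
      bounds \<open>n\<close> and \<open>- n'\<close> make this set bounded above and
      nonempty.\<close>
    define D where "D = Sup {p. \<not> below p}"
    have bdd: "bdd_above {p. \<not> below p}" using both[OF _ n] by (intro bdd_aboveI[of _ "real n"]) simp
    have D1: "\<not> below p" if "p < D" for p
    proof -
      obtain p' where "\<not> below p'" "p < p'" 
        using \<open>p < D\<close> n' less_cSup_iff[OF _ bdd] unfolding D_def by blast
      then show ?thesis unfolding below_def frequently_slope_def by (meson less_trans)
    qed
    have D2: "\<not> above q" if "D < q" for q
    proof -
      obtain p where "D < p" "p < q" using dense[OF \<open>D < q\<close>] by blast
      then have "below p" using cSup_upper[OF _ bdd] unfolding D_def by force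
      then show ?thesis using gap[OF \<open>p < q\<close>] by blast
    qed
    have "(f has_real_derivative D) (at t)"
    proof (rule slope_close_imp_DERIV)
      show "isCont f t" 
        using continuous_on_interior[OF absolutely_continuous_imp_continuous_on[OF ac]] t by simp
      fix \<epsilon> :: real assume "\<epsilon> > 0"
      then obtain \<eta>1 where 1: "\<eta>1 > 0" "\<forall>u v. u < t \<longrightarrow> t < v \<longrightarrow> v - u < \<eta>1 \<longrightarrow> (f v - f u) / (v - u) \<le> D + \<epsilon>"
        using le[of "D + \<epsilon>"] D2 by auto
      obtain \<eta>2 where 2: "\<eta>2 > 0" "\<forall>u v. u < t \<longrightarrow> t < v \<longrightarrow> v - u < \<eta>2 \<longrightarrow> D - \<epsilon> \<le> (f v - f u) / (v - u)"
        using ge[of "D - \<epsilon>"] D1 \<open>\<epsilon> > 0\<close> by auto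
      have "\<bar>(f v - f u) / (v - u) - D\<bar> \<le> \<epsilon>" if "u < t" "t < v" "v - u < min \<eta>1 \<eta>2" for u v
      proof -
        have "(f v - f u) / (v - u) \<le> D + \<epsilon>" "D - \<epsilon> \<le> (f v - f u) / (v - u)"
          using 1(2) 2(2) that by auto
        then show ?thesis by linarith
      qed
      then show "\<exists>\<eta>>0. \<forall>u v. u < t \<longrightarrow> t < v \<longrightarrow> v - u < \<eta> \<longrightarrow> \<bar>(f v - f u) / (v - u) - D\<bar> \<le> \<epsilon>"
        using 1(1) 2(1) by (intro exI[of _ "min \<eta>1 \<eta>2"]) auto
    qed
    then show ?thesis ..
  qed
  ultimately show ?thesis by (elim negligible_subset) blast
qed

section \<open>Lipschitz functions and indefinite integrals\<close>

lemma lipschitz_imp_absolutely_continuous: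
  fixes f :: "real \<Rightarrow> real"
  assumes f: "L-lipschitz_on {c..d} f"
  shows "absolutely_continuous_on_Icc c d f"
  unfolding absolutely_continuous_on_Icc_def
proof (intro allI impI)
  fix \<epsilon> :: real assume "\<epsilon> > 0"
  have "L \<ge> 0" using f by (rule lipschitz_on_nonneg)
  show "\<exists>\<delta>>0. \<forall>\<D>. \<D> division_of \<Union>\<D> \<and> \<Union>\<D> \<subseteq> {c..d} \<and> (\<Sum>K\<in>\<D>. Sup K - Inf K) < \<delta> \<longrightarrow>
       (\<Sum>K\<in>\<D>. \<bar>increment f K\<bar>) < \<epsilon>"
  \<comment> \<open>\<open>L + 1\<close> in place of \<open>L\<close> keeps the divisor positive
    when \<open>L = 0\<close>.\<close>
  proof (intro exI[of _ "\<epsilon> / (L + 1)"] conjI allI impI)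
    show "0 < \<epsilon> / (L + 1)" using \<open>\<epsilon> > 0\<close> \<open>L \<ge> 0\<close> by simp
    fix \<D> assume D: "\<D> division_of \<Union>\<D> \<and> \<Union>\<D> \<subseteq> {c..d} \<and> (\<Sum>K\<in>\<D>. Sup K - Inf K) < \<epsilon> / (L + 1)"
    have "\<bar>increment f K\<bar> \<le> (L + 1) * (Sup K - Inf K)" if K: "K \<in> \<D>" for K
    proof -
      obtain u v where uv: "K = {u..v}" using D K by (metis box_real(2) division_ofD(4))
      have "K \<noteq> {}" "K \<subseteq> {c..d}" using D K by blast+
      then have "u \<le> v" "u \<in> {c..d}" "v \<in> {c..d}" using uv by auto
      then have "dist (f v) (f u) \<le> L * dist v u" using f by (auto simp: lipschitz_on_def)
      then show ?thesis using \<open>u \<le> v\<close> uv by (simp add: dist_real_def distrib_right)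
    qed
    then have "(\<Sum>K\<in>\<D>. \<bar>increment f K\<bar>) \<le> (L + 1) * (\<Sum>K\<in>\<D>. Sup K - Inf K)"
      unfolding sum_distrib_left by (rule sum_mono)
    also have "\<dots> < (L + 1) * (\<epsilon> / (L + 1))"
      using D \<open>L \<ge> 0\<close> by (intro mult_strict_left_mono) auto
    finally show "(\<Sum>K\<in>\<D>. \<bar>increment f K\<bar>) < \<epsilon>" using \<open>L \<ge> 0\<close> by simp
  qed
qed

lemma lipschitz_on_exp:
  fixes f :: "'a::metric_space \<Rightarrow> real"
  assumes f: "L-lipschitz_on S f" and M: "\<And>x. x \<in> S \<Longrightarrow> f x \<le> M"
  shows "(exp M * L)-lipschitz_on S (\<lambda>x. exp (f x))"
proof (rule lipschitz_onI)
  fix x y assume xy: "x \<in> S" "y \<in> S"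
  have *: "exp r - exp s \<le> exp M * \<bar>r - s\<bar>" if "r \<le> M" for r s :: real
  proof -
    have "1 + (s - r) \<le> exp (s - r)" by (rule exp_ge_add_one_self)
    then have "exp r * (1 + (s - r)) \<le> exp r * exp (s - r)" by (intro mult_left_mono) auto
    also have "exp r * exp (s - r) = exp s" by (simp add: exp_diff)
    finally have "exp r - exp s \<le> exp r * (r - s)" by (simp add: algebra_simps)
    also have "\<dots> \<le> exp r * \<bar>r - s\<bar>" by (intro mult_left_mono) auto
    also have "\<dots> \<le> exp M * \<bar>r - s\<bar>" using that by (intro mult_right_mono) auto
    finally show ?thesis .
  qed
  have "dist (exp (f x)) (exp (f y)) \<le> exp M * dist (f x) (f y)"
    using *[of "f x" "f y"] *[of "f y" "f x"] M xy by (auto simp: dist_real_def abs_le_iff abs_minus_commute)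
  also have "\<dots> \<le> exp M * (L * dist x y)"
    using f xy by (intro mult_left_mono) (auto simp: lipschitz_on_def)
  finally show "dist (exp (f x)) (exp (f y)) \<le> exp M * L * dist x y" by (simp add: mult.assoc)
qed (use lipschitz_on_nonneg[OF f] in auto)

lemma bounded_measurable_integrable_on_Icc:
  fixes b :: "real \<Rightarrow> real"
  assumes "b \<in> borel_measurable lebesgue" and "\<And>t. \<bar>b t\<bar> \<le> C"
  shows "b integrable_on {u..v}"
proof (rule measurable_bounded_by_integrable_imp_integrable[where g = "\<lambda>_. C"])
  show "b \<in> borel_measurable (lebesgue_on {u..v})"
    using assms(1) by (rule measurable_restrict_space1)
qed (use assms(2) in auto)

lemma integral_increment:
  fixes b :: "real \<Rightarrow> real"
  assumes "b \<in> borel_measurable lebesgue" and "\<And>t. \<bar>b t\<bar> \<le> C" and "c \<le> u" "u \<le> v"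
  shows "integral {c..v} b - integral {c..u} b = integral {u..v} b"
  using Henstock_Kurzweil_Integration.integral_combine[OF assms(3,4), of b]
    bounded_measurable_integrable_on_Icc[OF assms(1,2)] by (simp add: algebra_simps)

lemma integral_lipschitz:
  fixes b :: "real \<Rightarrow> real"
  assumes b: "b \<in> borel_measurable lebesgue" "\<And>t. \<bar>b t\<bar> \<le> C"
  shows "C-lipschitz_on {c..d} (\<lambda>t. integral {c..t} b)"
proof (rule lipschitz_onI)
  show "0 \<le> C" using b(2)[of 0] by linarith
  have *: "\<bar>integral {c..v} b - integral {c..u} b\<bar> \<le> C * (v - u)" if "c \<le> u" "u \<le> v" for u v
  proof -
    have "norm (integral {u..v} b) \<le> integral {u..v} (\<lambda>_. C)"
      using bounded_measurable_integrable_on_Icc[OF b] b(2) by (intro integral_norm_bound_integral) auto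
    then show ?thesis
      using integral_increment[OF b that] \<open>u \<le> v\<close> by (simp add: mult.commute)
  qed
  fix x y assume "x \<in> {c..d}" "y \<in> {c..d}"
  then show "dist (integral {c..x} b) (integral {c..y} b) \<le> C * dist x y"
    using *[of x y] *[of y x] by (cases "x \<le> y") (auto simp: dist_real_def abs_minus_commute)
qed

text \<open>Over disjoint intervals of slope below \<open>p\<close> and total length
  \<open>T\<close> that nearly cover the set, the integral of \<open>b\<close> is at most
  \<open>p * T\<close>. But \<open>b > q\<close> on the set and the intervals protrude little from
  it, so the integral is also nearly at least \<open>q * T\<close>; this forces measure
  zero.\<close>

lemma integral_slope_gap_negligible:
  fixes b :: "real \<Rightarrow> real"
  assumes b: "b \<in> borel_measurable lebesgue" "\<And>t. \<bar>b t\<bar> \<le> C" and "p < q"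
  shows "negligible {t \<in> {c<..<d}. frequently_slope (\<lambda>t. integral {c..t} b) (\<lambda>s. s < p) t \<and> q < b t}"
    (is "negligible ?E")
proof -
  define B where "B = (\<lambda>t. integral {c..t} b)"
  define E where "E = ?E"
  have "E = {c<..<d} \<inter> {t. frequently_slope B (\<lambda>s. s < p) t} \<inter> {t. q < b t}"
    by (auto simp: E_def B_def)
  moreover have "{t. frequently_slope B (\<lambda>s. s < p) t} \<in> sets lebesgue"
    using frequently_slope_borel[of B "\<lambda>s. s < p"] by simp
  moreover have "{t. q < b t} \<in> sets lebesgue"
    using borel_measurable_less[OF borel_measurable_const b(1)] by simp
  ultimately have E: "E \<in> lmeasurable"
    by (intro bounded_set_imp_lmeasurable) (auto intro!: sets.Int intro: bounded_subset[of "{c<..<d}"])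
  define m where "m = measure lebesgue E"
  have "C \<ge> 0" using b(2)[of 0] by linarith
  have main: "(q - p) * m \<le> \<epsilon> * (C + \<bar>q\<bar> + (q - p))" if "\<epsilon> > 0" for \<epsilon>
  proof -
    obtain G0 where G0: "open G0" "E \<subseteq> G0" "G0 - E \<in> lmeasurable" "emeasure lebesgue (G0 - E) < ennreal \<epsilon>"
      using sets_lebesgue_outer_open[of E \<epsilon>] E \<open>\<epsilon> > 0\<close> by auto
    define G where "G = G0 \<inter> {c<..<d}"
    have G: "open G" "E \<subseteq> G" "G \<subseteq> {c<..<d}" using G0 by (auto simp: G_def E_def)
    have Gm: "G \<in> lmeasurable" 
      using G by (intro bounded_set_imp_lmeasurable) (auto intro: bounded_subset[of "{c<..<d}"])
    have "measure lebesgue (G0 - E) < \<epsilon>"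
      using G0(3,4) \<open>\<epsilon> > 0\<close> by (simp add: emeasure_eq_measure2 ennreal_less_iff)
    have lo: "\<exists>u v. u < t \<and> t < v \<and> v - u < \<eta> \<and> (B v - B u) / (v - u) < p" if "t \<in> E" "\<eta> > 0" for t \<eta>
      using that by (auto simp: E_def B_def frequently_slope_def)
    from Vitali_finite_intervals[OF E G(1,2) \<open>\<epsilon> > 0\<close>, of "\<lambda>u v. (B v - B u) / (v - u) < p", OF lo]
    obtain \<D> where D: "finite \<D>"
      "\<And>K. K \<in> \<D> \<Longrightarrow> \<exists>u v. u < v \<and> K = {u..v} \<and> (B v - B u) / (v - u) < p \<and> K \<subseteq> G"
      "pairwise disjnt \<D>" "measure lebesgue (E - \<Union>\<D>) < \<epsilon>"
      by blast
    define U where "U = \<Union>\<D>"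
    have div: "\<D> division_of U"
      unfolding U_def using disjoint_intervals_division[OF D(1) _ D(3)] D(2) by blast
    have Um: "U \<in> lmeasurable" using div by (rule lmeasurable_division)
    define T where "T = (\<Sum>K\<in>\<D>. increment (\<lambda>t. t) K)"
    have T: "T = measure lebesgue U"
      using measure_division_Union[of \<D>] div by (simp add: T_def U_def)
    have "U - E \<subseteq> G0 - E" using D(2) by (force simp: U_def G_def)
    then have UE: "measure lebesgue (U - E) \<le> \<epsilon>"
      using G0(3) E Um measure_mono_fmeasurable[of "U - E" "G0 - E" lebesgue]
        \<open>measure lebesgue (G0 - E) < \<epsilon>\<close> by auto
    have "m \<le> measure lebesgue ((E - U) \<union> U)"
      unfolding m_def using E Um by (intro measure_mono_fmeasurable) (auto intro: fmeasurable_Diff)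
    also have "\<dots> \<le> measure lebesgue (E - U) + measure lebesgue U"
      using E Um by (intro measure_Un_le) (auto intro: fmeasurableD)
    finally have mT: "m - \<epsilon> \<le> T" using D(4) by (simp add: T U_def)
    have bint: "b integrable_on U"
      using div bounded_measurable_integrable_on_Icc[OF b] D(2) 
      by (intro integrable_combine_division[OF div]) blast
    have ind: "(indicat_real (U - E) has_integral measure lebesgue (U - E)) U"
    proof -
      have "(indicat_real (U - E) has_integral measure lebesgue (U - E)) UNIV"
        using fmeasurable_Diff[OF Um fmeasurableD[OF E]] by (simp only: lmeasurable_iff_has_integral)
      moreover have "(\<lambda>t. if t \<in> U then indicat_real (U - E) t else 0) = indicat_real (U - E)"
        by (auto simp: indicator_def fun_eq_iff)
      ultimately show ?thesis using has_integral_restrict_UNIV[of U "indicat_real (U - E)"] by simp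
    qed
    have one: "((\<lambda>t. 1 :: real) has_integral measure lebesgue U) U"
    proof -
      have "(\<lambda>t. if t \<in> U then 1 else 0) = indicat_real U" by (auto simp: indicator_def fun_eq_iff)
      then show ?thesis
        using Um has_integral_restrict_UNIV[of U "\<lambda>_. 1 :: real"] by (simp add: lmeasurable_iff_has_integral)
    qed
    \<comment> \<open>The integrand is a minorant of \<open>b\<close> on \<open>U\<close>: it equals
      \<open>q\<close> on \<open>E\<close> and \<open>q - C - \<bar>q\<bar> \<le> - C\<close> off
      \<open>E\<close>.\<close>
    have low: "((\<lambda>t. q * 1 - (C + \<bar>q\<bar>) * indicat_real (U - E) t) has_integral
        (q * measure lebesgue U - (C + \<bar>q\<bar>) * measure lebesgue (U - E))) U"
      by (intro has_integral_diff has_integral_mult_right ind one)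
    have "q * T - (C + \<bar>q\<bar>) * measure lebesgue (U - E) \<le> integral U b"
      unfolding T
    proof (rule has_integral_le[OF low integrable_integral[OF bint]])
      fix t assume "t \<in> U"
      have "- C \<le> b t" using b(2)[of t] by linarith
      moreover have "q < b t" if "t \<in> E" using that by (simp add: E_def)
      ultimately show "q * 1 - (C + \<bar>q\<bar>) * indicat_real (U - E) t \<le> b t"
        using \<open>t \<in> U\<close> by (cases "t \<in> E") (auto simp: indicator_def)
    qed
    also have "integral U b = (\<Sum>K\<in>\<D>. integral K b)"
      using integral_combine_division_topdown[OF bint div] .
    also have "\<dots> = (\<Sum>K\<in>\<D>. increment B K)"
    proof (rule sum.cong[OF refl])
      fix K assume K: "K \<in> \<D>"
      obtain u v where uv: "u < v" "K = {u..v}" "K \<subseteq> G" using D(2)[OF K] by blast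
      then have "u \<in> K" by simp
      then have "u \<in> {c<..<d}" using uv(3) G(3) by blast
      then show "integral K b = increment B K"
        using uv integral_increment[OF b, of c u v] by (simp add: B_def)
    qed
    also have "\<dots> \<le> p * T"
      unfolding T_def sum_distrib_left using D(2) by (intro sum_mono) (fastforce simp: field_simps)
    finally have "(q - p) * T \<le> (C + \<bar>q\<bar>) * measure lebesgue (U - E)" by (simp add: algebra_simps)
    also have "\<dots> \<le> (C + \<bar>q\<bar>) * \<epsilon>" using UE \<open>C \<ge> 0\<close> by (intro mult_left_mono) auto
    finally have "(q - p) * T \<le> (C + \<bar>q\<bar>) * \<epsilon>" .
    moreover have "(q - p) * (m - \<epsilon>) \<le> (q - p) * T"
      using mT \<open>p < q\<close> by (intro mult_left_mono) auto
    ultimately show ?thesis by (simp add: algebra_simps)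
  qed
  have "(q - p) * m \<le> 0 + x" if "x > 0" for x
  proof -
    define k where "k = C + \<bar>q\<bar> + (q - p)"
    have "k > 0" using \<open>p < q\<close> \<open>C \<ge> 0\<close> by (simp add: k_def)
    then show ?thesis using main[of "x / k", folded k_def] that by simp
  qed
  then have "(q - p) * m \<le> 0" by (rule field_le_epsilon)
  moreover have "m \<ge> 0" by (simp add: m_def)
  ultimately have "m = 0" using \<open>p < q\<close> by (smt (verit) mult_pos_pos)
  then show ?thesis using E unfolding m_def E_def by (simp add: negligible_iff_measure0)
qed

text \<open>The derivative exists almost everywhere because the integral is Lipschitz; a value
  \<open>D < b t\<close> would leave room for rationals \<open>D < p < q < b t\<close> and so put
  \<open>t\<close> into a null set. The lower bound is the direction that the comparison argument
  consumes.\<close>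

lemma integral_deriv_ge_AE:
  fixes b :: "real \<Rightarrow> real"
  assumes b: "b \<in> borel_measurable lebesgue" "\<And>t. \<bar>b t\<bar> \<le> C"
  shows "negligible {t \<in> {c<..<d}. \<not> (\<exists>D\<ge>b t. ((\<lambda>t. integral {c..t} b) has_real_derivative D) (at t))}"
proof -
  define B where "B = (\<lambda>t. integral {c..t} b)"
  define Z where "Z = (\<lambda>(p, q). {t \<in> {c<..<d}. frequently_slope B (\<lambda>s. s < p) t \<and> q < b t})"
  define Q where "Q = {(p, q). p \<in> \<rat> \<and> q \<in> \<rat> \<and> p < (q::real)}"
  have "countable Q" 
    by (rule countable_subset[of _ "\<rat> \<times> \<rat>"]) (auto simp: Q_def countable_rat)
  then have "negligible (\<Union>(Z ` Q))"
    using integral_slope_gap_negligible[OF b] 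
    by (intro negligible_countable_Union) (auto simp: Q_def Z_def B_def)
  moreover have "negligible {t \<in> {c<..<d}. \<not> (\<exists>D. (B has_real_derivative D) (at t))}"
    unfolding B_def
    by (rule absolutely_continuous_differentiable_AE[OF lipschitz_imp_absolutely_continuous[OF integral_lipschitz[OF b]]])
  ultimately have "negligible (\<Union>(Z ` Q) \<union> {t \<in> {c<..<d}. \<not> (\<exists>D. (B has_real_derivative D) (at t))})"
    by (rule negligible_Un)
  moreover have "\<exists>D\<ge>b t. (B has_real_derivative D) (at t)"
    if t: "t \<in> {c<..<d}" and N: "t \<notin> \<Union>(Z ` Q)" and D: "(B has_real_derivative D) (at t)" for t D
  proof (rule ccontr)
    assume "\<not> ?thesis"
    then have "D < b t" using D by (meson not_le)
    obtain p where p: "p \<in> \<rat>" "D < p" "p < b t" using Rats_dense_in_real \<open>D < b t\<close> by blast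
    obtain q where q: "q \<in> \<rat>" "p < q" "q < b t" using Rats_dense_in_real p by blast
    have "t \<in> Z (p, q)" using frequently_slope_less[OF D p(2)] t q by (simp add: Z_def)
    moreover have "(p, q) \<in> Q" using p q by (simp add: Q_def)
    ultimately show False using N by blast
  qed
  ultimately show ?thesis unfolding B_def[symmetric] by (elim negligible_subset) blast
qed

section \<open>The comparison equation\<close>

text \<open>The running maximum of \<open>z e\<^bsup>eB\<^esup>\<close> is attained at the right endpoint: after a point \<open>t\<^sub>1\<close>
  where it equals \<open>W\<close>, the function \<open>W e\<^bsup>-eB\<^esup> - z\<close> is nonincreasing.\<close>

lemma delay_comparison:
  fixes B z b \<eta> :: "real \<Rightarrow> real"
  assumes "\<sigma> \<le> c" and N: "negligible N"
    and B: "L-lipschitz_on {\<sigma>..c} B" and z: "M-lipschitz_on {\<sigma>..c} z" and "z \<sigma> \<ge> 0"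
    and dB: "\<And>t. \<sigma> < t \<Longrightarrow> t < c \<Longrightarrow> t \<notin> N \<Longrightarrow> \<exists>D\<ge>b t. (B has_real_derivative D) (at t)"
    and b: "\<And>t. \<sigma> < t \<Longrightarrow> t < c \<Longrightarrow> b t \<ge> 0"
    and \<eta>: "\<And>t. \<sigma> < t \<Longrightarrow> t < c \<Longrightarrow> \<eta> t \<le> t"
    and B\<eta>: "\<And>t. \<sigma> < t \<Longrightarrow> t < c \<Longrightarrow> \<sigma> \<le> \<eta> t \<Longrightarrow> B t - B (\<eta> t) \<le> 1 / exp 1"
    and dz: "\<And>t. \<sigma> < t \<Longrightarrow> t < c \<Longrightarrow> t \<notin> N \<Longrightarrow>
       \<exists>D. (z has_real_derivative D) (at t) \<and> 0 \<le> D + b t * (if \<sigma> \<le> \<eta> t then z (\<eta> t) else 0)"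
  shows "z c \<ge> 0"
proof -
  define e where "e = exp (1::real)"
  have "e > 0" by (simp add: e_def)
  \<comment> \<open>The exponent carries the factor e because
    \<open>exp (e * (B t - B (\<eta> t)))\<close> is then at most e when the increment of
    \<open>B\<close> is at most 1/e, and e is exactly the factor produced by differentiating
    \<open>exp (- e * B t)\<close>.\<close>
  define w where "w t = z t * exp (e * B t)" for t
  have "continuous_on {\<sigma>..c} w"
    unfolding w_def using lipschitz_on_continuous_on[OF B] lipschitz_on_continuous_on[OF z]
    by (intro continuous_intros)
  then obtain t1 where t1: "t1 \<in> {\<sigma>..c}" "\<And>t. t \<in> {\<sigma>..c} \<Longrightarrow> w t \<le> w t1"
    using continuous_attains_sup[of "{\<sigma>..c}" w] \<open>\<sigma> \<le> c\<close> by auto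
  define W where "W = w t1"
  have "0 \<le> w \<sigma>" using \<open>z \<sigma> \<ge> 0\<close> by (simp add: w_def)
  then have "W \<ge> 0" using t1(2)[of \<sigma>] \<open>\<sigma> \<le> c\<close> by (simp add: W_def)
  define u where "u t = W * exp (- e * B t) - z t" for t
  have zw: "z t = w t * exp (- e * B t)" for t by (simp add: w_def exp_minus)
  \<comment> \<open>The exponent is bounded above on the compact interval, so its exponential is
    Lipschitz and the derivative criterion applies to \<open>u\<close>.\<close>
  have "\<exists>K. K-lipschitz_on {\<sigma>..c} u"
  proof -
    have B': "(\<bar>- e\<bar> * L)-lipschitz_on {\<sigma>..c} (\<lambda>t. - e * B t)" by (rule lipschitz_on_cmult_real[OF B])
    have "continuous_on {\<sigma>..c} (\<lambda>t. - e * B t)" by (rule lipschitz_on_continuous_on[OF B'])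
    then obtain t2 where "\<And>t. t \<in> {\<sigma>..c} \<Longrightarrow> - e * B t \<le> - e * B t2"
      using continuous_attains_sup[of "{\<sigma>..c}" "\<lambda>t. - e * B t"] \<open>\<sigma> \<le> c\<close>
      by (metis atLeastatMost_empty_iff compact_Icc)
    from lipschitz_on_exp[OF B' this] show ?thesis
      unfolding u_def using lipschitz_on_diff[OF lipschitz_on_cmult_real z] by blast
  qed
  then obtain K where "K-lipschitz_on {\<sigma>..c} u" ..
  then have ac: "absolutely_continuous_on_Icc t1 c u"
    using t1(1) by (intro lipschitz_imp_absolutely_continuous) (auto intro: lipschitz_on_subset)
  have "u c - u t1 \<le> 0 * (c - t1)"
  proof (rule absolutely_continuous_increment_le[OF ac _ N])
    show "t1 \<le> c" using t1 by simp
    fix t assume t: "t1 < t" "t < c" "t \<notin> N"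
    then have t': "\<sigma> < t" using t1 by simp
    obtain D where D: "D \<ge> b t" "(B has_real_derivative D) (at t)" using dB t t' by blast
    obtain D' where D': "(z has_real_derivative D') (at t)"
      "0 \<le> D' + b t * (if \<sigma> \<le> \<eta> t then z (\<eta> t) else 0)" using dz t t' by blast
    have du: "(u has_real_derivative (W * (exp (- e * B t) * (- e * D)) - D')) (at t)"
      unfolding u_def by (auto intro!: derivative_eq_intros D D')
    have "(if \<sigma> \<le> \<eta> t then z (\<eta> t) else 0) \<le> W * (e * exp (- e * B t))"
    proof (cases "\<sigma> \<le> \<eta> t")
      case True
      have "z (\<eta> t) \<le> W * exp (- e * B (\<eta> t))"
        unfolding zw[of "\<eta> t"] W_def using t1(2)[of "\<eta> t"] True \<eta>[OF t' t(2)] t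
        by (intro mult_right_mono) auto
      also have "\<dots> \<le> W * exp (1 + - e * B t)"
      proof -
        have "e * (B t - B (\<eta> t)) \<le> e * (1 / e)"
          using B\<eta>[OF t' t(2) True] \<open>e > 0\<close> by (intro mult_left_mono) (auto simp: e_def)
        then have "- e * B (\<eta> t) \<le> 1 + - e * B t" using \<open>e > 0\<close> by (simp add: algebra_simps)
        then show ?thesis using \<open>W \<ge> 0\<close> by (intro mult_left_mono) auto
      qed
      also have "exp (1 + - e * B t) = e * exp (- e * B t)" unfolding e_def by (rule exp_add)
      finally show ?thesis using True by simp
    qed (use \<open>W \<ge> 0\<close> \<open>e > 0\<close> in auto)
    then have "b t * (if \<sigma> \<le> \<eta> t then z (\<eta> t) else 0) \<le> b t * (W * (e * exp (- e * B t)))"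
      using b[OF t' t(2)] by (rule mult_left_mono)
    \<comment> \<open>Passing from \<open>b t\<close> to the possibly larger \<open>D\<close>
      matches the delayed term with the derivative of \<open>W * exp (- e * B t)\<close>; this is
      where \<open>W \<ge> 0\<close>, hence \<open>z \<sigma> \<ge> 0\<close>, enters.\<close>
    also have "\<dots> \<le> D * (W * (e * exp (- e * B t)))"
      using D(1) \<open>W \<ge> 0\<close> \<open>e > 0\<close> by (intro mult_right_mono) auto
    finally have "W * (exp (- e * B t) * (- e * D)) - D' \<le> 0" using D'(2) by (simp add: algebra_simps)
    with du show "\<exists>D\<le>0. (u has_real_derivative D) (at t)" by blast
  qed
  moreover have "u t1 = 0" using zw[of t1] by (simp add: u_def W_def)
  ultimately have "W * exp (- e * B c) \<le> z c" by (simp add: u_def)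
  then show ?thesis using \<open>W \<ge> 0\<close> by (smt (verit) exp_gt_zero mult_nonneg_nonneg)
qed

section \<open>A priori estimates\<close>

lemma absolutely_continuous_increment_bound:
  assumes ac: "absolutely_continuous_on_Icc c d f" and "c \<le> d" and N: "negligible N"
    and D: "\<And>t. c < t \<Longrightarrow> t < d \<Longrightarrow> t \<notin> N \<Longrightarrow> \<exists>D. (f has_real_derivative D) (at t) \<and> \<bar>D\<bar> \<le> p"
  shows "\<bar>f d - f c\<bar> \<le> p * (d - c)"
proof -
  have "f d - f c \<le> p * (d - c)"
    by (rule absolutely_continuous_increment_le[OF ac \<open>c \<le> d\<close> N]) (meson D abs_le_D1)
  moreover have "- f d - - f c \<le> p * (d - c)"
  proof (rule absolutely_continuous_increment_le[OF absolutely_continuous_uminus[OF ac] \<open>c \<le> d\<close> N])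
    fix t assume "c < t" "t < d" "t \<notin> N"
    then obtain D where "(f has_real_derivative D) (at t)" "\<bar>D\<bar> \<le> p" using D by blast
    then show "\<exists>D\<le>p. ((\<lambda>t. - f t) has_real_derivative D) (at t)"
      by (intro exI[of _ "- D"] conjI DERIV_minus) auto
  qed
  ultimately show ?thesis by (simp add: abs_le_iff)
qed

text \<open>The sum of two constants from the growth estimate on the initial interval:
  \<open>2 + (bb + S) / bb\<close> bounds the weighted supremum of x in units of \<open>D\<close>,
  the last fraction that of x'. Adding them gives one constant for both.\<close>

definition growth_constant :: "real \<Rightarrow> real \<Rightarrow> real" where
  "growth_constant bb S = 2 + (bb + S) / bb + (bb * (2 + (bb + S) / bb + 1) + S) / (1 - S)"

text \<open>The auxiliary equation \<open>x'(t) + b1(t) x(\<eta>(t)) = 0\<close> is the non-oscillating comparison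
  equation; \<open>B\<close> plays the role of a primitive of \<open>b1\<close>.\<close>

locale neutral_estimates =
  fixes l :: nat and a g :: "nat \<Rightarrow> real \<Rightarrow> real" and b h \<phi> \<psi> x :: "real \<Rightarrow> real"
    and \<sigma> \<Delta> D \<beta> bb S \<kappa>2 \<kappa>3 :: real and N :: "real set" and \<alpha> \<kappa> :: "nat \<Rightarrow> real"
    and b1 \<eta> B :: "real \<Rightarrow> real" and L :: real
  assumes \<Delta>: "\<Delta> > 0" and N: "negligible N" and bb: "bb > 0" and \<beta>: "\<beta> > 0"
    and \<alpha>_nonneg: "\<And>k. k \<in> {1..l} \<Longrightarrow> \<alpha> k \<ge> 0"
    and a: "\<And>k t. k \<in> {1..l} \<Longrightarrow> \<sigma> < t \<Longrightarrow> t \<notin> N \<Longrightarrow> \<bar>a k t\<bar> \<le> \<alpha> k"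
    and S: "S = (\<Sum>k=1..l. \<alpha> k)" "S < 1"
    and b: "\<And>t. \<sigma> < t \<Longrightarrow> t \<notin> N \<Longrightarrow> \<bar>b t\<bar> \<le> bb"
    and g: "\<And>k t. k \<in> {1..l} \<Longrightarrow> \<sigma> < t \<Longrightarrow> g k t \<le> t \<and> t - g k t \<le> \<Delta>"
    and g_null: "\<And>k Z. k \<in> {1..l} \<Longrightarrow> negligible Z \<Longrightarrow> negligible {t \<in> {\<sigma>..}. g k t \<in> Z}"
    and h: "\<And>t. \<sigma> < t \<Longrightarrow> h t \<le> t \<and> t - h t \<le> \<Delta>"
    and \<phi>: "\<And>s. s \<le> \<sigma> \<Longrightarrow> \<bar>\<phi> s\<bar> \<le> D" and \<psi>: "\<And>s. s < \<sigma> \<Longrightarrow> \<bar>\<psi> s\<bar> \<le> D"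
    and x_\<sigma>: "x \<sigma> = \<phi> \<sigma>"
    and x_lipschitz: "\<And>c. \<exists>L. L-lipschitz_on {\<sigma>..c} x"
    and x_deriv: "\<And>t. \<sigma> < t \<Longrightarrow> t \<notin> N \<Longrightarrow> (x has_real_derivative deriv x t) (at t)"
    and x_deriv_bound: "\<And>c. \<exists>C. \<forall>t. \<sigma> < t \<longrightarrow> t < c \<longrightarrow> t \<notin> N \<longrightarrow> \<bar>deriv x t\<bar> \<le> C"
    and eq: "\<And>t. \<sigma> < t \<Longrightarrow> t \<notin> N \<Longrightarrow>
        deriv x t - (\<Sum>k=1..l. a k t * (if g k t < \<sigma> then \<psi> (g k t) else deriv x (g k t)))
          = - b t * (if h t \<le> \<sigma> then \<phi> (h t) else x (h t))"
    and b1_lower: "\<And>t. \<sigma> < t \<Longrightarrow> \<beta> \<le> b1 t" and b1_upper: "\<And>t. \<sigma> < t \<Longrightarrow> t \<notin> N \<Longrightarrow> b1 t \<le> bb"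
    and \<eta>: "\<And>t. \<sigma> < t \<Longrightarrow> h t \<le> \<eta> t \<and> \<eta> t \<le> t"
    and B_lipschitz: "\<And>c. L-lipschitz_on {\<sigma>..c} B"
    and B_deriv: "\<And>t. \<sigma> < t \<Longrightarrow> t \<notin> N \<Longrightarrow> \<exists>D\<ge>b1 t. (B has_real_derivative D) (at t)"
    and B_\<eta>: "\<And>t. \<sigma> < t \<Longrightarrow> \<sigma> \<le> \<eta> t \<Longrightarrow> B t - B (\<eta> t) \<le> 1 / exp 1"
    and \<kappa>: "\<And>k t. k \<in> {1..l} \<Longrightarrow> \<sigma> < t \<Longrightarrow> t \<notin> N \<Longrightarrow> \<bar>a k t\<bar> \<le> \<kappa> k * b1 t"
    and \<kappa>2: "\<And>t. \<sigma> < t \<Longrightarrow> t \<notin> N \<Longrightarrow> \<bar>b t - b1 t\<bar> \<le> \<kappa>2 * b1 t"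
    and \<kappa>3: "\<And>t. \<sigma> < t \<Longrightarrow> t \<notin> N \<Longrightarrow> \<bar>b t\<bar> * (\<eta> t - h t) \<le> \<kappa>3 * b1 t"
begin

lemma D_nonneg: "D \<ge> 0" using \<phi>[of \<sigma>] by linarith

lemma S_nonneg: "S \<ge> 0" unfolding S using \<alpha>_nonneg by (intro sum_nonneg) auto

text \<open>The equation maps a bound \<open>|x'| \<le> C E\<close> to \<open>|x'| \<le> (\<rho> S C + const) E\<close>; starting from any finite
  bound, iterate this contraction to its fixed point.\<close>

lemma deriv_weight_bound:
  fixes E :: "real \<Rightarrow> real"
  assumes E_pos: "m > 0" "\<And>t. \<sigma> \<le> t \<Longrightarrow> t \<le> c \<Longrightarrow> m \<le> E t"
    and E_shift: "\<And>s t. \<sigma> \<le> s \<Longrightarrow> s \<le> t \<Longrightarrow> t \<le> c \<Longrightarrow> t - s \<le> \<Delta> \<Longrightarrow> E s \<le> \<rho> * E t"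
    and E_start: "\<And>t. \<sigma> \<le> t \<Longrightarrow> t \<le> c \<Longrightarrow> t - \<sigma> \<le> \<Delta> \<Longrightarrow> 1 \<le> \<rho> * E t"
    and \<rho>: "\<rho> \<ge> 1" "\<rho> * S < 1"
    and X: "\<And>t. \<sigma> \<le> t \<Longrightarrow> t \<le> c \<Longrightarrow> \<bar>x t\<bar> \<le> X * E t" and "X \<ge> 0"
  shows "negligible {t \<in> {\<sigma><..<c}. \<not> \<bar>deriv x t\<bar> \<le> \<rho> * (bb * (X + D) + S * D) / (1 - \<rho> * S) * E t}"
proof -
  define bad where "bad C = {t \<in> {\<sigma><..<c}. \<not> \<bar>deriv x t\<bar> \<le> C * E t}" for C
  define F where "F C = \<rho> * S * C + \<rho> * (bb * (X + D) + S * D)" for C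
  define \<nu> where "\<nu> = \<rho> * (bb * (X + D) + S * D) / (1 - \<rho> * S)"
  have step: "negligible (bad (F C))" if neg: "negligible (bad C)" and "C \<ge> 0" for C
  proof -
    \<comment> \<open>The preimages of \<open>bad C\<close> are null by \<open>g_null\<close>, so
      the bound for x' is available at \<open>g k t\<close> for almost every \<open>t\<close>. The
      point \<open>\<sigma>\<close> joins because the derivative is controlled only beyond
      it.\<close>
    define Z where "Z = N \<union> (\<Union>k\<in>{1..l}. {t \<in> {\<sigma>..}. g k t \<in> insert \<sigma> (bad C)})"
    have "negligible Z"
      unfolding Z_def
    proof (intro negligible_Un N negligible_Union)
      fix T assume "T \<in> (\<lambda>k. {t \<in> {\<sigma>..}. g k t \<in> insert \<sigma> (bad C)}) ` {1..l}"
      then obtain k where k: "k \<in> {1..l}" "T = {t \<in> {\<sigma>..}. g k t \<in> insert \<sigma> (bad C)}" by blast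
      show "negligible T" unfolding k(2) by (rule g_null[OF k(1)]) (simp add: neg negligible_insert)
    qed simp
    moreover have "bad (F C) \<subseteq> Z"
    proof (rule subsetI, rule ccontr)
      fix t assume t: "t \<in> bad (F C)" and "t \<notin> Z"
      then have t': "\<sigma> < t" "t < c" "t \<notin> N" "\<And>k. k \<in> {1..l} \<Longrightarrow> g k t \<notin> insert \<sigma> (bad C)"
        by (auto simp: bad_def Z_def)
      have Et: "E t > 0" using E_pos t' by (smt (verit))
      define y where "y k = (if g k t < \<sigma> then \<psi> (g k t) else deriv x (g k t))" for k
      define w where "w = (if h t \<le> \<sigma> then \<phi> (h t) else x (h t))"
      have y: "\<bar>y k\<bar> \<le> (C + D) * (\<rho> * E t)" if k: "k \<in> {1..l}" for k
      proof (cases "g k t < \<sigma>")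
        case True
        \<comment> \<open>A delayed argument before \<open>\<sigma>\<close> forces
          \<open>t - \<sigma> \<le> \<Delta>\<close>, where the weight is still at least
          \<open>1 / \<rho>\<close>; thus a multiple of it dominates the data bound
          \<open>D\<close>.\<close>
        then have "1 \<le> \<rho> * E t" using E_start[of t] g[OF k t'(1)] t' by auto
        have "\<bar>y k\<bar> \<le> D * 1" using True \<psi> by (simp add: y_def)
        also have "\<dots> \<le> (C + D) * (\<rho> * E t)" 
          using \<open>1 \<le> \<rho> * E t\<close> \<open>C \<ge> 0\<close> D_nonneg by (intro mult_mono) auto
        finally show ?thesis .
      next
        case False
        then have gt: "\<sigma> < g k t" "g k t \<notin> bad C" using t'(4)[OF k] by auto
        have "\<bar>y k\<bar> \<le> C * E (g k t)" using False gt g[OF k t'(1)] t' by (auto simp: y_def bad_def)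
        also have "\<dots> \<le> C * (\<rho> * E t)" 
          using E_shift[of "g k t" t] g[OF k t'(1)] gt t' \<open>C \<ge> 0\<close> by (intro mult_left_mono) auto
        also have "\<dots> \<le> (C + D) * (\<rho> * E t)" 
          using \<rho> Et D_nonneg by (intro mult_right_mono) auto
        finally show ?thesis .
      qed
      have w: "\<bar>w\<bar> \<le> (X + D) * (\<rho> * E t)"
      proof (cases "h t \<le> \<sigma>")
        case True
        then have "1 \<le> \<rho> * E t" using E_start[of t] h[OF t'(1)] t' by auto
        have "\<bar>w\<bar> \<le> D * 1" using True \<phi> by (simp add: w_def)
        also have "\<dots> \<le> (X + D) * (\<rho> * E t)" 
          using \<open>1 \<le> \<rho> * E t\<close> \<open>X \<ge> 0\<close> D_nonneg by (intro mult_mono) auto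
        finally show ?thesis .
      next
        case False
        have "\<bar>w\<bar> \<le> X * E (h t)" using False X[of "h t"] h[OF t'(1)] t' by (auto simp: w_def)
        also have "\<dots> \<le> X * (\<rho> * E t)" 
          using E_shift[of "h t" t] h[OF t'(1)] False t' \<open>X \<ge> 0\<close> by (intro mult_left_mono) auto
        also have "\<dots> \<le> (X + D) * (\<rho> * E t)" 
          using \<rho> Et D_nonneg by (intro mult_right_mono) auto
        finally show ?thesis .
      qed
      have "\<bar>\<Sum>k=1..l. a k t * y k\<bar> \<le> (\<Sum>k=1..l. \<alpha> k * ((C + D) * (\<rho> * E t)))"
      proof (rule order_trans[OF sum_abs sum_mono])
        fix k assume k: "k \<in> {1..l}"
        show "\<bar>a k t * y k\<bar> \<le> \<alpha> k * ((C + D) * (\<rho> * E t))"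
          unfolding abs_mult using a[OF k t'(1,3)] y[OF k] \<alpha>_nonneg[OF k] by (intro mult_mono) auto
      qed
      also have "\<dots> = S * ((C + D) * (\<rho> * E t))" by (simp only: S sum_distrib_right)
      finally have 1: "\<bar>\<Sum>k=1..l. a k t * y k\<bar> \<le> S * ((C + D) * (\<rho> * E t))" .
      have 2: "\<bar>b t * w\<bar> \<le> bb * ((X + D) * (\<rho> * E t))"
        unfolding abs_mult using b[OF t'(1,3)] w bb by (intro mult_mono) auto
      have "deriv x t = (\<Sum>k=1..l. a k t * y k) - b t * w"
        using eq[OF t'(1,3)] by (simp add: y_def w_def)
      then have "\<bar>deriv x t\<bar> \<le> S * ((C + D) * (\<rho> * E t)) + bb * ((X + D) * (\<rho> * E t))"
        using 1 2 by linarith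
      also have "\<dots> = F C * E t" by (simp add: F_def algebra_simps)
      finally show False using t by (simp add: bad_def)
    qed
    ultimately show ?thesis by (rule negligible_subset)
  qed
  have F_nonneg: "F C \<ge> 0" if "C \<ge> 0" for C
    using that \<rho> S_nonneg bb \<open>X \<ge> 0\<close> D_nonneg unfolding F_def by simp
  obtain C0 where C0: "\<forall>t. \<sigma> < t \<longrightarrow> t < c \<longrightarrow> t \<notin> N \<longrightarrow> \<bar>deriv x t\<bar> \<le> C0" using x_deriv_bound by blast
  \<comment> \<open>The local bound \<open>C0\<close>, of unknown size, becomes a first multiple of
    \<open>E\<close> through the lower bound \<open>m\<close>; its size disappears in the limit of
    the iteration.\<close>
  define C1 where "C1 = \<bar>C0\<bar> / m"
  have "C1 \<ge> 0" using E_pos(1) by (simp add: C1_def)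
  have "bad C1 \<subseteq> N"
  proof (rule subsetI, rule ccontr)
    fix t assume t: "t \<in> bad C1" "t \<notin> N"
    then have "\<bar>deriv x t\<bar> \<le> \<bar>C0\<bar>" using C0 by (fastforce simp: bad_def)
    also have "\<dots> = C1 * m" using E_pos(1) by (simp add: C1_def)
    also have "\<dots> \<le> C1 * E t" using t E_pos(2) \<open>C1 \<ge> 0\<close> by (intro mult_left_mono) (auto simp: bad_def)
    finally show False using t by (simp add: bad_def)
  qed
  then have C1: "negligible (bad C1)" using N negligible_subset by blast
  have iter: "negligible (bad ((F ^^ n) C1)) \<and> (F ^^ n) C1 \<ge> 0" for n
    by (induction n) (use C1 \<open>C1 \<ge> 0\<close> step F_nonneg in auto)
  have closed: "(F ^^ n) C1 = (\<rho> * S) ^ n * (C1 - \<nu>) + \<nu>" for n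
  proof (induction n)
    case (Suc n)
    have "\<nu> * (1 - \<rho> * S) = \<rho> * (bb * (X + D) + S * D)" using \<rho> by (simp add: \<nu>_def)
    then have "F C = \<rho> * S * (C - \<nu>) + \<nu>" for C by (simp add: F_def algebra_simps)
    then show ?case using Suc by simp
  qed simp
  have "(\<lambda>n. (\<rho> * S) ^ n) \<longlonglongrightarrow> 0"
    using \<rho> S_nonneg by (intro LIMSEQ_realpow_zero) auto
  then have "(\<lambda>n. (\<rho> * S) ^ n * (C1 - \<nu>) + \<nu>) \<longlonglongrightarrow> 0 * (C1 - \<nu>) + \<nu>"
    by (intro tendsto_add tendsto_mult tendsto_const)
  then have lim: "(\<lambda>n. (F ^^ n) C1) \<longlonglongrightarrow> \<nu>" by (simp add: closed)
  \<comment> \<open>Outside the null sets of all iterates every bound holds at once, so passing to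
    the limit costs only a countable union.\<close>
  have "bad \<nu> \<subseteq> (\<Union>n. bad ((F ^^ n) C1))"
  proof (rule subsetI, rule ccontr)
    fix t assume t: "t \<in> bad \<nu>" and "t \<notin> (\<Union>n. bad ((F ^^ n) C1))"
    then have "\<bar>deriv x t\<bar> \<le> (F ^^ n) C1 * E t" for n by (auto simp: bad_def)
    moreover have "(\<lambda>n. (F ^^ n) C1 * E t) \<longlonglongrightarrow> \<nu> * E t" using lim by (intro tendsto_intros)
    ultimately have "\<bar>deriv x t\<bar> \<le> \<nu> * E t" by (intro LIMSEQ_le_const) auto
    then show False using t by (simp add: bad_def)
  qed
  moreover have "negligible (\<Union>n. bad ((F ^^ n) C1))" using iter by (intro negligible_Union_nat) auto
  ultimately have "negligible (bad \<nu>)" using negligible_subset by blast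
  then show ?thesis unfolding bad_def \<nu>_def .
qed

lemma x_continuous: "continuous_on {\<sigma>..c} x"
  using x_lipschitz lipschitz_on_continuous_on by blast

text \<open>Here the weight is the growing function \<open>exp (\<lambda> (t - \<sigma>))\<close>, for which no shift loss occurs.\<close>

lemma initial_growth:
  assumes "\<sigma> < c"
  shows "\<bar>x c\<bar> \<le> growth_constant bb S * D * exp (2 * bb / (1 - S) * (c - \<sigma>))"
    and "negligible {t \<in> {\<sigma><..<c}. \<not> \<bar>deriv x t\<bar> \<le> growth_constant bb S * D * exp (2 * bb / (1 - S) * (t - \<sigma>))}"
proof -
  \<comment> \<open>Chosen so that integrating \<open>\<nu> * E\<close> contributes
    \<open>\<nu> / lam\<close>, in which \<open>X\<close> has coefficient 1/2 and can be
    absorbed.\<close>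
  define lam where "lam = 2 * bb / (1 - S)"
  have lam: "lam > 0" using bb S by (simp add: lam_def)
  define E where "E t = exp (lam * (t - \<sigma>))" for t
  have "continuous_on {\<sigma>..c} (\<lambda>t. \<bar>x t\<bar> / E t)"
    unfolding E_def by (intro continuous_intros x_continuous) auto
  then obtain t1 where t1: "t1 \<in> {\<sigma>..c}" "\<And>t. t \<in> {\<sigma>..c} \<Longrightarrow> \<bar>x t\<bar> / E t \<le> \<bar>x t1\<bar> / E t1"
    using continuous_attains_sup[of "{\<sigma>..c}" "\<lambda>t. \<bar>x t\<bar> / E t"] \<open>\<sigma> < c\<close>
    by (metis atLeastatMost_empty_iff compact_Icc less_imp_le)
  define X where "X = \<bar>x t1\<bar> / E t1"
  have Epos: "E t > 0" for t by (simp add: E_def)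
  have "X \<ge> 0" by (simp add: X_def E_def)
  have X: "\<bar>x t\<bar> \<le> X * E t" if "\<sigma> \<le> t" "t \<le> c" for t
    using t1(2)[of t] that Epos[of t] by (simp add: X_def field_simps)
  define \<nu> where "\<nu> = (bb * (X + D) + S * D) / (1 - S)"
  define Z where "Z = {t \<in> {\<sigma><..<c}. \<not> \<bar>deriv x t\<bar> \<le> \<nu> * E t}"
  have Z: "negligible Z"
  proof -
    \<comment> \<open>The weight is increasing and at least 1, so the shift factor
      \<open>\<rho>\<close> can be taken to be 1.\<close>
    have "negligible {t \<in> {\<sigma><..<c}. \<not> \<bar>deriv x t\<bar> \<le> 1 * (bb * (X + D) + S * D) / (1 - 1 * S) * E t}"
      by (rule deriv_weight_bound[where m = 1]) (use lam X \<open>X \<ge> 0\<close> S in \<open>auto simp: E_def\<close>)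
    then show ?thesis by (simp add: Z_def \<nu>_def)
  qed
  have "\<nu> \<ge> 0" using S bb \<open>X \<ge> 0\<close> D_nonneg S_nonneg by (simp add: \<nu>_def)
  have "\<bar>x t1\<bar> \<le> D + \<nu> / lam * E t1"
  proof -
    obtain M where M: "M-lipschitz_on {\<sigma>..t1} x" using x_lipschitz by blast
    have ME: "\<exists>M. M-lipschitz_on {\<sigma>..t1} (\<lambda>t. \<nu> / lam * E t)"
    proof -
      have "(\<bar>lam\<bar> * 1)-lipschitz_on {\<sigma>..t1} (\<lambda>t. lam * (t - \<sigma>))"
        by (intro lipschitz_on_cmult_real lipschitz_onI) (auto simp: dist_real_def)
      from lipschitz_on_exp[OF this, of "lam * (t1 - \<sigma>)"] lam
      have "\<exists>M. M-lipschitz_on {\<sigma>..t1} E" by (auto simp: E_def)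
      then show ?thesis using lipschitz_on_cmult_real by blast
    qed
    then obtain M' where M': "M'-lipschitz_on {\<sigma>..t1} (\<lambda>t. \<nu> / lam * E t)" ..
    have dE: "((\<lambda>t. \<nu> / lam * E t) has_real_derivative \<nu> * E t) (at t)" for t
      unfolding E_def using lam by (auto intro!: derivative_eq_intros)
    \<comment> \<open>\<open>\<nu> / lam * E\<close> is a primitive of the bound for x'; the sign
      \<open>s\<close> treats x and -x together.\<close>
    have sx: "s * x t1 - s * x \<sigma> \<le> \<nu> / lam * E t1" if s: "\<bar>s\<bar> = 1" for s
    proof -
      define u where "u t = s * x t - \<nu> / lam * E t" for t
      have ac: "absolutely_continuous_on_Icc \<sigma> t1 u"
        unfolding u_def
        by (rule lipschitz_imp_absolutely_continuous[OF lipschitz_on_diff[OF lipschitz_on_cmult_real[OF M] M']])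
      have "u t1 - u \<sigma> \<le> 0 * (t1 - \<sigma>)"
      proof (rule absolutely_continuous_increment_le[OF ac _ negligible_Un[OF N Z]])
        show "\<sigma> \<le> t1" using t1 by simp
        fix t assume t: "\<sigma> < t" "t < t1" "t \<notin> N \<union> Z"
        then have "(u has_real_derivative s * deriv x t - \<nu> * E t) (at t)"
          unfolding u_def by (intro DERIV_diff DERIV_cmult dE x_deriv) auto
        moreover have "\<bar>s * deriv x t\<bar> \<le> \<nu> * E t" using t t1 s by (auto simp: Z_def abs_mult)
        ultimately show "\<exists>D\<le>0. (u has_real_derivative D) (at t)" by (intro exI conjI) auto
      qed
      moreover have "E \<sigma> = 1" by (simp add: E_def)
      moreover have "0 \<le> \<nu> / lam" using \<open>\<nu> \<ge> 0\<close> lam by simp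
      ultimately show ?thesis unfolding u_def by simp
    qed
    from sx[of 1] sx[of "-1"] show ?thesis using \<phi>[of \<sigma>] x_\<sigma> by (simp add: abs_le_iff)
  qed
  then have "X \<le> (D + \<nu> / lam * E t1) / E t1" unfolding X_def by (intro divide_right_mono) (auto simp: E_def)
  also have "\<dots> = D / E t1 + \<nu> / lam" using Epos[of t1] by (simp add: field_simps)
  also have "D / E t1 \<le> D"
    using D_nonneg t1 lam by (intro divide_le_eq[THEN iffD2] ) (auto simp: E_def mult_le_cancel_left1)
  also have "\<nu> / lam = (bb * (X + D) + S * D) / (2 * bb)"
    using S bb by (simp add: \<nu>_def lam_def field_simps)
  finally have "X \<le> D + (bb * (X + D) + S * D) / (2 * bb)" by simp
  then have XD: "X \<le> (2 + (bb + S) / bb) * D" using bb by (simp add: field_simps)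
  define C where "C = (bb * (2 + (bb + S) / bb + 1) + S) / (1 - S)"
  have C0: "C \<ge> 0" using S bb S_nonneg by (simp add: C_def)
  have "\<nu> \<le> C * D"
  proof -
    have "bb * (X + D) + S * D \<le> bb * ((2 + (bb + S) / bb) * D + D) + S * D"
      using XD bb by (intro add_right_mono mult_left_mono) auto
    also have "\<dots> = (bb * (2 + (bb + S) / bb + 1) + S) * D" by (simp add: algebra_simps)
    finally have "\<nu> \<le> (bb * (2 + (bb + S) / bb + 1) + S) * D / (1 - S)"
      unfolding \<nu>_def using S by (intro divide_right_mono) auto
    then show ?thesis by (simp add: C_def)
  qed
  moreover have "0 \<le> (2 + (bb + S) / bb) * D" using bb S_nonneg D_nonneg by simp
  ultimately have \<nu>G: "\<nu> \<le> growth_constant bb S * D" 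
    unfolding growth_constant_def C_def[symmetric] by (simp add: distrib_right)
  have XG: "X \<le> growth_constant bb S * D" 
    using XD C0 D_nonneg unfolding growth_constant_def C_def[symmetric] by (simp add: distrib_right add_increasing2)
  have "\<bar>x c\<bar> \<le> X * E c" using X[of c] \<open>\<sigma> < c\<close> by simp
  also have "\<dots> \<le> growth_constant bb S * D * E c" using XG Epos[of c] by (intro mult_right_mono) auto
  finally show "\<bar>x c\<bar> \<le> growth_constant bb S * D * exp (2 * bb / (1 - S) * (c - \<sigma>))" by (simp add: E_def lam_def)
  have "{t \<in> {\<sigma><..<c}. \<not> \<bar>deriv x t\<bar> \<le> growth_constant bb S * D * E t} \<subseteq> Z"
  proof -
    have "\<nu> * E t \<le> growth_constant bb S * D * E t" for t using \<nu>G Epos[of t] by (intro mult_right_mono) auto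
    then show ?thesis unfolding Z_def by (smt (verit) Collect_mono_iff)
  qed
  then show "negligible {t \<in> {\<sigma><..<c}. \<not> \<bar>deriv x t\<bar> \<le> growth_constant bb S * D * exp (2 * bb / (1 - S) * (t - \<sigma>))}"
    using Z negligible_subset unfolding E_def lam_def by blast
qed

text \<open>Beyond \<open>\<sigma> + \<Delta>\<close> every delayed argument exceeds
  \<open>\<sigma>\<close>, and the equation turns the left side into the neutral sum, plus
  \<open>b t * (x (\<eta> t) - x (h t))\<close>, minus \<open>(b t - b1 t) * x (\<eta> t)\<close>.
  The hypotheses on \<open>\<kappa>\<close>, \<open>\<kappa>3\<close> and \<open>\<kappa>2\<close>
  make these terms multiples of \<open>b1 t\<close>, the form that a barrier can dominate.\<close>

lemma remainder_bound:
  fixes E :: "real \<Rightarrow> real"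
  assumes E_nonneg: "\<And>t. \<sigma> \<le> t \<Longrightarrow> t \<le> c \<Longrightarrow> 0 \<le> E t" and "\<rho> \<ge> 0"
    and E_shift: "\<And>s t. \<sigma> \<le> s \<Longrightarrow> s \<le> t \<Longrightarrow> t \<le> c \<Longrightarrow> t - s \<le> \<Delta> \<Longrightarrow> E s \<le> \<rho> * E t"
    and X: "\<And>t. \<sigma> \<le> t \<Longrightarrow> t \<le> c \<Longrightarrow> \<bar>x t\<bar> \<le> X * E t" and "X \<ge> 0"
    and Z: "negligible Z" "\<And>t. \<sigma> < t \<Longrightarrow> t < c \<Longrightarrow> t \<notin> Z \<Longrightarrow> \<bar>deriv x t\<bar> \<le> \<nu> * E t" and "\<nu> \<ge> 0"
  obtains Z' where "negligible Z'"
    "\<And>t. \<sigma> + \<Delta> < t \<Longrightarrow> t < c \<Longrightarrow> t \<notin> Z' \<Longrightarrow>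
      \<bar>deriv x t + b1 t * x (\<eta> t)\<bar> \<le> b1 t * (\<rho> * (((\<Sum>k=1..l. \<kappa> k) + \<kappa>3) * \<nu> + \<kappa>2 * X)) * E t"
proof
  define Z' where "Z' = N \<union> Z \<union> (\<Union>k\<in>{1..l}. {t \<in> {\<sigma>..}. g k t \<in> Z})"
  show "negligible Z'"
    unfolding Z'_def using N Z(1) g_null by (intro negligible_Un negligible_Union) auto
  fix t assume t: "\<sigma> + \<Delta> < t" "t < c" "t \<notin> Z'"
  then have t': "\<sigma> < t" "t \<notin> N" "\<And>k. k \<in> {1..l} \<Longrightarrow> g k t \<notin> Z" using \<Delta> by (auto simp: Z'_def)
  have ht: "\<sigma> < h t" "h t \<le> \<eta> t" "\<eta> t \<le> t" "t - h t \<le> \<Delta>"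
    using h[OF t'(1)] \<eta>[OF t'(1)] t by auto
  have gt: "\<sigma> < g k t" "g k t \<le> t" "t - g k t \<le> \<Delta>" if "k \<in> {1..l}" for k
    using g[OF that t'(1)] t by auto
  have b1: "0 \<le> b1 t" using b1_lower[OF t'(1)] \<beta> by linarith
  have \<rho>E: "\<nu> * E s \<le> \<nu> * (\<rho> * E t)" if "\<sigma> \<le> s" "s \<le> t" "t - s \<le> \<Delta>" for s
    using E_shift[OF that(1,2) _ that(3)] t \<open>\<nu> \<ge> 0\<close> by (intro mult_left_mono) auto
  have "deriv x t = (\<Sum>k=1..l. a k t * deriv x (g k t)) - b t * x (h t)"
  proof -
    have "(\<Sum>k=1..l. a k t * (if g k t < \<sigma> then \<psi> (g k t) else deriv x (g k t)))
        = (\<Sum>k=1..l. a k t * deriv x (g k t))"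
      using gt by (intro sum.cong) fastforce+
    then show ?thesis using eq[OF t'(1,2)] ht by simp
  qed
  then have "deriv x t + b1 t * x (\<eta> t) = (\<Sum>k=1..l. a k t * deriv x (g k t))
      + b t * (x (\<eta> t) - x (h t)) - (b t - b1 t) * x (\<eta> t)" by (simp add: algebra_simps)
  moreover have "\<bar>\<Sum>k=1..l. a k t * deriv x (g k t)\<bar> \<le> (\<Sum>k=1..l. \<kappa> k) * (b1 t * (\<nu> * (\<rho> * E t)))"
    unfolding sum_distrib_right
  proof (rule order_trans[OF sum_abs sum_mono])
    fix k assume k: "k \<in> {1..l}"
    have "\<bar>deriv x (g k t)\<bar> \<le> \<nu> * E (g k t)" using gt[OF k] t'(3)[OF k] t by (intro Z(2)) auto
    also have "\<dots> \<le> \<nu> * (\<rho> * E t)" using gt[OF k] by (intro \<rho>E) auto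
    finally have "\<bar>a k t * deriv x (g k t)\<bar> \<le> (\<kappa> k * b1 t) * (\<nu> * (\<rho> * E t))"
      unfolding abs_mult using \<kappa>[OF k t'(1,2)] by (intro mult_mono) auto
    then show "\<bar>a k t * deriv x (g k t)\<bar> \<le> \<kappa> k * (b1 t * (\<nu> * (\<rho> * E t)))" by (simp add: mult.assoc)
  qed
  moreover have "\<bar>b t * (x (\<eta> t) - x (h t))\<bar> \<le> \<kappa>3 * (b1 t * (\<nu> * (\<rho> * E t)))"
  proof -
    obtain M where "M-lipschitz_on {\<sigma>..\<eta> t} x" using x_lipschitz by blast
    then have M: "M-lipschitz_on {h t..\<eta> t} x" using ht by (rule_tac lipschitz_on_subset) auto
    \<comment> \<open>Changing the delay is paid for by x', integrated over an interval of length
      \<open>\<eta> t - h t\<close>; hence \<open>\<kappa>3\<close> joins the neutral coefficients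
      in \<open>\<kappa>0\<close>.\<close>
    have "\<bar>x (\<eta> t) - x (h t)\<bar> \<le> \<nu> * (\<rho> * E t) * (\<eta> t - h t)"
    proof (rule absolutely_continuous_increment_bound[OF lipschitz_imp_absolutely_continuous[OF M] ht(2) negligible_Un[OF N Z(1)]])
      fix s assume s: "h t < s" "s < \<eta> t" "s \<notin> N \<union> Z"
      then have s': "\<sigma> < s" using ht by linarith
      have "\<bar>deriv x s\<bar> \<le> \<nu> * E s" using s s' ht t by (intro Z(2)) auto
      also have "\<dots> \<le> \<nu> * (\<rho> * E t)" using s s' ht by (intro \<rho>E) auto
      finally show "\<exists>D. (x has_real_derivative D) (at s) \<and> \<bar>D\<bar> \<le> \<nu> * (\<rho> * E t)"
        using x_deriv[of s] s s' by auto
    qed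
    moreover have "0 \<le> \<nu> * (\<rho> * E t)" using \<open>\<nu> \<ge> 0\<close> \<open>\<rho> \<ge> 0\<close> E_nonneg[of t] t t' by simp
    ultimately have "\<bar>b t\<bar> * \<bar>x (\<eta> t) - x (h t)\<bar> \<le> \<bar>b t\<bar> * (\<nu> * (\<rho> * E t) * (\<eta> t - h t))"
      by (intro mult_left_mono) auto
    also have "\<dots> = (\<bar>b t\<bar> * (\<eta> t - h t)) * (\<nu> * (\<rho> * E t))" by simp
    also have "\<dots> \<le> (\<kappa>3 * b1 t) * (\<nu> * (\<rho> * E t))"
      using \<kappa>3[OF t'(1,2)] \<open>0 \<le> \<nu> * (\<rho> * E t)\<close> by (rule mult_right_mono)
    finally show ?thesis by (simp add: abs_mult mult.assoc)
  qed
  moreover have "\<bar>(b t - b1 t) * x (\<eta> t)\<bar> \<le> \<kappa>2 * (b1 t * (X * (\<rho> * E t)))"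
  proof -
    have "\<bar>x (\<eta> t)\<bar> \<le> X * E (\<eta> t)" using ht t by (intro X) auto
    also have "\<dots> \<le> X * (\<rho> * E t)"
      using E_shift[of "\<eta> t" t] ht t \<open>X \<ge> 0\<close> by (intro mult_left_mono) auto
    finally have "\<bar>(b t - b1 t) * x (\<eta> t)\<bar> \<le> (\<kappa>2 * b1 t) * (X * (\<rho> * E t))"
      unfolding abs_mult using \<kappa>2[OF t'(1,2)] by (intro mult_mono) auto
    then show ?thesis by (simp add: mult.assoc)
  qed
  ultimately have "\<bar>deriv x t + b1 t * x (\<eta> t)\<bar> \<le> (\<Sum>k=1..l. \<kappa> k) * (b1 t * (\<nu> * (\<rho> * E t)))
      + \<kappa>3 * (b1 t * (\<nu> * (\<rho> * E t))) + \<kappa>2 * (b1 t * (X * (\<rho> * E t)))" by linarith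
  also have "\<dots> = b1 t * (\<rho> * (((\<Sum>k=1..l. \<kappa> k) + \<kappa>3) * \<nu> + \<kappa>2 * X)) * E t"
    by (simp add: algebra_simps)
  finally show "\<bar>deriv x t + b1 t * x (\<eta> t)\<bar>
      \<le> b1 t * (\<rho> * (((\<Sum>k=1..l. \<kappa> k) + \<kappa>3) * \<nu> + \<kappa>2 * X)) * E t" .
qed

section \<open>Barrier and exponential decay\<close>

text \<open>The barrier increases linearly on \<open>[\<sigma>,\<sigma>+\<Delta>]\<close>, where the history still enters and only crude
  bounds are available, and decays exponentially afterwards.\<close>

lemma barrier_bound:
  assumes \<gamma>: "0 < \<gamma>" "\<gamma> * (1 + \<Delta>) \<le> \<beta>" and "\<sigma> \<le> c" and "C \<ge> 1" and "K \<ge> 0"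
    and xC: "\<And>t. \<sigma> \<le> t \<Longrightarrow> t \<le> \<sigma> + \<Delta> \<Longrightarrow> \<bar>x t\<bar> \<le> C * D"
    and Z: "negligible Z" and dC: "\<And>t. \<sigma> < t \<Longrightarrow> t < \<sigma> + \<Delta> \<Longrightarrow> t \<notin> Z \<Longrightarrow> \<bar>deriv x t\<bar> \<le> C * D"
    and K: "\<And>t. \<sigma> + \<Delta> < t \<Longrightarrow> t < c \<Longrightarrow> t \<notin> Z \<Longrightarrow>
      \<bar>deriv x t + b1 t * x (\<eta> t)\<bar> \<le> b1 t * K * exp (- \<gamma> * (t - \<sigma>))"
  shows "\<bar>x c\<bar> \<le> exp (\<gamma> * \<Delta>) * (K / (1 - \<gamma> / \<beta>) + (1 + bb) * C * D * (1 + \<Delta>)) * exp (- \<gamma> * (c - \<sigma>))"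
proof -
  \<comment> \<open>The slope of the rising part has to outweigh x', at most \<open>C * D\<close>,
    and the delayed term, at most \<open>bb * C * D\<close>.\<close>
  define \<Lambda> where "\<Lambda> = (1 + bb) * C * D"
  \<comment> \<open>Dividing by \<open>1 - \<gamma> / \<beta>\<close> compensates the loss
    \<open>\<gamma> * K'\<close> from differentiating the decaying barrier, since
    \<open>b1 t \<ge> \<beta>\<close>.\<close>
  define K' where "K' = K / (1 - \<gamma> / \<beta>)"
  have "\<gamma> < \<beta>"
  proof -
    have "\<gamma> * 1 < \<gamma> * (1 + \<Delta>)" using \<gamma>(1) \<Delta> by (intro mult_strict_left_mono) auto
    then show ?thesis using \<gamma>(2) by linarith
  qed
  then have \<gamma>\<beta>: "0 < 1 - \<gamma> / \<beta>" using \<beta> by simp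
  have "K' \<ge> 0" using \<open>K \<ge> 0\<close> \<gamma>\<beta> by (simp add: K'_def)
  have CD: "0 \<le> C * D" "D \<le> C * D" using \<open>C \<ge> 1\<close> D_nonneg by (auto simp: mult_le_cancel_right1)
  have "\<Lambda> = C * D + bb * (C * D)" by (simp add: \<Lambda>_def algebra_simps)
  have "0 \<le> bb * (C * D)" by (rule mult_nonneg_nonneg[OF less_imp_le[OF bb] CD(1)])
  then have \<Lambda>: "0 \<le> \<Lambda>" "C * D \<le> \<Lambda>" using \<open>\<Lambda> = C * D + bb * (C * D)\<close> CD by auto
  define T where "T = \<sigma> + \<Delta>"
  define m where "m t = exp (- \<gamma> * (t - T))" for t
  have m_exp: "exp (\<gamma> * \<Delta>) * exp (- \<gamma> * (t - \<sigma>)) = m t" for t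
    unfolding m_def T_def mult_exp_exp by (simp add: algebra_simps)
  have m_pos: "m t > 0" for t by (simp add: m_def)
  show ?thesis
  proof (cases "c \<le> T")
    case True
    have "1 \<le> m c" using True \<gamma> by (simp add: m_def mult_nonneg_nonpos)
    have "\<bar>x c\<bar> \<le> C * D" using xC \<open>\<sigma> \<le> c\<close> True by (simp add: T_def)
    also have "\<dots> \<le> (K' + \<Lambda> * (1 + \<Delta>)) * 1"
    proof -
      have "\<Lambda> \<le> \<Lambda> * (1 + \<Delta>)" using \<Lambda> \<Delta> by (simp add: mult_le_cancel_left1)
      then show ?thesis unfolding mult_1_right using \<Lambda> \<open>K' \<ge> 0\<close> by linarith
    qed
    also have "\<dots> \<le> (K' + \<Lambda> * (1 + \<Delta>)) * m c"
      using \<open>1 \<le> m c\<close> \<open>K' \<ge> 0\<close> \<Lambda> \<Delta> by (intro mult_left_mono) auto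
    finally show ?thesis unfolding m_exp[of c, symmetric] K'_def \<Lambda>_def by (simp add: mult_ac)
  next
    case False
    define p1 where "p1 t = K' + \<Lambda> * (1 + (t - \<sigma>))" for t
    define p2 where "p2 t = (K' + \<Lambda> * (1 + \<Delta>)) * m t" for t
    define p where "p t = (if t \<le> T then p1 t else p2 t)" for t
    have "\<sigma> \<le> T" using \<Delta> by (simp add: T_def)
    have p_lip: "\<exists>M. M-lipschitz_on {\<sigma>..c} p"
    proof -
      have "(\<bar>\<Lambda>\<bar> * 1)-lipschitz_on {\<sigma>..T} (\<lambda>t. \<Lambda> * (1 + (t - \<sigma>)))"
        by (intro lipschitz_on_cmult_real lipschitz_onI) (auto simp: dist_real_def)
      from lipschitz_on_add[OF lipschitz_on_constant[of _ K'] this]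
      have 1: "(0 + \<bar>\<Lambda>\<bar> * 1)-lipschitz_on {\<sigma>..T} p1" by (simp add: p1_def)
      have "(\<bar>- \<gamma>\<bar> * 1)-lipschitz_on {T..c} (\<lambda>t. - \<gamma> * (t - T))"
        by (intro lipschitz_on_cmult_real lipschitz_onI) (auto simp: dist_real_def)
      from lipschitz_on_exp[OF this, of 0] \<gamma>
      have "\<exists>M. M-lipschitz_on {T..c} m" by (auto simp: m_def)
      then obtain M where 2: "M-lipschitz_on {T..c} p2"
        unfolding p2_def using lipschitz_on_cmult_real by blast
      have "p1 T = p2 T" by (simp add: p1_def p2_def m_def T_def)
      from lipschitz_on_concat_max[OF 1 2 this] show ?thesis unfolding p_def by blast
    qed
    then obtain Mp where Mp: "Mp-lipschitz_on {\<sigma>..c} p" ..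
    have dp1: "(p has_real_derivative \<Lambda>) (at t)" if "t < T" for t
    proof (rule has_field_derivative_transform_within_open)
      show "(p1 has_real_derivative \<Lambda>) (at t)" unfolding p1_def by (auto intro!: derivative_eq_intros)
      show "open {..<T}" "t \<in> {..<T}" "\<And>s. s \<in> {..<T} \<Longrightarrow> p1 s = p s" using that by (auto simp: p_def)
    qed
    have dp2: "(p has_real_derivative - \<gamma> * p2 t) (at t)" if "T < t" for t
    proof (rule has_field_derivative_transform_within_open)
      show "(p2 has_real_derivative - \<gamma> * p2 t) (at t)"
        unfolding p2_def m_def by (auto intro!: derivative_eq_intros)
      show "open {T<..}" "t \<in> {T<..}" "\<And>s. s \<in> {T<..} \<Longrightarrow> p2 s = p s" using that by (auto simp: p_def)
    qed
    \<comment> \<open>At a delayed argument the barrier may be as low as its starting value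
      \<open>K' + \<Lambda>\<close>, while its amplitude after \<open>T\<close> is
      \<open>K' + \<Lambda> * (1 + \<Delta>)\<close>; the condition
      \<open>\<gamma> * (1 + \<Delta>) \<le> \<beta>\<close> bridges this gap.\<close>
    have p_lower: "(K' + \<Lambda>) * m t \<le> p s" if "\<sigma> \<le> s" "s \<le> t" "T < t" for s t
    proof (cases "s \<le> T")
      case True
      have "m t \<le> 1" using that \<gamma> by (simp add: m_def)
      then have "(K' + \<Lambda>) * m t \<le> (K' + \<Lambda>) * 1" using \<open>K' \<ge> 0\<close> \<Lambda> by (intro mult_left_mono) auto
      also have "\<dots> \<le> p s" using True \<Lambda> that by (simp add: p_def p1_def mult_le_cancel_left1)
      finally show ?thesis .
    next
      case False
      have "\<Lambda> \<le> \<Lambda> * (1 + \<Delta>)" using \<Lambda> \<Delta> by (simp add: mult_le_cancel_left1)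
      moreover have "m t \<le> m s" using that \<gamma> by (simp add: m_def)
      ultimately have "(K' + \<Lambda>) * m t \<le> (K' + \<Lambda> * (1 + \<Delta>)) * m s"
        using \<open>K' \<ge> 0\<close> \<Lambda> m_pos[of t] by (intro mult_mono) auto
      then show ?thesis using False by (simp add: p_def p2_def)
    qed
    obtain Mx where Mx: "Mx-lipschitz_on {\<sigma>..c} x" using x_lipschitz by blast
    have p_nonneg: "0 \<le> p t" if "\<sigma> \<le> t" for t
      using that \<open>K' \<ge> 0\<close> \<Lambda> \<Delta> m_pos[of t] by (simp add: p_def p1_def p2_def)
    have "0 \<le> p c - s * x c" if s: "\<bar>s\<bar> = 1" for s
    \<comment> \<open>\<open>T\<close> joins the exceptional set because the two pieces of the
      barrier meet there with a kink.\<close>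
    proof (rule delay_comparison[OF \<open>\<sigma> \<le> c\<close> _ B_lipschitz[of c], of "insert T (N \<union> Z)" _ _ b1 \<eta>])
      show "negligible (insert T (N \<union> Z))" using N Z by (simp add: negligible_insert)
      show "(Mp + \<bar>s\<bar> * Mx)-lipschitz_on {\<sigma>..c} (\<lambda>t. p t - s * x t)"
        by (intro lipschitz_on_diff Mp lipschitz_on_cmult_real Mx)
      have sx: "s * y \<le> \<bar>y\<bar>" for y :: real using s by (metis abs_ge_self abs_mult mult_1)
      have "s * x \<sigma> \<le> D" using sx[of "x \<sigma>"] x_\<sigma> \<phi>[of \<sigma>] by linarith
      then show "0 \<le> p \<sigma> - s * x \<sigma>"
        using \<open>\<sigma> \<le> T\<close> \<Lambda> CD \<open>K' \<ge> 0\<close> by (simp add: p_def p1_def)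
      fix t assume t: "\<sigma> < t" "t < c"
      show "\<eta> t \<le> t" using \<eta> t by blast
      show b1: "0 \<le> b1 t" using b1_lower[OF t(1)] \<beta> by linarith
      show "B t - B (\<eta> t) \<le> 1 / exp 1" if "\<sigma> \<le> \<eta> t" using B_\<eta> t that by blast
      assume tN: "t \<notin> insert T (N \<union> Z)"
      show "\<exists>D\<ge>b1 t. (B has_real_derivative D) (at t)" using B_deriv t tN by blast
      have dx: "((\<lambda>t. s * x t) has_real_derivative s * deriv x t) (at t)"
        using t tN by (intro DERIV_cmult x_deriv) auto
      show "\<exists>D. ((\<lambda>t. p t - s * x t) has_real_derivative D) (at t) \<and>
           0 \<le> D + b1 t * (if \<sigma> \<le> \<eta> t then p (\<eta> t) - s * x (\<eta> t) else 0)"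
      proof (cases "t < T")
        case True
        have "s * deriv x t \<le> C * D" using sx[of "deriv x t"] dC[of t] t tN True by (auto simp: T_def)
        moreover have "- (bb * (C * D)) \<le> b1 t * (if \<sigma> \<le> \<eta> t then p (\<eta> t) - s * x (\<eta> t) else 0)"
        proof (cases "\<sigma> \<le> \<eta> t")
          case \<sigma>\<eta>: True
          have "s * x (\<eta> t) \<le> C * D" 
            using sx[of "x (\<eta> t)"] xC[OF \<sigma>\<eta>] \<eta>[OF t(1)] True by (auto simp: T_def)
          then have "b1 t * - (C * D) \<le> b1 t * (p (\<eta> t) - s * x (\<eta> t))"
            using p_nonneg[OF \<sigma>\<eta>] b1 by (intro mult_left_mono) auto
          moreover have "b1 t * (C * D) \<le> bb * (C * D)"
            using b1_upper[OF t(1)] tN CD by (intro mult_right_mono) auto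
          ultimately show ?thesis using \<sigma>\<eta> by simp
        qed (use \<open>0 \<le> bb * (C * D)\<close> in simp)
        ultimately have "0 \<le> \<Lambda> - s * deriv x t + b1 t * (if \<sigma> \<le> \<eta> t then p (\<eta> t) - s * x (\<eta> t) else 0)"
          using \<open>\<Lambda> = C * D + bb * (C * D)\<close> by linarith
        then show ?thesis using DERIV_diff[OF dp1[OF True] dx] by blast
      next
        case False
        then have Tt: "T < t" using tN by auto
        have \<eta>t: "\<sigma> \<le> \<eta> t" "\<eta> t \<le> t" using \<eta>[OF t(1)] h[OF t(1)] Tt by (auto simp: T_def)
        have "s * (deriv x t + b1 t * x (\<eta> t)) \<le> b1 t * K * exp (- \<gamma> * (t - \<sigma>))"
          using sx[of "deriv x t + b1 t * x (\<eta> t)"] K[of t] t tN Tt by (auto simp: T_def)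
        also have "\<dots> \<le> b1 t * K * m t"
        proof -
          have "exp (- \<gamma> * (t - \<sigma>)) \<le> m t" using \<gamma> \<Delta> by (simp add: m_def T_def)
          then show ?thesis using b1 \<open>K \<ge> 0\<close> by (intro mult_left_mono) auto
        qed
        finally have 1: "s * deriv x t + b1 t * (s * x (\<eta> t)) \<le> b1 t * K * m t" by (simp add: algebra_simps)
        have 2: "b1 t * ((K' + \<Lambda>) * m t) \<le> b1 t * p (\<eta> t)"
          using p_lower[OF \<eta>t Tt] b1 by (rule mult_left_mono)
        \<comment> \<open>The delayed barrier term covers both the decay of the amplitude and the
          remainder \<open>b1 t * K\<close>; the \<open>\<Lambda>\<close> part and the
          \<open>K'\<close> part balance separately.\<close>
        have "0 \<le> (b1 t * (K' + \<Lambda>) - \<gamma> * (K' + \<Lambda> * (1 + \<Delta>)) - b1 t * K) * m t"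
        proof (rule mult_nonneg_nonneg)
          have "\<gamma> * (1 + \<Delta>) * \<Lambda> \<le> b1 t * \<Lambda>"
            using \<gamma>(2) b1_lower[OF t(1)] \<Lambda> by (intro mult_right_mono) auto
          moreover have "\<gamma> * K' + b1 t * K \<le> b1 t * K'"
          proof -
            have "K = K' * (1 - \<gamma> / \<beta>)" unfolding K'_def using \<gamma>\<beta> by (metis less_irrefl nonzero_divide_eq_eq)
            then have "b1 t * K = b1 t * (K' * (1 - \<gamma> / \<beta>))" by (rule arg_cong)
            also have "\<dots> = b1 t * K' - \<gamma> * K' * (b1 t / \<beta>)" by (simp add: algebra_simps)
            finally have "b1 t * K = b1 t * K' - \<gamma> * K' * (b1 t / \<beta>)" .
            moreover have "\<gamma> * K' * 1 \<le> \<gamma> * K' * (b1 t / \<beta>)"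
              using \<gamma> \<open>K' \<ge> 0\<close> b1_lower[OF t(1)] \<beta> by (intro mult_left_mono) auto
            ultimately show ?thesis by linarith
          qed
          ultimately show "0 \<le> b1 t * (K' + \<Lambda>) - \<gamma> * (K' + \<Lambda> * (1 + \<Delta>)) - b1 t * K"
            by (simp add: algebra_simps)
        qed (use m_pos[of t] in simp)
        then have "0 \<le> b1 t * ((K' + \<Lambda>) * m t) - \<gamma> * p2 t - b1 t * K * m t"
          by (simp add: p2_def algebra_simps)
        then have "0 \<le> - \<gamma> * p2 t - s * deriv x t + b1 t * (p (\<eta> t) - s * x (\<eta> t))"
          using 1 2 by (simp add: right_diff_distrib)
        then show ?thesis using DERIV_diff[OF dp2[OF Tt] dx] \<eta>t by (intro exI conjI) auto
      qed
    qed
    from this[of 1] this[of "-1"] have "\<bar>x c\<bar> \<le> p c" by (simp add: abs_le_iff)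
    also have "\<dots> = (K' + \<Lambda> * (1 + \<Delta>)) * m c" using False by (simp add: p_def p2_def)
    finally show ?thesis unfolding m_exp[of c, symmetric] K'_def \<Lambda>_def by (simp add: mult_ac)
  qed
qed

text \<open>\<open>X\<close> is the largest value of |x|/E on the compact interval, attained at
  \<open>t1\<close>. The barrier on \<open>{\<sigma>..t1}\<close> bounds \<open>X\<close> by an
  affine function of itself with slope \<open>\<theta> < 1\<close>; as \<open>X\<close> is finite,
  the inequality can be solved for it, with a bound that is the same for every
  \<open>c\<close>.\<close>

lemma exponential_decay:
  assumes \<gamma>: "0 < \<gamma>" "\<gamma> * (1 + \<Delta>) \<le> \<beta>" and "\<sigma> \<le> c"
    and \<rho>: "\<rho> = exp (\<gamma> * \<Delta>)" "\<rho> * S < 1"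
    and \<kappa>0: "\<kappa>0 = (\<Sum>k=1..l. \<kappa> k) + \<kappa>3" "\<kappa>0 \<ge> 0" "\<kappa>2 \<ge> 0"
    and \<theta>: "\<theta> = \<rho> * (\<rho> * (\<kappa>0 * (\<rho> * bb / (1 - \<rho> * S)) + \<kappa>2)) / (1 - \<gamma> / \<beta>)" "\<theta> < 1"
    and C: "C = growth_constant bb S * exp (2 * bb / (1 - S) * \<Delta>)"
  shows "\<bar>x c\<bar> \<le> (\<rho> * (\<rho> * (\<kappa>0 * (\<rho> * (bb + S) / (1 - \<rho> * S)))) / (1 - \<gamma> / \<beta>)
    + \<rho> * (1 + bb) * C * (1 + \<Delta>)) / (1 - \<theta>) * D * exp (- \<gamma> * (c - \<sigma>))"
proof -
  define E where "E t = exp (- \<gamma> * (t - \<sigma>))" for t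
  have E_pos: "E t > 0" for t by (simp add: E_def)
  have "\<rho> \<ge> 1" using \<gamma> \<Delta> by (simp add: \<rho>)
  have "\<gamma> < \<beta>"
  proof -
    have "\<gamma> * 1 < \<gamma> * (1 + \<Delta>)" using \<gamma>(1) \<Delta> by (intro mult_strict_left_mono) auto
    then show ?thesis using \<gamma>(2) by linarith
  qed
  then have \<gamma>\<beta>: "0 < 1 - \<gamma> / \<beta>" using \<beta> by simp
  have G: "growth_constant bb S \<ge> 1"
    using bb S S_nonneg unfolding growth_constant_def by (smt (verit) divide_nonneg_nonneg mult_nonneg_nonneg)
  have lam: "2 * bb / (1 - S) \<ge> 0" using bb S by simp
  have "1 * 1 \<le> C" unfolding C using G mult_nonneg_nonneg[OF lam less_imp_le[OF \<Delta>]]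
    by (intro mult_mono) auto
  then have C1: "C \<ge> 1" by simp
  \<comment> \<open>\<open>C\<close> arises by freezing the growing weight at its value at the end
    of the initial interval.\<close>
  have Cgrow: "growth_constant bb S * D * exp (2 * bb / (1 - S) * (t - \<sigma>)) \<le> C * D" if "t \<le> \<sigma> + \<Delta>" for t
  proof -
    have "exp (2 * bb / (1 - S) * (t - \<sigma>)) \<le> exp (2 * bb / (1 - S) * \<Delta>)"
      using lam that by (simp only: exp_le_cancel_iff) (intro mult_left_mono, auto)
    then have "growth_constant bb S * D * exp (2 * bb / (1 - S) * (t - \<sigma>))
        \<le> growth_constant bb S * D * exp (2 * bb / (1 - S) * \<Delta>)"
      using G D_nonneg by (intro mult_left_mono) auto
    then show ?thesis by (simp add: C mult_ac)
  qed
  have xC: "\<bar>x t\<bar> \<le> C * D" if t: "\<sigma> \<le> t" "t \<le> \<sigma> + \<Delta>" for t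
  proof (cases "t = \<sigma>")
    case True
    have "D \<le> C * D" using C1 D_nonneg by (simp add: mult_le_cancel_right1)
    then show ?thesis using True \<phi>[of \<sigma>] x_\<sigma> by simp
  next
    case False
    then show ?thesis using initial_growth(1)[of t] Cgrow[OF t(2)] t by linarith
  qed
  define Z0 where "Z0 = {t \<in> {\<sigma><..<\<sigma> + \<Delta>}. \<not> \<bar>deriv x t\<bar> \<le> growth_constant bb S * D * exp (2 * bb / (1 - S) * (t - \<sigma>))}"
  have Z0: "negligible Z0" unfolding Z0_def using \<Delta> by (intro initial_growth(2)) auto
  have dC: "\<bar>deriv x t\<bar> \<le> C * D" if "\<sigma> < t" "t < \<sigma> + \<Delta>" "t \<notin> Z0" for t
    using that Cgrow[of t] unfolding Z0_def by fastforce
  have "continuous_on {\<sigma>..c} (\<lambda>t. \<bar>x t\<bar> / E t)"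
    unfolding E_def by (intro continuous_intros x_continuous) auto
  then obtain t1 where t1: "t1 \<in> {\<sigma>..c}" "\<And>t. t \<in> {\<sigma>..c} \<Longrightarrow> \<bar>x t\<bar> / E t \<le> \<bar>x t1\<bar> / E t1"
    using continuous_attains_sup[of "{\<sigma>..c}" "\<lambda>t. \<bar>x t\<bar> / E t"] \<open>\<sigma> \<le> c\<close>
    by (metis atLeastatMost_empty_iff compact_Icc)
  define X where "X = \<bar>x t1\<bar> / E t1"
  have "X \<ge> 0" by (simp add: X_def E_def)
  have X: "\<bar>x t\<bar> \<le> X * E t" if "\<sigma> \<le> t" "t \<le> c" for t
    using t1(2)[of t] that E_pos[of t] by (simp add: X_def field_simps)
  define \<nu> where "\<nu> = \<rho> * (bb * (X + D) + S * D) / (1 - \<rho> * S)"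
  have "\<nu> \<ge> 0"
    using \<rho>(2) \<open>\<rho> \<ge> 1\<close> bb \<open>X \<ge> 0\<close> D_nonneg S_nonneg by (simp add: \<nu>_def)
  have E_shift: "E s \<le> \<rho> * E t" if "t - s \<le> \<Delta>" for s t
  proof -
    have "\<gamma> * (t - s) \<le> \<gamma> * \<Delta>" using that \<gamma> by (intro mult_left_mono) auto
    then show ?thesis unfolding E_def \<rho> mult_exp_exp by (simp add: algebra_simps)
  qed
  define Z where "Z = {t \<in> {\<sigma><..<c}. \<not> \<bar>deriv x t\<bar> \<le> \<nu> * E t}"
  have Z: "negligible Z" unfolding Z_def \<nu>_def
  proof (rule deriv_weight_bound[where m = "E c"])
    show "E c \<le> E t" if "\<sigma> \<le> t" "t \<le> c" for t using that \<gamma> by (simp add: E_def)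
    show "1 \<le> \<rho> * E t" if "t - \<sigma> \<le> \<Delta>" for t using E_shift[OF that] by (simp add: E_def)
  qed (use E_pos E_shift \<open>\<rho> \<ge> 1\<close> \<rho>(2) X \<open>X \<ge> 0\<close> in auto)
  obtain Z' where Z': "negligible Z'"
    "\<And>t. \<sigma> + \<Delta> < t \<Longrightarrow> t < c \<Longrightarrow> t \<notin> Z' \<Longrightarrow>
      \<bar>deriv x t + b1 t * x (\<eta> t)\<bar> \<le> b1 t * (\<rho> * (((\<Sum>k=1..l. \<kappa> k) + \<kappa>3) * \<nu> + \<kappa>2 * X)) * E t"
  proof (rule remainder_bound[of c E \<rho> X Z \<nu>])
    show "0 \<le> E t" for t using E_pos[of t] by simp
    show "\<bar>deriv x t\<bar> \<le> \<nu> * E t" if "\<sigma> < t" "t < c" "t \<notin> Z" for t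
      using that by (simp add: Z_def)
  qed (use E_shift \<open>\<rho> \<ge> 1\<close> X \<open>X \<ge> 0\<close> Z \<open>\<nu> \<ge> 0\<close> in auto)
  define K where "K = \<rho> * (\<kappa>0 * \<nu> + \<kappa>2 * X)"
  have "K \<ge> 0" using \<open>\<rho> \<ge> 1\<close> \<kappa>0 \<open>\<nu> \<ge> 0\<close> \<open>X \<ge> 0\<close> by (simp add: K_def)
  have "\<bar>x t1\<bar> \<le> exp (\<gamma> * \<Delta>) * (K / (1 - \<gamma> / \<beta>) + (1 + bb) * C * D * (1 + \<Delta>)) * exp (- \<gamma> * (t1 - \<sigma>))"
  proof (rule barrier_bound[OF \<gamma> _ C1 \<open>K \<ge> 0\<close> xC negligible_Un[OF Z0 Z'(1)]])
    fix t assume t: "\<sigma> + \<Delta> < t" "t < t1" "t \<notin> Z0 \<union> Z'"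
    then show "\<bar>deriv x t + b1 t * x (\<eta> t)\<bar> \<le> b1 t * K * exp (- \<gamma> * (t - \<sigma>))"
      using Z'(2)[of t] t1 by (simp add: K_def \<kappa>0 E_def)
  qed (use t1 dC in auto)
  then have "X \<le> \<rho> * (K / (1 - \<gamma> / \<beta>) + (1 + bb) * C * D * (1 + \<Delta>))"
    unfolding X_def pos_divide_le_eq[OF E_pos] by (simp only: E_def \<rho>)
  also have "\<dots> = \<theta> * X + (\<rho> * (\<rho> * (\<kappa>0 * (\<rho> * (bb + S) / (1 - \<rho> * S)))) / (1 - \<gamma> / \<beta>)
    + \<rho> * (1 + bb) * C * (1 + \<Delta>)) * D"
  proof -
    \<comment> \<open>\<open>\<nu>\<close> is affine in \<open>X\<close> and \<open>D\<close>; with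
      the quotients named, the remaining identity is polynomial.\<close>
    have \<nu>: "\<nu> = \<rho> * bb / (1 - \<rho> * S) * X + \<rho> * (bb + S) / (1 - \<rho> * S) * D"
      unfolding \<nu>_def by (simp add: add_divide_distrib[symmetric] algebra_simps)
    define d1 d2 where "d1 = \<rho> * bb / (1 - \<rho> * S)" and "d2 = \<rho> * (bb + S) / (1 - \<rho> * S)"
    define d3 where "d3 = 1 / (1 - \<gamma> / \<beta>)"
    have d3: "y / (1 - \<gamma> / \<beta>) = y * d3" for y by (simp add: d3_def)
    show ?thesis
      unfolding \<theta>(1) K_def \<nu> d1_def[symmetric] d2_def[symmetric] d3 by (simp add: algebra_simps)
  qed
  finally have "X * (1 - \<theta>) \<le> (\<rho> * (\<rho> * (\<kappa>0 * (\<rho> * (bb + S) / (1 - \<rho> * S)))) / (1 - \<gamma> / \<beta>)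
    + \<rho> * (1 + bb) * C * (1 + \<Delta>)) * D" by (simp only: right_diff_distrib mult_1_right) (simp add: mult.commute)
  then have "X \<le> (\<rho> * (\<rho> * (\<kappa>0 * (\<rho> * (bb + S) / (1 - \<rho> * S)))) / (1 - \<gamma> / \<beta>)
    + \<rho> * (1 + bb) * C * (1 + \<Delta>)) / (1 - \<theta>) * D"
    using \<theta>(2) by (simp add: pos_le_divide_eq)
  then have "X * E c \<le> (\<rho> * (\<rho> * (\<kappa>0 * (\<rho> * (bb + S) / (1 - \<rho> * S)))) / (1 - \<gamma> / \<beta>)
    + \<rho> * (1 + bb) * C * (1 + \<Delta>)) / (1 - \<theta>) * D * E c"
    using E_pos[of c] by (intro mult_right_mono) auto
  then show ?thesis using X[of c] \<open>\<sigma> \<le> c\<close> unfolding E_def by linarith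
qed

end

text \<open>At \<open>\<gamma> = 0\<close> the three expressions equal 0, \<open>S\<close> and
  \<open>\<kappa>0 * (bb / (1 - S)) + \<kappa>2\<close>, each strictly below its bound; by
  continuity the inequalities persist for small positive \<open>\<gamma>\<close>.\<close>

lemma small_decay_rate:
  fixes bb S \<beta> \<Delta> \<kappa>0 \<kappa>2 :: real
  assumes "S < 1" "\<beta> > 0" "\<kappa>0 * (bb / (1 - S)) + \<kappa>2 < 1"
  obtains \<gamma> where "0 < \<gamma>" "\<gamma> * (1 + \<Delta>) \<le> \<beta>" "exp (\<gamma> * \<Delta>) * S < 1"
    "exp (\<gamma> * \<Delta>) * (exp (\<gamma> * \<Delta>) * (\<kappa>0 * (exp (\<gamma> * \<Delta>) * bb / (1 - exp (\<gamma> * \<Delta>) * S)) + \<kappa>2)) / (1 - \<gamma> / \<beta>) < 1"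
proof -
  have 1: "((\<lambda>\<gamma>. \<gamma> * (1 + \<Delta>)) \<longlongrightarrow> 0 * (1 + \<Delta>)) (at_right 0)" by (intro tendsto_intros)
  have 2: "((\<lambda>\<gamma>. exp (\<gamma> * \<Delta>) * S) \<longlongrightarrow> exp (0 * \<Delta>) * S) (at_right 0)" by (intro tendsto_intros)
  have 3: "((\<lambda>\<gamma>. exp (\<gamma> * \<Delta>) * (exp (\<gamma> * \<Delta>) * (\<kappa>0 * (exp (\<gamma> * \<Delta>) * bb / (1 - exp (\<gamma> * \<Delta>) * S)) + \<kappa>2)) / (1 - \<gamma> / \<beta>))
    \<longlongrightarrow> exp (0 * \<Delta>) * (exp (0 * \<Delta>) * (\<kappa>0 * (exp (0 * \<Delta>) * bb / (1 - exp (0 * \<Delta>) * S)) + \<kappa>2)) / (1 - 0 / \<beta>)) (at_right 0)"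
    using assms by (intro tendsto_intros) auto
  have "\<forall>\<^sub>F \<gamma> in at_right 0. 0 < \<gamma> \<and> \<gamma> * (1 + \<Delta>) < \<beta> \<and> exp (\<gamma> * \<Delta>) * S < 1 \<and>
     exp (\<gamma> * \<Delta>) * (exp (\<gamma> * \<Delta>) * (\<kappa>0 * (exp (\<gamma> * \<Delta>) * bb / (1 - exp (\<gamma> * \<Delta>) * S)) + \<kappa>2)) / (1 - \<gamma> / \<beta>) < 1"
    using assms by (intro eventually_conj eventually_at_right_less
      order_tendstoD(2)[OF 1] order_tendstoD(2)[OF 2] order_tendstoD(2)[OF 3]) auto
  then obtain \<gamma> where "0 < \<gamma> \<and> \<gamma> * (1 + \<Delta>) < \<beta> \<and> exp (\<gamma> * \<Delta>) * S < 1 \<and>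
     exp (\<gamma> * \<Delta>) * (exp (\<gamma> * \<Delta>) * (\<kappa>0 * (exp (\<gamma> * \<Delta>) * bb / (1 - exp (\<gamma> * \<Delta>) * S)) + \<kappa>2)) / (1 - \<gamma> / \<beta>) < 1"
    using eventually_happens'[OF trivial_limit_at_right_real] by blast
  then show ?thesis by (intro that) auto
qed

section \<open>Exponential stability\<close>

lemma AE_lebesgue_on_iff_negligible:
  assumes "A \<in> sets lebesgue"
  shows "(AE t in lebesgue_on A. P t) \<longleftrightarrow> negligible {t \<in> A. \<not> P t}"
proof -
  have "(AE t in lebesgue_on A. P t) \<longleftrightarrow> (AE t in lebesgue. t \<in> A \<longrightarrow> P t)"
    using assms by (intro AE_restrict_space_iff) simp
  also have "\<dots> \<longleftrightarrow> negligible {t \<in> A. \<not> P t}"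
  proof
    assume "AE t in lebesgue. t \<in> A \<longrightarrow> P t"
    then obtain Z where "Z \<in> null_sets lebesgue" "{t. \<not> (t \<in> A \<longrightarrow> P t)} \<subseteq> Z"
      unfolding eventually_ae_filter by auto
    then show "negligible {t \<in> A. \<not> P t}"
      unfolding negligible_iff_null_sets[symmetric] by (elim negligible_subset) blast
  next
    assume "negligible {t \<in> A. \<not> P t}"
    then show "AE t in lebesgue. t \<in> A \<longrightarrow> P t"
      by (intro AE_I'[of "{t \<in> A. \<not> P t}"]) (auto simp: negligible_iff_null_sets)
  qed
  finally show ?thesis .
qed

lemma not_negligible_atLeast: "\<not> negligible {t0::real..}"
proof
  assume "negligible {t0..}"
  then have "negligible {t0..t0 + 1}" by (rule negligible_subset) auto
  then show False by (simp add: negligible_iff_measure)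
qed

text \<open>The real-valued norm agrees with the extended essential supremum once the latter is
  finite: \<open>C\<close> bounds it from above, and some point of the non-null ray has its modulus
  below it, which excludes \<open>- \<infinity>\<close>.\<close>

lemma ess_norm_bound:
  assumes "f \<in> borel_measurable (lebesgue_on {t0..})" and "negligible {t \<in> {t0..}. \<not> \<bar>f t\<bar> \<le> C}"
  shows "negligible {t \<in> {t0..}. \<not> \<bar>f t\<bar> \<le> ess_norm t0 f}"
proof -
  let ?M = "lebesgue_on {t0..}"
  define e where "e = esssup ?M (\<lambda>t. ereal \<bar>f t\<bar>)"
  have meas: "(\<lambda>t. ereal \<bar>f t\<bar>) \<in> borel_measurable ?M" using assms(1) by simp
  have "AE t in ?M. ereal \<bar>f t\<bar> \<le> ereal C"
    using assms(2) by (simp add: AE_lebesgue_on_iff_negligible)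
  then have "e \<le> ereal C" unfolding e_def by (rule esssup_I[OF meas])
  have AE: "AE t in ?M. ereal \<bar>f t\<bar> \<le> e" unfolding e_def by (rule esssup_AE)
  then have neg: "negligible {t \<in> {t0..}. \<not> ereal \<bar>f t\<bar> \<le> e}"
    by (simp add: AE_lebesgue_on_iff_negligible)
  then obtain t where "t \<ge> t0" "ereal \<bar>f t\<bar> \<le> e"
    using not_negligible_atLeast[of t0] negligible_subset by (smt (verit) atLeast_iff mem_Collect_eq subsetI)
  then have "e \<noteq> - \<infinity>" by auto
  with \<open>e \<le> ereal C\<close> have "e = ereal (ess_norm t0 f)"
    unfolding ess_norm_def e_def[symmetric] by (cases e) auto
  with neg show ?thesis by simp
qed

text \<open>Serves with \<open>c = 0\<close> for nonnegativity of norms and with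
  \<open>c = \<beta>\<close> for positivity of the norm of \<open>b\<close>.\<close>

lemma ess_norm_ge:
  assumes "f \<in> borel_measurable (lebesgue_on {t0..})" and "negligible {t \<in> {t0..}. \<not> \<bar>f t\<bar> \<le> C}"
    and "\<And>t. t \<ge> t0 \<Longrightarrow> c \<le> \<bar>f t\<bar>"
  shows "c \<le> ess_norm t0 f"
proof (rule ccontr)
  assume "\<not> c \<le> ess_norm t0 f"
  then have "{t0..} \<subseteq> {t \<in> {t0..}. \<not> \<bar>f t\<bar> \<le> ess_norm t0 f}" using assms(3) by fastforce
  then show False using ess_norm_bound[OF assms(1,2)] not_negligible_atLeast negligible_subset by blast
qed

text \<open>On each bounded interval the essential bound of the derivative yields a Lipschitz bound
  through the increment estimate for absolutely continuous functions. Intervals of integer length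
  exhaust the half-line, so one null set collects all exceptional points.\<close>

lemma neutral_solution_regularity:
  assumes sol: "neutral_solution l a g b h \<sigma> \<phi> \<psi> x"
  obtains N where "negligible N" "\<And>c. \<exists>L. L-lipschitz_on {\<sigma>..c} x"
    "\<And>t. \<sigma> < t \<Longrightarrow> t \<notin> N \<Longrightarrow> (x has_real_derivative deriv x t) (at t)"
    "\<And>c. \<exists>C. \<forall>t. \<sigma> < t \<longrightarrow> t < c \<longrightarrow> t \<notin> N \<longrightarrow> \<bar>deriv x t\<bar> \<le> C"
    "\<And>t. \<sigma> < t \<Longrightarrow> t \<notin> N \<Longrightarrow>
        deriv x t - (\<Sum>k=1..l. a k t * (if g k t < \<sigma> then \<psi> (g k t) else deriv x (g k t)))
          = - b t * (if h t \<le> \<sigma> then \<phi> (h t) else x (h t))"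
proof -
  have ac: "absolutely_continuous_on_Icc \<sigma> c x" if "c > \<sigma>" for c
    using sol that by (auto simp: neutral_solution_def)
  have "\<forall>n. \<exists>C. negligible {t \<in> {\<sigma>..\<sigma> + real (Suc n)}. \<not> \<bar>deriv x t\<bar> \<le> C}"
    using sol unfolding neutral_solution_def ess_bounded_on_def
    by (auto simp: AE_lebesgue_on_iff_negligible simp del: of_nat_Suc)
  then obtain C where C: "\<And>n. negligible {t \<in> {\<sigma>..\<sigma> + real (Suc n)}. \<not> \<bar>deriv x t\<bar> \<le> C n}" by metis
  define Z1 where "Z1 n = {t \<in> {\<sigma><..<\<sigma> + real (Suc n)}. \<not> (\<exists>D. (x has_real_derivative D) (at t))}" for n
  define Z2 where "Z2 n = {t \<in> {\<sigma>..\<sigma> + real (Suc n)}. \<not> \<bar>deriv x t\<bar> \<le> C n}" for n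
  define Z3 where "Z3 = {t \<in> {\<sigma>..}. deriv x t - (\<Sum>k=1..l. a k t * (if g k t < \<sigma> then \<psi> (g k t) else deriv x (g k t)))
          \<noteq> - b t * (if h t \<le> \<sigma> then \<phi> (h t) else x (h t))}"
  define N where "N = (\<Union>n. Z1 n) \<union> (\<Union>n. Z2 n) \<union> Z3"
  have "negligible Z3"
    using sol unfolding neutral_solution_def Z3_def by (simp add: AE_lebesgue_on_iff_negligible)
  moreover have "negligible (Z1 n)" for n
    unfolding Z1_def by (rule absolutely_continuous_differentiable_AE[OF ac]) simp
  moreover have "negligible (Z2 n)" for n unfolding Z2_def by (rule C)
  ultimately have N: "negligible N" unfolding N_def by (intro negligible_Un negligible_Union_nat)
  have ex: "\<exists>n. c < \<sigma> + real (Suc n)" for c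
  proof -
    obtain n where "c - \<sigma> < real n" using reals_Archimedean2 by blast
    then show ?thesis by (intro exI[of _ n]) simp
  qed
  have D: "(x has_real_derivative deriv x t) (at t)" if t: "\<sigma> < t" "t \<notin> N" for t
  proof -
    obtain n where "t < \<sigma> + real (Suc n)" using ex by blast
    then obtain D where "(x has_real_derivative D) (at t)"
      using t unfolding N_def Z1_def by (auto simp del: of_nat_Suc)
    then show ?thesis by (simp add: DERIV_imp_deriv)
  qed
  have dC: "\<bar>deriv x t\<bar> \<le> C n" if "\<sigma> < t" "t < \<sigma> + real (Suc n)" "t \<notin> N" for t n
    using that unfolding N_def Z2_def by (auto simp del: of_nat_Suc)
  show ?thesis
  proof (rule that[OF N _ D])
    fix c
    obtain n where n: "c < \<sigma> + real (Suc n)" using ex by blast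
    then show "\<exists>C. \<forall>t. \<sigma> < t \<longrightarrow> t < c \<longrightarrow> t \<notin> N \<longrightarrow> \<bar>deriv x t\<bar> \<le> C" 
      using dC[of _ n] by (intro exI[of _ "C n"]) auto
    have *: "\<bar>x v - x u\<bar> \<le> \<bar>C n\<bar> * (v - u)" if "\<sigma> \<le> u" "u \<le> v" "v \<le> c" for u v
    proof (rule absolutely_continuous_increment_bound[OF _ that(2) N])
      have "absolutely_continuous_on_Icc \<sigma> (\<sigma> + real (Suc n)) x" by (rule ac) simp
      then show "absolutely_continuous_on_Icc u v x"
        by (rule absolutely_continuous_on_subinterval) (use that n in auto)
      show "\<exists>D. (x has_real_derivative D) (at t) \<and> \<bar>D\<bar> \<le> \<bar>C n\<bar>" if t: "u < t" "t < v" "t \<notin> N" for t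
        using D[of t] dC[of t n] t \<open>\<sigma> \<le> u\<close> \<open>v \<le> c\<close> n by (intro exI[of _ "deriv x t"]) auto
    qed
    have "\<bar>C n\<bar>-lipschitz_on {\<sigma>..c} x"
    proof (rule lipschitz_onI)
      fix u v assume "u \<in> {\<sigma>..c}" "v \<in> {\<sigma>..c}"
      then show "dist (x u) (x v) \<le> \<bar>C n\<bar> * dist u v"
        using *[of u v] *[of v u] by (cases "u \<le> v") (auto simp: dist_real_def abs_minus_commute)
    qed simp
    then show "\<exists>L. L-lipschitz_on {\<sigma>..c} x" ..
  qed (auto simp: N_def Z3_def)
qed

section \<open>Initial data and reduction to a comparison equation\<close>

lemma initial_data_bound:
  assumes "initial_data \<sigma> \<phi> \<psi>"
  defines "D \<equiv> SUP s\<in>{..\<sigma>}. \<bar>\<phi> s\<bar> + (if s < \<sigma> then \<bar>\<psi> s\<bar> else 0)"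
  shows "s \<le> \<sigma> \<Longrightarrow> \<bar>\<phi> s\<bar> \<le> D" and "s < \<sigma> \<Longrightarrow> \<bar>\<psi> s\<bar> \<le> D"
proof -
  obtain p where p: "\<And>s. s \<le> \<sigma> \<Longrightarrow> \<bar>\<phi> s\<bar> \<le> p"
    using assms(1) unfolding initial_data_def bounded_iff by auto
  obtain q where q: "\<And>s. s < \<sigma> \<Longrightarrow> \<bar>\<psi> s\<bar> \<le> q"
    using assms(1) unfolding initial_data_def bounded_iff by auto
  \<comment> \<open>A real \<open>SUP\<close> is sure to dominate its members only for a family
    bounded above, which bounded data ensure.\<close>
  have bdd: "bdd_above ((\<lambda>s. \<bar>\<phi> s\<bar> + (if s < \<sigma> then \<bar>\<psi> s\<bar> else 0)) ` {..\<sigma>})"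
    using p q by (intro bdd_aboveI2[of _ _ "p + \<bar>q\<bar>"]) (fastforce intro: add_mono order_trans[OF _ abs_ge_self])
  have *: "\<bar>\<phi> s\<bar> + (if s < \<sigma> then \<bar>\<psi> s\<bar> else 0) \<le> D" if "s \<le> \<sigma>" for s
    unfolding D_def using that by (intro cSUP_upper bdd) auto
  show "\<bar>\<phi> s\<bar> \<le> D" if "s \<le> \<sigma>" using *[OF that] by (smt (verit))
  show "\<bar>\<psi> s\<bar> \<le> D" if "s < \<sigma>" using *[of s] that by auto
qed

text \<open>Common core of the three conditions, each of which supplies \<open>b1\<close>,
  \<open>\<eta>\<close> and the defects \<open>\<kappa>\<close>, \<open>\<kappa>2\<close>,
  \<open>\<kappa>3\<close>. The coefficient is truncated at \<open>bb\<close> because the essential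
  bound holds only almost everywhere, while the Lipschitz primitive is built from a pointwise
  bound.\<close>

lemma stability_by_comparison:
  fixes t0 \<tau> \<beta> bb S \<kappa>2 \<kappa>3 :: real and l :: nat
    and a g :: "nat \<Rightarrow> real \<Rightarrow> real" and b h b1 \<eta> :: "real \<Rightarrow> real"
    and \<delta> \<alpha> \<kappa> :: "nat \<Rightarrow> real"
  assumes "t0 \<ge> 0" "\<tau> > 0" "\<beta> > 0" "bb > 0"
    and g: "\<And>k t. k \<in> {1..l} \<Longrightarrow> t \<ge> 0 \<Longrightarrow> 0 \<le> t - g k t \<and> t - g k t \<le> \<delta> k"
    and g_null: "\<And>k E. k \<in> {1..l} \<Longrightarrow> negligible E \<Longrightarrow> negligible {t \<in> {0..}. g k t \<in> E}"
    and h: "\<And>t. t \<ge> 0 \<Longrightarrow> 0 \<le> t - h t \<and> t - h t \<le> \<tau>"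
    and \<alpha>: "\<And>k. k \<in> {1..l} \<Longrightarrow> 0 \<le> \<alpha> k" "\<And>k. k \<in> {1..l} \<Longrightarrow> negligible {t \<in> {t0..}. \<not> \<bar>a k t\<bar> \<le> \<alpha> k}"
    and S: "S = (\<Sum>k=1..l. \<alpha> k)" "S < 1"
    and b: "negligible {t \<in> {t0..}. \<not> \<bar>b t\<bar> \<le> bb}"
    and b1: "b1 \<in> borel_measurable (lebesgue_on {t0..})" "\<And>t. t \<ge> t0 \<Longrightarrow> \<beta> \<le> b1 t \<and> b1 t \<le> b t"
    and \<eta>: "\<And>t. t \<ge> 0 \<Longrightarrow> h t \<le> \<eta> t \<and> \<eta> t \<le> t"
    and int: "\<And>t. t \<ge> t0 \<Longrightarrow> t0 \<le> \<eta> t \<Longrightarrow>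
      integral {\<eta> t..t} (\<lambda>s. if s \<in> {t0..} then min (b1 s) bb else 0) \<le> 1 / exp 1"
    and \<kappa>: "\<And>k. k \<in> {1..l} \<Longrightarrow> 0 \<le> \<kappa> k" "\<And>k. k \<in> {1..l} \<Longrightarrow> negligible {t \<in> {t0..}. \<not> \<bar>a k t\<bar> \<le> \<kappa> k * b1 t}"
    and \<kappa>2: "0 \<le> \<kappa>2" "negligible {t \<in> {t0..}. \<not> \<bar>b t - b1 t\<bar> \<le> \<kappa>2 * b1 t}"
    and \<kappa>3: "0 \<le> \<kappa>3" "negligible {t \<in> {t0..}. \<not> \<bar>b t\<bar> * (\<eta> t - h t) \<le> \<kappa>3 * b1 t}"
    and small: "((\<Sum>k=1..l. \<kappa> k) + \<kappa>3) * (bb / (1 - S)) + \<kappa>2 < 1"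
  shows "exponentially_stable t0 l a g b h"
proof -
  \<comment> \<open>One delay bound for all arguments; absolute values let the sum dominate each
    \<open>\<delta> k\<close>.\<close>
  define \<Delta> where "\<Delta> = \<tau> + (\<Sum>k=1..l. \<bar>\<delta> k\<bar>)"
  have "0 \<le> (\<Sum>k=1..l. \<bar>\<delta> k\<bar>)" by (intro sum_nonneg) auto
  then have \<Delta>: "\<Delta> > 0" "\<tau> \<le> \<Delta>" using \<open>\<tau> > 0\<close> unfolding \<Delta>_def by linarith+
  have \<delta>: "\<delta> k \<le> \<Delta>" if "k \<in> {1..l}" for k
  proof -
    have "\<bar>\<delta> k\<bar> \<le> (\<Sum>k=1..l. \<bar>\<delta> k\<bar>)" using that by (intro member_le_sum) auto
    then show ?thesis using \<open>\<tau> > 0\<close> unfolding \<Delta>_def by linarith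
  qed
  \<comment> \<open>The lower bound that survives the truncation at \<open>bb\<close>.\<close>
  define \<beta>' where "\<beta>' = min \<beta> bb"
  have \<beta>': "\<beta>' > 0" using \<open>\<beta> > 0\<close> \<open>bb > 0\<close> by (simp add: \<beta>'_def)
  define \<kappa>0 where "\<kappa>0 = (\<Sum>k=1..l. \<kappa> k) + \<kappa>3"
  have \<kappa>0: "\<kappa>0 \<ge> 0" unfolding \<kappa>0_def using \<kappa>(1) \<kappa>3(1) by (intro add_nonneg_nonneg sum_nonneg) auto
  obtain \<gamma> where \<gamma>: "0 < \<gamma>" "\<gamma> * (1 + \<Delta>) \<le> \<beta>'" "exp (\<gamma> * \<Delta>) * S < 1"
    "exp (\<gamma> * \<Delta>) * (exp (\<gamma> * \<Delta>) * (\<kappa>0 * (exp (\<gamma> * \<Delta>) * bb / (1 - exp (\<gamma> * \<Delta>) * S)) + \<kappa>2)) / (1 - \<gamma> / \<beta>') < 1"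
    using small_decay_rate[OF S(2) \<beta>' small[folded \<kappa>0_def], of \<Delta>] by blast
  define \<rho> where "\<rho> = exp (\<gamma> * \<Delta>)"
  define \<theta> where "\<theta> = \<rho> * (\<rho> * (\<kappa>0 * (\<rho> * bb / (1 - \<rho> * S)) + \<kappa>2)) / (1 - \<gamma> / \<beta>')"
  define C where "C = growth_constant bb S * exp (2 * bb / (1 - S) * \<Delta>)"
  define M where "M = (\<rho> * (\<rho> * (\<kappa>0 * (\<rho> * (bb + S) / (1 - \<rho> * S)))) / (1 - \<gamma> / \<beta>')
    + \<rho> * (1 + bb) * C * (1 + \<Delta>)) / (1 - \<theta>)"
  define b2 where "b2 = (\<lambda>s. if s \<in> {t0..} then min (b1 s) bb else 0)"
  have b2: "b2 \<in> borel_measurable lebesgue"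
  proof -
    have "(\<lambda>s. min (b1 s) bb) \<in> borel_measurable (lebesgue_on {t0..})" using b1(1) by measurable
    then show ?thesis unfolding b2_def by (subst borel_measurable_if) auto
  qed
  have b2_bound: "\<bar>b2 t\<bar> \<le> bb" for t
    using b1(2)[of t] \<open>\<beta> > 0\<close> \<open>bb > 0\<close> by (auto simp: b2_def)
  have main: "\<bar>x t\<bar> \<le> M * D * exp (- \<gamma> * (t - \<sigma>))"
    if "t0 \<le> \<sigma>" and init: "initial_data \<sigma> \<phi> \<psi>" and sol: "neutral_solution l a g b h \<sigma> \<phi> \<psi> x" and "\<sigma> \<le> t"
      and D: "D = (SUP s\<in>{..\<sigma>}. \<bar>\<phi> s\<bar> + (if s < \<sigma> then \<bar>\<psi> s\<bar> else 0))"
    for \<sigma> \<phi> \<psi> x t D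
  proof -
    obtain N where N: "negligible N" "\<And>c. \<exists>L. L-lipschitz_on {\<sigma>..c} x"
      "\<And>t. \<sigma> < t \<Longrightarrow> t \<notin> N \<Longrightarrow> (x has_real_derivative deriv x t) (at t)"
      "\<And>c. \<exists>C. \<forall>t. \<sigma> < t \<longrightarrow> t < c \<longrightarrow> t \<notin> N \<longrightarrow> \<bar>deriv x t\<bar> \<le> C"
      "\<And>t. \<sigma> < t \<Longrightarrow> t \<notin> N \<Longrightarrow>
        deriv x t - (\<Sum>k=1..l. a k t * (if g k t < \<sigma> then \<psi> (g k t) else deriv x (g k t)))
          = - b t * (if h t \<le> \<sigma> then \<phi> (h t) else x (h t))"
      using neutral_solution_regularity[OF sol] by blast
    define B where "B = (\<lambda>t. integral {\<sigma>..t} b2)"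
    define ZB where "ZB n = {t \<in> {\<sigma><..<\<sigma> + real n}. \<not> (\<exists>D\<ge>b2 t. (B has_real_derivative D) (at t))}" for n
    define Za where "Za k = {t \<in> {t0..}. \<not> \<bar>a k t\<bar> \<le> \<alpha> k} \<union> {t \<in> {t0..}. \<not> \<bar>a k t\<bar> \<le> \<kappa> k * b1 t}" for k
    define Zb where "Zb = {t \<in> {t0..}. \<not> \<bar>b t\<bar> \<le> bb} \<union> {t \<in> {t0..}. \<not> \<bar>b t - b1 t\<bar> \<le> \<kappa>2 * b1 t}
      \<union> {t \<in> {t0..}. \<not> \<bar>b t\<bar> * (\<eta> t - h t) \<le> \<kappa>3 * b1 t}"
    define N' where "N' = N \<union> (\<Union>n. ZB n) \<union> (\<Union>k\<in>{1..l}. Za k) \<union> Zb"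
    have "negligible (ZB n)" for n
      unfolding ZB_def B_def by (rule integral_deriv_ge_AE[OF b2 b2_bound])
    moreover have "negligible (\<Union>k\<in>{1..l}. Za k)"
      unfolding Za_def using \<alpha>(2) \<kappa>(2) by (intro negligible_Union) auto
    moreover have "negligible Zb" unfolding Zb_def using b \<kappa>2(2) \<kappa>3(2) by (intro negligible_Un)
    ultimately have N': "negligible N'"
      unfolding N'_def using N(1) by (intro negligible_Un negligible_Union_nat)
    \<comment> \<open>Off the null set \<open>b1 t \<le> b t \<le> bb\<close>, so the truncation is
      inactive there.\<close>
    have eqb: "b2 t = b1 t" if "\<sigma> < t" "t \<notin> N'" for t
      using that b1(2)[of t] \<open>t0 \<le> \<sigma>\<close> by (auto simp: N'_def Zb_def b2_def)
    have "neutral_estimates l a g b h \<phi> \<psi> x \<sigma> \<Delta> D \<beta>' bb S \<kappa>2 \<kappa>3 N' \<alpha> \<kappa> b2 \<eta> B bb"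
    proof
      show "\<bar>\<phi> s\<bar> \<le> D" if "s \<le> \<sigma>" for s unfolding D by (rule initial_data_bound(1)[OF init that])
      show "\<bar>\<psi> s\<bar> \<le> D" if "s < \<sigma>" for s unfolding D by (rule initial_data_bound(2)[OF init that])
      show "negligible {t \<in> {\<sigma>..}. g k t \<in> Z}" if "k \<in> {1..l}" "negligible Z" for k Z
        by (rule negligible_subset[OF g_null[OF that]]) (use \<open>t0 \<le> \<sigma>\<close> \<open>t0 \<ge> 0\<close> in auto)
      show "x \<sigma> = \<phi> \<sigma>" using sol by (simp add: neutral_solution_def)
      show "\<exists>L. L-lipschitz_on {\<sigma>..c} x" for c by (rule N(2))
      show "bb-lipschitz_on {\<sigma>..c} B" for c
        unfolding B_def by (rule integral_lipschitz[OF b2 b2_bound])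
      show "\<exists>C. \<forall>t. \<sigma> < t \<longrightarrow> t < c \<longrightarrow> t \<notin> N' \<longrightarrow> \<bar>deriv x t\<bar> \<le> C" for c
        using N(4)[of c] by (auto simp: N'_def)
      fix t assume t: "\<sigma> < t"
      then have t0: "t0 \<le> t" "0 \<le> t" using \<open>t0 \<le> \<sigma>\<close> \<open>t0 \<ge> 0\<close> by auto
      show "h t \<le> t \<and> t - h t \<le> \<Delta>" using h[OF t0(2)] \<Delta> by auto
      show "g k t \<le> t \<and> t - g k t \<le> \<Delta>" if "k \<in> {1..l}" for k
        using g[OF that t0(2)] \<delta>[OF that] by auto
      show "h t \<le> \<eta> t \<and> \<eta> t \<le> t" by (rule \<eta>[OF t0(2)])
      show "\<beta>' \<le> b2 t" using b1(2)[OF t0(1)] t0 by (auto simp: \<beta>'_def b2_def)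
      show "B t - B (\<eta> t) \<le> 1 / exp 1" if "\<sigma> \<le> \<eta> t"
      proof -
        have "B t - B (\<eta> t) = integral {\<eta> t..t} b2"
          unfolding B_def using that \<eta>[OF t0(2)] by (intro integral_increment[OF b2 b2_bound]) auto
        then show ?thesis using int[OF t0(1)] that \<open>t0 \<le> \<sigma>\<close> by (simp add: b2_def)
      qed
      assume tN: "t \<notin> N'"
      show "(x has_real_derivative deriv x t) (at t)" using N(3) t tN by (simp add: N'_def)
      show "deriv x t - (\<Sum>k=1..l. a k t * (if g k t < \<sigma> then \<psi> (g k t) else deriv x (g k t)))
          = - b t * (if h t \<le> \<sigma> then \<phi> (h t) else x (h t))"
        using t tN by (intro N(5)) (auto simp: N'_def)
      show "\<bar>b t\<bar> \<le> bb" using tN t0 by (auto simp: N'_def Zb_def)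
      show "b2 t \<le> bb" by (rule order_trans[OF abs_ge_self b2_bound])
      show "\<bar>a k t\<bar> \<le> \<alpha> k" if "k \<in> {1..l}" for k using tN t0 that by (auto simp: N'_def Za_def)
      show "\<bar>a k t\<bar> \<le> \<kappa> k * b2 t" if "k \<in> {1..l}" for k
        using tN t0 that unfolding eqb[OF t tN] by (auto simp: N'_def Za_def)
      show "\<bar>b t - b2 t\<bar> \<le> \<kappa>2 * b2 t"
        using tN t0 unfolding eqb[OF t tN] by (auto simp: N'_def Zb_def)
      show "\<bar>b t\<bar> * (\<eta> t - h t) \<le> \<kappa>3 * b2 t"
        using tN t0 unfolding eqb[OF t tN] by (auto simp: N'_def Zb_def)
      show "\<exists>D\<ge>b2 t. (B has_real_derivative D) (at t)"
      proof -
        obtain n where "t - \<sigma> < real n" using reals_Archimedean2 by blast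
        then have "t < \<sigma> + real n" by simp
        then show ?thesis using tN t unfolding N'_def ZB_def by auto
      qed
    qed (use \<Delta> N' \<open>bb > 0\<close> \<beta>' \<alpha> S in auto)
    from neutral_estimates.exponential_decay[OF this \<gamma>(1,2) \<open>\<sigma> \<le> t\<close> \<rho>_def \<gamma>(3)[folded \<rho>_def] \<kappa>0_def \<kappa>0 \<kappa>2(1)
        \<theta>_def \<gamma>(4)[folded \<rho>_def, folded \<theta>_def] C_def]
    show ?thesis by (simp add: M_def)
  qed
  show ?thesis
    unfolding exponentially_stable_def
  \<comment> \<open>\<open>\<bar>M\<bar> + 1\<close> is positive whatever the sign of
    \<open>M\<close>, as the definition of stability demands.\<close>
  proof (rule exI[of _ "\<bar>M\<bar> + 1"], rule conjI[OF _ exI[of _ \<gamma>]], simp, intro conjI allI impI)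
    fix \<sigma> \<phi> \<psi> x t
    assume *: "t0 \<le> \<sigma>" "initial_data \<sigma> \<phi> \<psi>" "neutral_solution l a g b h \<sigma> \<phi> \<psi> x" "\<sigma> \<le> t"
    define D where "D = (SUP s\<in>{..\<sigma>}. \<bar>\<phi> s\<bar> + (if s < \<sigma> then \<bar>\<psi> s\<bar> else 0))"
    have "0 \<le> D" using initial_data_bound(1)[OF *(2), of \<sigma>] by (simp add: D_def)
    have "\<bar>x t\<bar> \<le> M * D * exp (- \<gamma> * (t - \<sigma>))" by (rule main[OF * D_def])
    also have "\<dots> \<le> (\<bar>M\<bar> + 1) * D * exp (- \<gamma> * (t - \<sigma>))"
      using \<open>0 \<le> D\<close> by (intro mult_right_mono) auto
    finally show "\<bar>x t\<bar> \<le> (\<bar>M\<bar> + 1) * exp (- \<gamma> * (t - \<sigma>)) * (SUP s\<in>{..\<sigma>}. \<bar>\<phi> s\<bar> + (if s < \<sigma> then \<bar>\<psi> s\<bar> else 0))"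
      by (simp add: D_def mult_ac)
  qed (rule \<gamma>(1))
qed

text \<open>The lower bound \<open>\<beta>\<close> of the denominator makes the quotient essentially
  bounded, so its norm is a genuine bound and may be multiplied back by
  \<open>c t > 0\<close>.\<close>

lemma ess_norm_quotient:
  assumes f: "f \<in> borel_measurable (lebesgue_on {t0..})" "negligible {t \<in> {t0..}. \<not> \<bar>f t\<bar> \<le> C}"
    and c: "c \<in> borel_measurable (lebesgue_on {t0..})" "\<beta> > 0" "\<And>t. t \<ge> t0 \<Longrightarrow> \<beta> \<le> c t"
  shows "0 \<le> ess_norm t0 (\<lambda>t. f t / c t)"
    and "negligible {t \<in> {t0..}. \<not> \<bar>f t\<bar> \<le> ess_norm t0 (\<lambda>t. f t / c t) * c t}"
proof -
  have meas: "(\<lambda>t. f t / c t) \<in> borel_measurable (lebesgue_on {t0..})" using f(1) c(1) by measurable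
  have bnd: "negligible {t \<in> {t0..}. \<not> \<bar>f t / c t\<bar> \<le> C / \<beta>}"
  proof (rule negligible_subset[OF f(2)], rule subsetI, rule ccontr)
    fix t assume t: "t \<in> {t \<in> {t0..}. \<not> \<bar>f t / c t\<bar> \<le> C / \<beta>}"
      and "t \<notin> {t \<in> {t0..}. \<not> \<bar>f t\<bar> \<le> C}"
    then have "\<bar>f t\<bar> / \<bar>c t\<bar> \<le> C / \<beta>" using c(2) c(3)[of t] by (intro frac_le) auto
    then show False using t by (simp add: abs_divide)
  qed
  show "0 \<le> ess_norm t0 (\<lambda>t. f t / c t)" by (rule ess_norm_ge[OF meas bnd]) simp
  show "negligible {t \<in> {t0..}. \<not> \<bar>f t\<bar> \<le> ess_norm t0 (\<lambda>t. f t / c t) * c t}"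
  proof (rule negligible_subset[OF ess_norm_bound[OF meas bnd]], rule subsetI, rule ccontr)
    fix t assume t: "t \<in> {t \<in> {t0..}. \<not> \<bar>f t\<bar> \<le> ess_norm t0 (\<lambda>t. f t / c t) * c t}"
      "t \<notin> {t \<in> {t0..}. \<not> \<bar>f t / c t\<bar> \<le> ess_norm t0 (\<lambda>t. f t / c t)}"
    then have "c t > 0" using t c(2) c(3)[of t] by auto
    then show False using t by (simp add: abs_divide pos_divide_le_eq)
  qed
qed

section \<open>The three smallness conditions\<close>

theorem theorem5p1:
  fixes t0 A0 \<tau> \<beta> S :: real and l :: nat
    and a g :: "nat \<Rightarrow> real \<Rightarrow> real" and b h b0 :: "real \<Rightarrow> real"
    and \<delta> :: "nat \<Rightarrow> real"
  assumes "t0 \<ge> 0" and "l \<ge> 1"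
    and "\<And>k. k \<in> {1..l} \<Longrightarrow> a k \<in> borel_measurable (lebesgue_on {0..})"
    and "\<And>k. k \<in> {1..l} \<Longrightarrow> g k \<in> borel_measurable (lebesgue_on {0..})"
    and "b \<in> borel_measurable (lebesgue_on {0..})"
    and "h \<in> borel_measurable (lebesgue_on {0..})"
    and "\<And>k. k \<in> {1..l} \<Longrightarrow> ess_bounded_on {0..} (a k)"
    and "ess_bounded_on {0..} b"
    and "S = (\<Sum>k=1..l. ess_norm t0 (a k))"
    and "S \<le> A0" and "A0 < 1"
    and "\<And>t. t \<ge> t0 \<Longrightarrow> b t \<ge> 0"
    and "\<And>k t. k \<in> {1..l} \<Longrightarrow> t \<ge> 0 \<Longrightarrow> 0 \<le> t - g k t \<and> t - g k t \<le> \<delta> k"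
    and "\<tau> > 0"
    and "\<And>t. t \<ge> 0 \<Longrightarrow> 0 \<le> t - h t \<and> t - h t \<le> \<tau>"
    and "\<And>k E. k \<in> {1..l} \<Longrightarrow> negligible E \<Longrightarrow> negligible {t \<in> {0..}. g k t \<in> E}"
    and "\<beta> > 0" and "\<And>t. t \<ge> t0 \<Longrightarrow> b t \<ge> \<beta>"
    and "b0 = (\<lambda>t. min (b t) (1 / (\<tau> * exp 1)))"
    and "((\<forall>t\<ge>t0. (LINT s:{h t..t}|lebesgue. (if s < 0 then 0 else b s)) \<le> 1 / exp 1) \<and>
          S + ess_norm t0 b * (\<Sum>k=1..l. ess_norm t0 (\<lambda>t. a k t / b t)) < 1)
       \<or> (\<Sum>k=1..l. ess_norm t0 (\<lambda>t. a k t / b0 t)) * (ess_norm t0 b / (1 - S))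
          + ess_norm t0 (\<lambda>t. (b t - b0 t) / b0 t) < 1
       \<or> ess_norm t0 b * ((\<Sum>k=1..l. ess_norm t0 (\<lambda>t. a k t / b t))
          + ess_norm t0 (\<lambda>t. max (t - h t - 1 / (ess_norm t0 b * exp 1)) 0)) < 1 - S"
  shows "exponentially_stable t0 l a g b h"
proof -
  have R: "f \<in> borel_measurable (lebesgue_on {t0..})" if "f \<in> borel_measurable (lebesgue_on {0..})" for f :: "real \<Rightarrow> real"
    using that \<open>t0 \<ge> 0\<close> by (elim measurable_restrict_mono) auto
  have bnd: "\<exists>C. negligible {t \<in> {t0..}. \<not> \<bar>f t\<bar> \<le> C}" if "ess_bounded_on {0..} f" for f
  proof -
    obtain C where "negligible {t \<in> {0..}. \<not> \<bar>f t\<bar> \<le> C}"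
      using \<open>ess_bounded_on {0..} f\<close> unfolding ess_bounded_on_def by (auto simp: AE_lebesgue_on_iff_negligible)
    then have "negligible {t \<in> {t0..}. \<not> \<bar>f t\<bar> \<le> C}"
      by (rule negligible_subset) (use \<open>t0 \<ge> 0\<close> in auto)
    then show ?thesis ..
  qed
  note a_meas = R[OF assms(3)] and b_meas = R[OF assms(5)] and h_meas = R[OF assms(6)]
  note a_bnd = bnd[OF assms(7)] and b_bnd = bnd[OF assms(8)]
  note b_ge = assms(18)
  define bb where "bb = ess_norm t0 b"
  obtain Cb where Cb: "negligible {t \<in> {t0..}. \<not> \<bar>b t\<bar> \<le> Cb}" using b_bnd by blast
  have bb: "negligible {t \<in> {t0..}. \<not> \<bar>b t\<bar> \<le> bb}"
    unfolding bb_def by (rule ess_norm_bound[OF b_meas Cb])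
  have "\<beta> \<le> bb" unfolding bb_def
    by (rule ess_norm_ge[OF b_meas Cb]) (use b_ge in \<open>auto intro: order_trans[OF _ abs_ge_self]\<close>)
  then have "bb > 0" using \<open>\<beta> > 0\<close> by simp
  have \<alpha>: "0 \<le> ess_norm t0 (a k)" "negligible {t \<in> {t0..}. \<not> \<bar>a k t\<bar> \<le> ess_norm t0 (a k)}"
    if k: "k \<in> {1..l}" for k
  proof -
    obtain C where C: "negligible {t \<in> {t0..}. \<not> \<bar>a k t\<bar> \<le> C}" using a_bnd[OF k] by blast
    show "0 \<le> ess_norm t0 (a k)" by (rule ess_norm_ge[OF a_meas[OF k] C]) simp
    show "negligible {t \<in> {t0..}. \<not> \<bar>a k t\<bar> \<le> ess_norm t0 (a k)}" by (rule ess_norm_bound[OF a_meas[OF k] C])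
  qed
  have "S < 1" using \<open>S \<le> A0\<close> \<open>A0 < 1\<close> by simp
  have \<kappa>: "0 \<le> ess_norm t0 (\<lambda>t. a k t / c t)" 
      "negligible {t \<in> {t0..}. \<not> \<bar>a k t\<bar> \<le> ess_norm t0 (\<lambda>t. a k t / c t) * c t}"
    if k: "k \<in> {1..l}" and c: "c \<in> borel_measurable (lebesgue_on {t0..})" "\<beta>' > 0" "\<And>t. t \<ge> t0 \<Longrightarrow> \<beta>' \<le> c t"
    for k c \<beta>'
  proof -
    obtain C where C: "negligible {t \<in> {t0..}. \<not> \<bar>a k t\<bar> \<le> C}" using a_bnd[OF k] by blast
    show "0 \<le> ess_norm t0 (\<lambda>t. a k t / c t)" 
      "negligible {t \<in> {t0..}. \<not> \<bar>a k t\<bar> \<le> ess_norm t0 (\<lambda>t. a k t / c t) * c t}"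
      using ess_norm_quotient[OF a_meas[OF k] C c] by auto
  qed
  have b2: "(\<lambda>s. if s \<in> {t0..} then min (c s) bb else 0) \<in> borel_measurable lebesgue"
    "\<bar>if s \<in> {t0..} then min (c s) bb else 0\<bar> \<le> bb"
    if "c \<in> borel_measurable (lebesgue_on {t0..})" "\<And>t. t \<ge> t0 \<Longrightarrow> 0 \<le> c t" for c s
  proof -
    have "(\<lambda>s. min (c s) bb) \<in> borel_measurable (lebesgue_on {t0..})" using that(1) by measurable
    then show "(\<lambda>s. if s \<in> {t0..} then min (c s) bb else 0) \<in> borel_measurable lebesgue"
      by (subst borel_measurable_if) auto
    show "\<bar>if s \<in> {t0..} then min (c s) bb else 0\<bar> \<le> bb" using that(2)[of s] \<open>bb > 0\<close> by auto
  qed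
  have int_le: "integral {u..t} (\<lambda>s. if s \<in> {t0..} then min (c s) bb else 0) \<le> d * (t - u)"
    if "c \<in> borel_measurable (lebesgue_on {t0..})" "\<And>t. t \<ge> t0 \<Longrightarrow> 0 \<le> c t" "u \<le> t" 
      "\<And>t. t \<ge> t0 \<Longrightarrow> min (c t) bb \<le> d" "0 \<le> d" for c u t d
  proof -
    have "integral {u..t} (\<lambda>s. if s \<in> {t0..} then min (c s) bb else 0) \<le> integral {u..t} (\<lambda>_. d)"
      using bounded_measurable_integrable_on_Icc[OF b2[OF that(1,2)]] that(4,5) by (intro integral_le) auto
    then show ?thesis using \<open>u \<le> t\<close> by (simp add: mult.commute)
  qed
  \<comment> \<open>The reduction with the norms of the theorem inserted: a case only has to provide
    the coefficient \<open>c\<close>, the delayed argument \<open>\<eta>\<close>, and the defects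
    \<open>\<mu>\<close> and \<open>\<nu>\<close>.\<close>
  have stab: "exponentially_stable t0 l a g b h"
    if c: "\<beta>' > 0" "c \<in> borel_measurable (lebesgue_on {t0..})" "\<And>t. t \<ge> t0 \<Longrightarrow> \<beta>' \<le> c t \<and> c t \<le> b t"
      and \<eta>: "\<And>t. t \<ge> 0 \<Longrightarrow> h t \<le> \<eta> t \<and> \<eta> t \<le> t"
      and int: "\<And>t. t \<ge> t0 \<Longrightarrow> t0 \<le> \<eta> t \<Longrightarrow>
        integral {\<eta> t..t} (\<lambda>s. if s \<in> {t0..} then min (c s) bb else 0) \<le> 1 / exp 1"
      and \<mu>: "0 \<le> \<mu>" "negligible {t \<in> {t0..}. \<not> \<bar>b t - c t\<bar> \<le> \<mu> * c t}"
      and \<nu>: "0 \<le> \<nu>" "negligible {t \<in> {t0..}. \<not> \<bar>b t\<bar> * (\<eta> t - h t) \<le> \<nu> * c t}"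
      and small: "((\<Sum>k=1..l. ess_norm t0 (\<lambda>t. a k t / c t)) + \<nu>) * (bb / (1 - S)) + \<mu> < 1"
    for \<beta>' c \<eta> \<mu> \<nu>
  proof (rule stability_by_comparison[where \<alpha> = "\<lambda>k. ess_norm t0 (a k)" and \<delta> = \<delta>
        and \<kappa> = "\<lambda>k. ess_norm t0 (\<lambda>t. a k t / c t)", OF \<open>t0 \<ge> 0\<close> \<open>\<tau> > 0\<close> c(1) \<open>bb > 0\<close>])
    have c': "\<And>t. t \<ge> t0 \<Longrightarrow> \<beta>' \<le> c t" using c(3) by blast
    show "0 \<le> ess_norm t0 (\<lambda>t. a k t / c t)" if "k \<in> {1..l}" for k by (rule \<kappa>(1)[OF that c(2,1) c'])
    show "negligible {t \<in> {t0..}. \<not> \<bar>a k t\<bar> \<le> ess_norm t0 (\<lambda>t. a k t / c t) * c t}" if "k \<in> {1..l}" for k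
      by (rule \<kappa>(2)[OF that c(2,1) c'])
  qed (fact assms(13) assms(16) assms(15) \<alpha> assms(9) \<open>S < 1\<close> bb c(2,3) \<eta> int \<mu> \<nu> small)+
  note cond = assms(20)[folded bb_def]
  have b_nonneg: "t \<ge> t0 \<Longrightarrow> 0 \<le> b t" for t by (rule assms(12))
  from cond show ?thesis
  proof (elim disjE conjE)
    assume i: "\<forall>t\<ge>t0. (LINT s:{h t..t}|lebesgue. (if s < 0 then 0 else b s)) \<le> 1 / exp 1"
      and small: "S + bb * (\<Sum>k=1..l. ess_norm t0 (\<lambda>t. a k t / b t)) < 1"
    show ?thesis
    proof (rule stab[OF \<open>\<beta> > 0\<close> b_meas, where \<eta> = h and \<mu> = 0 and \<nu> = 0])
      show "integral {h t..t} (\<lambda>s. if s \<in> {t0..} then min (b s) bb else 0) \<le> 1 / exp 1"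
        if t: "t \<ge> t0" "t0 \<le> h t" for t
      proof -
        define f where "f = (\<lambda>s. if s \<in> {t0..} then min (b s) bb else 0)"
        define f0 where "f0 = (\<lambda>s. if s < 0 then 0 else b s)"
        have f: "f \<in> borel_measurable lebesgue" "\<And>s. \<bar>f s\<bar> \<le> bb"
          unfolding f_def using b2[OF b_meas b_nonneg] by auto
        \<comment> \<open>Condition (i) speaks of the Lebesgue integral of \<open>b\<close> itself,
          the comparison of the gauge integral of the truncated coefficient. The integrands agree
          off a null set, and absolute integrability, carried from the bounded \<open>f\<close> to
          \<open>f0\<close>, identifies the two integrals.\<close>
        have f_int: "f absolutely_integrable_on {h t..t}"
          by (rule measurable_bounded_by_integrable_imp_absolutely_integrable[where g = "\<lambda>_. bb"])
            (use f in \<open>auto intro: measurable_restrict_space1\<close>)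
        have eq: "f0 s = f s" if "s \<in> {h t..t} - {t \<in> {t0..}. \<not> \<bar>b t\<bar> \<le> bb}" for s
          using that t \<open>t0 \<ge> 0\<close> by (auto simp: f_def f0_def)
        have "f0 absolutely_integrable_on {h t..t}" using f_int bb eq by (rule absolutely_integrable_spike)
        then have "(LINT s:{h t..t}|lebesgue. f0 s) = integral {h t..t} f0"
          by (rule set_lebesgue_integral_eq_integral(2))
        also have "\<dots> = integral {h t..t} f" using eq by (intro integral_spike[OF bb]) auto
        finally show ?thesis using i t unfolding f_def f0_def by auto
      qed
      have "(\<Sum>k=1..l. ess_norm t0 (\<lambda>t. a k t / b t)) * bb < 1 - S" using small by (simp add: mult.commute)
      then show "((\<Sum>k=1..l. ess_norm t0 (\<lambda>t. a k t / b t)) + 0) * (bb / (1 - S)) + 0 < 1"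
        using \<open>S < 1\<close> by (simp add: pos_divide_less_eq)
    qed (use b_ge assms(15) in auto)
  next
    assume small: "(\<Sum>k=1..l. ess_norm t0 (\<lambda>t. a k t / b0 t)) * (bb / (1 - S))
      + ess_norm t0 (\<lambda>t. (b t - b0 t) / b0 t) < 1"
    \<comment> \<open>\<open>b0\<close> inherits a positive lower bound, since both entries of its
      minimum have one.\<close>
    define \<beta>' where "\<beta>' = min \<beta> (1 / (\<tau> * exp 1))"
    have "\<beta>' > 0" using \<open>\<beta> > 0\<close> \<open>\<tau> > 0\<close> by (simp add: \<beta>'_def)
    have b0_meas: "b0 \<in> borel_measurable (lebesgue_on {t0..})"
      unfolding assms(19) using b_meas by measurable
    have b0_ge: "\<beta>' \<le> b0 t" if "t \<ge> t0" for t using b_ge[OF that] by (auto simp: \<beta>'_def assms(19))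
    have b0_nonneg: "0 \<le> b0 t" if "t \<ge> t0" for t using b0_ge[OF that] \<open>\<beta>' > 0\<close> by simp
    have bb0: "negligible {t \<in> {t0..}. \<not> \<bar>b t - b0 t\<bar> \<le> bb}"
    proof (rule negligible_subset[OF bb], safe)
      fix t assume t: "t0 \<le> t" "\<not> \<bar>b t - b0 t\<bar> \<le> bb" "\<bar>b t\<bar> \<le> bb"
      have "b0 t \<le> b t" by (simp add: assms(19))
      then show False using b0_nonneg[OF t(1)] t by linarith
    qed
    have "(\<lambda>t. b t - b0 t) \<in> borel_measurable (lebesgue_on {t0..})" using b_meas b0_meas by measurable
    note \<kappa>2 = ess_norm_quotient[OF this bb0 b0_meas \<open>\<beta>' > 0\<close> b0_ge]
    show ?thesis
    proof (rule stab[OF \<open>\<beta>' > 0\<close> b0_meas, where \<eta> = h and \<mu> = "ess_norm t0 (\<lambda>t. (b t - b0 t) / b0 t)" and \<nu> = 0])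
      show "integral {h t..t} (\<lambda>s. if s \<in> {t0..} then min (b0 s) bb else 0) \<le> 1 / exp 1"
        if t: "t \<ge> t0" "t0 \<le> h t" for t
      proof -
        have ht: "0 \<le> t - h t" "t - h t \<le> \<tau>" using assms(15)[of t] t \<open>t0 \<ge> 0\<close> by auto
        \<comment> \<open>The reason for the cap in \<open>b0\<close>: over a window of length at
          most \<open>\<tau>\<close> it integrates to at most 1/e.\<close>
        have "integral {h t..t} (\<lambda>s. if s \<in> {t0..} then min (b0 s) bb else 0) \<le> 1 / (\<tau> * exp 1) * (t - h t)"
          using ht \<open>\<tau> > 0\<close> b0_nonneg by (intro int_le[OF b0_meas]) (auto simp: assms(19))
        also have "\<dots> \<le> 1 / (\<tau> * exp 1) * \<tau>" using ht \<open>\<tau> > 0\<close> by (intro mult_left_mono) auto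
        finally show ?thesis using \<open>\<tau> > 0\<close> by simp
      qed
    qed (use small b0_ge assms(15) \<kappa>2 in \<open>auto simp: assms(19)\<close>)
  next
    assume small: "bb * ((\<Sum>k=1..l. ess_norm t0 (\<lambda>t. a k t / b t))
      + ess_norm t0 (\<lambda>t. max (t - h t - 1 / (bb * exp 1)) 0)) < 1 - S"
    \<comment> \<open>The longest window over which a coefficient bounded by \<open>bb\<close> is
      certain to integrate to at most 1/e. Cutting the delay there gives \<open>\<eta>\<close>, and
      the excess delay \<open>f\<close> becomes the defect \<open>\<nu>\<close>.\<close>
    define q where "q = 1 / (bb * exp 1)"
    have "q > 0" using \<open>bb > 0\<close> by (simp add: q_def)
    define \<eta> where "\<eta> = (\<lambda>t. max (h t) (t - q))"
    define f where "f = (\<lambda>t. max (t - h t - q) 0)"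
    have "(\<lambda>t::real. t) \<in> borel_measurable (lebesgue_on {t0..})"
      by (intro measurable_restrict_space1 measurable_completion) simp
    then have f_meas: "f \<in> borel_measurable (lebesgue_on {t0..})" unfolding f_def using h_meas by measurable
    have f: "negligible {t \<in> {t0..}. \<not> \<bar>f t\<bar> \<le> \<tau>}"
    proof -
      have "\<bar>f t\<bar> \<le> \<tau>" if "t0 \<le> t" for t
        using assms(15)[of t] that \<open>t0 \<ge> 0\<close> \<open>q > 0\<close> \<open>\<tau> > 0\<close> by (simp add: f_def)
      then have "{t \<in> {t0..}. \<not> \<bar>f t\<bar> \<le> \<tau>} = {}" by auto
      then show ?thesis by (simp only: negligible_empty)
    qed
    have \<kappa>3: "0 \<le> ess_norm t0 f" by (rule ess_norm_ge[OF f_meas f]) simp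
    have \<kappa>3b: "negligible {t \<in> {t0..}. \<not> \<bar>b t\<bar> * (\<eta> t - h t) \<le> ess_norm t0 f * b t}"
    proof (rule negligible_subset[OF ess_norm_bound[OF f_meas f]], rule subsetI, rule ccontr)
      fix t assume t: "t \<in> {t \<in> {t0..}. \<not> \<bar>b t\<bar> * (\<eta> t - h t) \<le> ess_norm t0 f * b t}"
        "t \<notin> {t \<in> {t0..}. \<not> \<bar>f t\<bar> \<le> ess_norm t0 f}"
      have "\<eta> t - h t = f t" by (auto simp: \<eta>_def f_def)
      then have "b t * (\<eta> t - h t) \<le> b t * ess_norm t0 f"
        using t b_nonneg[of t] by (intro mult_left_mono) auto
      then show False using t b_nonneg[of t] by (simp add: mult.commute)
    qed
    show ?thesis
    proof (rule stab[OF \<open>\<beta> > 0\<close> b_meas, where \<eta> = \<eta> and \<mu> = 0 and \<nu> = "ess_norm t0 f"])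
      show \<eta>: "h t \<le> \<eta> t \<and> \<eta> t \<le> t" if "t \<ge> 0" for t
        using assms(15)[OF that] \<open>q > 0\<close> by (auto simp: \<eta>_def)
      show "integral {\<eta> t..t} (\<lambda>s. if s \<in> {t0..} then min (b s) bb else 0) \<le> 1 / exp 1"
        if t: "t \<ge> t0" "t0 \<le> \<eta> t" for t
      proof -
        have "integral {\<eta> t..t} (\<lambda>s. if s \<in> {t0..} then min (b s) bb else 0) \<le> bb * (t - \<eta> t)"
          using \<eta>[of t] t \<open>t0 \<ge> 0\<close> \<open>bb > 0\<close> b_nonneg by (intro int_le[OF b_meas]) auto
        also have "\<dots> \<le> bb * q" using \<open>bb > 0\<close> by (intro mult_left_mono) (auto simp: \<eta>_def)
        finally show ?thesis using \<open>bb > 0\<close> by (simp add: q_def)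
      qed
      have "((\<Sum>k=1..l. ess_norm t0 (\<lambda>t. a k t / b t)) + ess_norm t0 f) * bb < 1 - S"
        using small by (simp add: f_def q_def mult.commute)
      then show "((\<Sum>k=1..l. ess_norm t0 (\<lambda>t. a k t / b t)) + ess_norm t0 f) * (bb / (1 - S)) + 0 < 1"
        using \<open>S < 1\<close> by (simp add: pos_divide_less_eq)
    qed (use b_ge \<kappa>3 \<kappa>3b in auto)
  qed
qed

end
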